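(* Let $d\ge1$, let $X_1,\dots,X_n\in\mathbb{R}^d$ be fixed, let $\pi^*$ be an unknown permutation of $\{1,\dots,n\}$ and let $Y_i=f^*(X_{\pi^*(i)})+\epsilon_i$, $1\le i\le n$, where $\epsilon_1,\dots,\epsilon_n$ are i.i.d. $N(0,\sigma^2I_d)$ with $\sigma>0$ known. Assume $f^*=\nabla\psi_{f^*}$ for a differentiable $\psi_{f^*}:\mathbb{R}^d\to\mathbb{R}$ satisfying: (A1) $\psi_{f^*}(z)\ge\psi_{f^*}(x)+\langle\nabla\psi_{f^*}(x),z-x\rangle+\frac{\lambda}{2}\|x-z\|_2^2$ for all $x,z$ (some $\lambda>0$); (A2) $\psi_{f^*}(z)\le\psi_{f^*}(x)+\langle\nabla\psi_{f^*}(x),z-x\rangle+\frac{L}{2}\|x-z\|_2^2$ for all $x,z$ (some $L>0$); (A3) $\max_{1\le i\le n}\|f^*(X_i)\|_2\le B$ for some $0<B<\infty$. Let $\widehat f(X_1),\dots,\widehat f(X_n)$ be the output of the denoising procedure described in the context. Then there are constants $C_0,C>0$ depending only on $d,B,\sigma$ such that if $n\ge C_0(\log n)^{d+1}$, then with probability at least $1-5/n$, $$\frac1n\sum_{i=1}^n\|\widehat f(X_i)-f^*(X_i)\|_2^2\le C\,\frac{L}{\lambda}\,\frac{1}{\log n}.$$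
   Context: Let $\varphi_\sigma$ denote the density of $N(0,\sigma^2I_d)$. Denoising procedure: (1) Compute the Kiefer–Wolfowitz nonparametric maximum likelihood estimator (NPMLE), i.e. a minimizer $\widehat{\mathsf f}_n$ of $-\sum_{i=1}^n\log\mathsf f(Y_i)$ over all densities of the form $\mathsf f(y)=\int\varphi_\sigma(y-\theta)\,d\nu(\theta)$ with $\nu$ a probability distribution on $\mathbb{R}^d$; the associated mixing measure is atomic, $\widehat\nu=\sum_{j=1}^p\widehat\alpha_j\delta_{\widehat\theta_j}$ with $\widehat\alpha_j>0$, $\sum_j\widehat\alpha_j=1$. (2) Compute an optimal coupling matrix $\widehat\Gamma\in\mathbb{R}_+^{n\times p}$ minimizing $\sum_{i,j}\Gamma_{ij}\frac12\|X_i-\widehat\theta_j\|_2^2$ subject to $\sum_i\Gamma_{ij}=\widehat\alpha_j$ for all $j$ and $\sum_j\Gamma_{ij}=1/n$ for all $i$. (3) Output the barycentric projection $\widehat f(X_i)=n\sum_{j=1}^p\widehat\Gamma_{ij}\widehat\theta_j$, $1\le i\le n$. *)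

theory Defs
  imports "HOL-Probability.Probability"
begin

definition gdens :: "real \<Rightarrow> 'a::euclidean_space \<Rightarrow> real" where
  "gdens \<sigma> y = (2 * pi * \<sigma>\<^sup>2) powr (- real DIM('a) / 2) * exp (- (norm y)\<^sup>2 / (2 * \<sigma>\<^sup>2))"

definition gauss_vec :: "real \<Rightarrow> 'a::euclidean_space measure" where
  "gauss_vec \<sigma> = density lborel (\<lambda>y. ennreal (gdens \<sigma> y))"

definition mixture_dens :: "real \<Rightarrow> 'a::euclidean_space measure \<Rightarrow> 'a \<Rightarrow> real" where
  "mixture_dens \<sigma> \<nu> y = (\<integral>\<theta>. gdens \<sigma> (y - \<theta>) \<partial>\<nu>)"

text \<open>(p, alpha, theta) is an atomic Kiefer--Wolfowitz NPMLE for the data Y_0..Y_{n-1}: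
  the atomic mixing distribution sum_j alpha_j delta_{theta_j} maximises the log-likelihood
  over all Borel probability measures on R^d.\<close>
definition is_npmle :: "real \<Rightarrow> nat \<Rightarrow> (nat \<Rightarrow> 'a::euclidean_space) \<Rightarrow> nat \<Rightarrow> (nat \<Rightarrow> real) \<Rightarrow> (nat \<Rightarrow> 'a) \<Rightarrow> bool" where
  "is_npmle \<sigma> n Y p \<alpha> \<theta> \<longleftrightarrow>
     (\<forall>j<p. \<alpha> j > 0) \<and> (\<Sum>j<p. \<alpha> j) = 1 \<and>
     (\<forall>\<nu>. prob_space \<nu> \<and> sets \<nu> = sets borel \<longrightarrow>
        - (\<Sum>i<n. ln (\<Sum>j<p. \<alpha> j * gdens \<sigma> (Y i - \<theta> j)))
        \<le> - (\<Sum>i<n. ln (mixture_dens \<sigma> \<nu> (Y i))))"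

definition is_coupling :: "nat \<Rightarrow> nat \<Rightarrow> (nat \<Rightarrow> real) \<Rightarrow> (nat \<Rightarrow> nat \<Rightarrow> real) \<Rightarrow> bool" where
  "is_coupling n p \<alpha> \<Gamma> \<longleftrightarrow>
     (\<forall>i<n. \<forall>j<p. \<Gamma> i j \<ge> 0) \<and>
     (\<forall>j<p. (\<Sum>i<n. \<Gamma> i j) = \<alpha> j) \<and>
     (\<forall>i<n. (\<Sum>j<p. \<Gamma> i j) = 1 / real n)"

definition coupling_cost :: "nat \<Rightarrow> nat \<Rightarrow> (nat \<Rightarrow> 'a::euclidean_space) \<Rightarrow> (nat \<Rightarrow> 'a) \<Rightarrow> (nat \<Rightarrow> nat \<Rightarrow> real) \<Rightarrow> real" where
  "coupling_cost n p X \<theta> \<Gamma> = (\<Sum>i<n. \<Sum>j<p. \<Gamma> i j * ((1/2) * (norm (X i - \<theta> j))\<^sup>2))"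

definition is_opt_coupling :: "nat \<Rightarrow> nat \<Rightarrow> (nat \<Rightarrow> 'a::euclidean_space) \<Rightarrow> (nat \<Rightarrow> 'a) \<Rightarrow> (nat \<Rightarrow> real) \<Rightarrow> (nat \<Rightarrow> nat \<Rightarrow> real) \<Rightarrow> bool" where
  "is_opt_coupling n p X \<theta> \<alpha> \<Gamma> \<longleftrightarrow> is_coupling n p \<alpha> \<Gamma> \<and>
     (\<forall>\<Gamma>'. is_coupling n p \<alpha> \<Gamma>' \<longrightarrow> coupling_cost n p X \<theta> \<Gamma> \<le> coupling_cost n p X \<theta> \<Gamma>')"

definition bary_proj :: "nat \<Rightarrow> nat \<Rightarrow> (nat \<Rightarrow> nat \<Rightarrow> real) \<Rightarrow> (nat \<Rightarrow> 'a::euclidean_space) \<Rightarrow> nat \<Rightarrow> 'a" where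
  "bary_proj n p \<Gamma> \<theta> i = real n *\<^sub>R (\<Sum>j<p. \<Gamma> i j *\<^sub>R \<theta> j)"

end

theory Submission
  imports Defs "HOL-Library.Real_Mod" "HOL-Real_Asymp.Real_Asymp"
begin

text \<open>
  Bregman estimates bound the error of the barycentric projection by \<open>L / \<lambda>\<close> times the transport
  cost of any coupling between the uniform distribution on the \<open>f (X i)\<close> and the estimated mixing
  measure, so it suffices to find a coupling of cost \<open>O(1 / log n)\<close>.

  The likelihood inequality and \<open>ln x \<le> x - 1 - (sqrt x - 1)\<^sup>2\<close> bound the empirical Hellinger
  distance between the true and the estimated mixture density on a ball whose radius is a small
  multiple of \<open>\<sigma> sqrt (ln n)\<close>. All empirical averages involved are linear in the mixing measure,
  so Hoeffding's inequality on a grid of atoms gives uniformity, and the characteristic functions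
  of the two mixtures differ by a negative power of \<open>n\<close>. Dividing by the Gaussian factor keeps a
  negative power for the mixing measures at frequencies up to a small multiple of \<open>sqrt (ln n)\<close>.

  The atoms lie in the ball spanned by the data, of radius \<open>O(sqrt (ln n))\<close>. Both mixing measures
  are smoothed by Fejer--Korovkin kernels of degree of order \<open>ln n\<close> on a torus of that size: the
  smoothing costs \<open>O(1 / log n)\<close>, and the smoothed measures differ by a negative power of \<open>n\<close> in
  total variation.
\<close>

subsection \<open>The Gaussian density\<close>

lemma gdens_pos: "\<sigma> > 0 \<Longrightarrow> gdens \<sigma> y > 0"
  by (simp add: gdens_def)

lemma gdens_nonneg [simp]: "gdens \<sigma> y \<ge> 0"
  by (simp add: gdens_def)

lemma borel_measurable_gdens [measurable]: "gdens \<sigma> \<in> borel_measurable borel"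
  unfolding gdens_def by measurable

lemma gdens_eq_peak_mult_exp:
  "gdens \<sigma> (y::'a::euclidean_space) = gdens \<sigma> (0::'a) * exp (- (norm y)\<^sup>2 / (2 * \<sigma>\<^sup>2))"
  by (simp add: gdens_def)

lemma gdens_le_peak: "gdens \<sigma> (y::'a::euclidean_space) \<le> gdens \<sigma> (0::'a)"
  by (simp add: gdens_def mult_left_le)

lemma gdens_ge:
  assumes "norm (y::'a::euclidean_space) \<le> r"
  shows "gdens \<sigma> (0::'a) * exp (- r\<^sup>2 / (2 * \<sigma>\<^sup>2)) \<le> gdens \<sigma> y"
  using assms by (auto simp: gdens_def intro!: mult_left_mono divide_right_mono power_mono)

lemma gdens_strict_antimono:
  fixes y z :: "'a::euclidean_space"
  assumes "\<sigma> > 0" "norm y < norm z"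
  shows "gdens \<sigma> z < gdens \<sigma> y"
proof -
  have "(norm y)\<^sup>2 / (2 * \<sigma>\<^sup>2) < (norm z)\<^sup>2 / (2 * \<sigma>\<^sup>2)"
    using assms by (intro divide_strict_right_mono power_strict_mono) auto
  thus ?thesis using assms by (simp add: gdens_def)
qed

lemma gdens_antimono:
  fixes y z :: "'a::euclidean_space"
  assumes "\<sigma> > 0" "norm y \<le> norm z"
  shows "gdens \<sigma> z \<le> gdens \<sigma> y"
  using gdens_strict_antimono[OF assms(1)] assms(2)
  by (cases "norm y = norm z") (auto simp: gdens_def less_le)

lemma exp_neg_square_lipschitz:
  fixes r s \<sigma> :: real
  assumes "\<sigma> > 0"
  shows "\<bar>exp (- r\<^sup>2 / (2 * \<sigma>\<^sup>2)) - exp (- s\<^sup>2 / (2 * \<sigma>\<^sup>2))\<bar> \<le> \<bar>r - s\<bar> / \<sigma>"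
proof -
  have "norm (exp (- r\<^sup>2 / (2 * \<sigma>\<^sup>2)) - exp (- s\<^sup>2 / (2 * \<sigma>\<^sup>2))) \<le> (1 / \<sigma>) * norm (r - s)"
  proof (rule field_differentiable_bound[of UNIV])
    fix x :: real
    show "((\<lambda>x. exp (- x\<^sup>2 / (2 * \<sigma>\<^sup>2))) has_field_derivative
        - (x / \<sigma>\<^sup>2) * exp (- x\<^sup>2 / (2 * \<sigma>\<^sup>2))) (at x within UNIV)"
      using assms by (auto intro!: derivative_eq_intros simp: field_simps)
    define u where "u = \<bar>x\<bar> / \<sigma>"
    have "u \<le> 1 + u\<^sup>2 / 2" using zero_le_power2[of "u - 1"] by (simp add: power2_diff)
    also have "\<dots> \<le> exp (u\<^sup>2 / 2)" by (rule exp_ge_add_one_self)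
    finally have "u * exp (- (u\<^sup>2 / 2)) \<le> 1" by (simp add: exp_minus field_simps)
    moreover have "\<bar>x\<bar> / \<sigma>\<^sup>2 * exp (- x\<^sup>2 / (2 * \<sigma>\<^sup>2)) = (u * exp (- (u\<^sup>2 / 2))) / \<sigma>"
      using assms by (simp add: u_def power_divide power2_eq_square)
    ultimately show "norm (- (x / \<sigma>\<^sup>2) * exp (- x\<^sup>2 / (2 * \<sigma>\<^sup>2))) \<le> 1 / \<sigma>"
      using assms by (simp add: abs_mult divide_right_mono)
  qed auto
  thus ?thesis by simp
qed

lemma gdens_lipschitz:
  fixes y z :: "'a::euclidean_space"
  assumes "\<sigma> > 0"
  shows "\<bar>gdens \<sigma> y - gdens \<sigma> z\<bar> \<le> gdens \<sigma> (0::'a) * (norm (y - z) / \<sigma>)"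
proof -
  have "\<bar>exp (- (norm y)\<^sup>2 / (2 * \<sigma>\<^sup>2)) - exp (- (norm z)\<^sup>2 / (2 * \<sigma>\<^sup>2))\<bar> \<le> norm (y - z) / \<sigma>"
    using exp_neg_square_lipschitz[OF assms, of "norm y" "norm z"] norm_triangle_ineq3[of y z] assms
    by (meson divide_right_mono less_imp_le order_trans)
  thus ?thesis
    unfolding gdens_eq_peak_mult_exp[of \<sigma> y] gdens_eq_peak_mult_exp[of \<sigma> z]
      right_diff_distrib[symmetric] abs_mult
    by (simp only: abs_of_nonneg[OF gdens_nonneg] mult_left_mono[OF _ gdens_nonneg])
qed

lemma gdens_eq_prod_normal_density:
  fixes y :: "'a::euclidean_space"
  assumes "\<sigma> > 0"
  shows "gdens \<sigma> y = (\<Prod>b\<in>Basis. normal_density 0 \<sigma> (y \<bullet> b))"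
proof -
  have "1 / sqrt (2 * pi * \<sigma>\<^sup>2) = (2 * pi * \<sigma>\<^sup>2) powr (-1/2)"
    using assms by (simp add: powr_minus_divide powr_half_sqrt)
  hence "(\<Prod>b\<in>(Basis::'a set). 1 / sqrt (2 * pi * \<sigma>\<^sup>2))
      = ((2 * pi * \<sigma>\<^sup>2) powr (-1/2)) powr real DIM('a)"
    using assms by (simp only: prod_constant) (subst powr_realpow, auto)
  hence "(\<Prod>b\<in>(Basis::'a set). 1 / sqrt (2 * pi * \<sigma>\<^sup>2)) = (2 * pi * \<sigma>\<^sup>2) powr (- real DIM('a) / 2)"
    by (simp only: powr_powr) simp
  moreover have "(\<Prod>b\<in>Basis. exp (-(y \<bullet> b)\<^sup>2 / (2 * \<sigma>\<^sup>2))) = exp (- (norm y)\<^sup>2 / (2 * \<sigma>\<^sup>2))"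
    unfolding power2_norm_eq_inner euclidean_inner[of y y]
    by (simp add: power2_eq_square sum_negf sum_divide_distrib[symmetric] flip: exp_sum)
  ultimately show ?thesis
    unfolding gdens_def normal_density_def diff_zero prod.distrib by simp
qed

lemma gdens_mult_exp_eq_gdens_sqrt2:
  fixes y :: "'a::euclidean_space"
  assumes "\<sigma> > 0"
  shows "gdens \<sigma> y * exp ((norm y)\<^sup>2 / (4 * \<sigma>\<^sup>2))
      = 2 powr (real DIM('a) / 2) * gdens (sqrt 2 * \<sigma>) y"
proof -
  have "2 * pi * (sqrt 2 * \<sigma>)\<^sup>2 = 2 * (2 * pi * \<sigma>\<^sup>2)" by (simp add: power_mult_distrib)
  hence "2 powr (real DIM('a) / 2) * (2 * pi * (sqrt 2 * \<sigma>)\<^sup>2) powr (- real DIM('a) / 2)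
      = (2 powr (real DIM('a) / 2) * 2 powr (- real DIM('a) / 2))
        * (2 * pi * \<sigma>\<^sup>2) powr (- real DIM('a) / 2)"
    by (simp only: powr_mult mult.assoc)
  also have "2 powr (real DIM('a) / 2) * 2 powr (- real DIM('a) / 2) = (1::real)"
    by (simp flip: powr_add)
  finally have "2 powr (real DIM('a) / 2) * (2 * pi * (sqrt 2 * \<sigma>)\<^sup>2) powr (- real DIM('a) / 2)
      = (2 * pi * \<sigma>\<^sup>2) powr (- real DIM('a) / 2)" by simp
  moreover have "exp (- (norm y)\<^sup>2 / (2 * \<sigma>\<^sup>2)) * exp ((norm y)\<^sup>2 / (4 * \<sigma>\<^sup>2))
      = exp (- (norm y)\<^sup>2 / (2 * (sqrt 2 * \<sigma>)\<^sup>2))"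
    using assms by (simp add: power_mult_distrib field_simps flip: exp_add)
  ultimately show ?thesis
    unfolding gdens_def by (simp only: mult.assoc [symmetric]) (simp only: mult.assoc)
qed

subsection \<open>The Gaussian measure\<close>

lemma has_bochner_integral_normal_density_cis:
  assumes "\<sigma> > 0"
  shows "has_bochner_integral lborel (\<lambda>x. normal_density 0 \<sigma> x *\<^sub>R cis (t * x))
      (complex_of_real (exp (- \<sigma>\<^sup>2 * t\<^sup>2 / 2)))"
  unfolding has_bochner_integral_iff
proof
  show "integrable lborel (\<lambda>x. normal_density 0 \<sigma> x *\<^sub>R cis (t * x))"
    by (rule Bochner_Integration.integrable_bound[OF integrable_normal_density[OF assms, of 0]])
       (auto simp: cis_conv_exp)
  have scale: "normal_density 0 \<sigma> (\<sigma> * x) = std_normal_density x / \<sigma>" for x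
    using assms by (simp add: normal_density_def real_sqrt_mult field_simps power_mult_distrib)
  have "(\<integral>x. normal_density 0 \<sigma> x *\<^sub>R cis (t * x) \<partial>lborel)
      = (\<integral>x. std_normal_density x *\<^sub>R cis ((\<sigma> * t) * x) \<partial>lborel)"
    using assms
    by (subst lborel_integral_real_affine[where c=\<sigma> and t=0])
       (auto simp: scale simp flip: integral_scaleR_right
           intro!: Bochner_Integration.integral_cong, simp add: mult_ac)
  also have "\<dots> = char std_normal_distribution (\<sigma> * t)"
    unfolding char_def by (subst integral_density) (auto simp: cis_conv_exp mult_ac)
  finally show "(\<integral>x. normal_density 0 \<sigma> x *\<^sub>R cis (t * x) \<partial>lborel)
      = complex_of_real (exp (- \<sigma>\<^sup>2 * t\<^sup>2 / 2))"
    by (simp add: char_std_normal_distribution power_mult_distrib)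
qed

lemma has_bochner_integral_gdens_cis:
  fixes t :: "'a::euclidean_space"
  assumes "\<sigma> > 0"
  shows "has_bochner_integral lborel (\<lambda>y. gdens \<sigma> y *\<^sub>R cis (t \<bullet> y))
      (complex_of_real (exp (- \<sigma>\<^sup>2 * (norm t)\<^sup>2 / 2)))"
proof -
  interpret product_sigma_finite "\<lambda>_::'a. lborel :: real measure" ..
  let ?F = "\<lambda>b x. normal_density 0 \<sigma> x *\<^sub>R cis ((t \<bullet> b) * x)"
  let ?T = "\<lambda>f. \<Sum>b\<in>Basis. f b *\<^sub>R (b::'a)"
  let ?M = "\<Pi>\<^sub>M b\<in>(Basis::'a set). (lborel::real measure)"
  have factors: "gdens \<sigma> y *\<^sub>R cis (t \<bullet> y) = (\<Prod>b\<in>Basis. ?F b (y \<bullet> b))" for y :: 'a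
    unfolding gdens_eq_prod_normal_density[OF assms] euclidean_inner[of t y] scaleR_conv_of_real
    by (simp add: prod.distrib cis_conv_exp sum_distrib_left exp_sum mult_ac)
  have "has_bochner_integral ?M (\<lambda>f. \<Prod>b\<in>Basis. ?F b (f b))
      (\<Prod>b\<in>Basis. complex_of_real (exp (- \<sigma>\<^sup>2 * (t \<bullet> b)\<^sup>2 / 2)))"
    using has_bochner_integral_normal_density_cis[OF assms]
    by (simp add: has_bochner_integral_iff product_integral_prod[of Basis ?F]
      product_integrable_prod[of Basis ?F])
  also have "(\<Prod>b\<in>Basis. complex_of_real (exp (- \<sigma>\<^sup>2 * (t \<bullet> b)\<^sup>2 / 2)))
      = complex_of_real (exp (- \<sigma>\<^sup>2 * (norm t)\<^sup>2 / 2))"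
    unfolding power2_norm_eq_inner euclidean_inner[of t t]
    by (simp add: power2_eq_square exp_sum[symmetric] sum_distrib_left sum_negf sum_divide_distrib
         flip: of_real_prod)
  also have "(\<lambda>f. \<Prod>b\<in>Basis. ?F b (f b)) = (\<lambda>f. gdens \<sigma> (?T f) *\<^sub>R cis (t \<bullet> ?T f))"
    unfolding factors by (intro ext prod.cong) auto
  finally show ?thesis
    by (subst lborel_eq)
       (intro has_bochner_integral_distr; auto simp: cis_conv_exp
           intro!: borel_measurable_scaleR borel_measurable_continuous_onI continuous_intros)
qed

lemma sets_gauss_vec [simp, measurable_cong]: "sets (gauss_vec \<sigma>) = sets borel"
  by (simp add: gauss_vec_def)

lemma space_gauss_vec [simp]: "space (gauss_vec \<sigma>) = UNIV"
  by (simp add: gauss_vec_def)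

lemma has_bochner_integral_gdens:
  assumes "\<sigma> > 0"
  shows "has_bochner_integral lborel (gdens \<sigma> :: 'a::euclidean_space \<Rightarrow> real) 1"
  using has_bochner_integral_bounded_linear[OF bounded_linear_Re
    has_bochner_integral_gdens_cis[OF assms, of "0::'a"]]
  by simp

lemma prob_space_gauss_vec:
  assumes "\<sigma> > 0"
  shows "prob_space (gauss_vec \<sigma> :: 'a::euclidean_space measure)"
proof
  have "(\<integral>\<^sup>+y. ennreal (gdens \<sigma> (y::'a)) \<partial>lborel) = 1"
    using has_bochner_integral_gdens[OF assms, where 'a = 'a]
    by (auto simp: has_bochner_integral_iff nn_integral_eq_integral)
  thus "emeasure (gauss_vec \<sigma> :: 'a measure) (space (gauss_vec \<sigma>)) = 1"
    by (simp add: gauss_vec_def emeasure_density)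
qed

lemma gauss_vec_char:
  fixes t :: "'a::euclidean_space"
  assumes "\<sigma> > 0"
  shows "(\<integral>y. cis (t \<bullet> y) \<partial>gauss_vec \<sigma>) = complex_of_real (exp (- \<sigma>\<^sup>2 * (norm t)\<^sup>2 / 2))"
  unfolding gauss_vec_def using has_bochner_integral_gdens_cis[OF assms, of t]
  by (subst integral_density) (auto simp: has_bochner_integral_iff cis_conv_exp)

lemma has_bochner_integral_gdens_shift:
  fixes g :: "'a::euclidean_space \<Rightarrow> 'b::{banach, second_countable_topology}"
  assumes "\<sigma> > 0" and [measurable]: "g \<in> borel_measurable borel" and "\<And>y. norm (g y) \<le> b"
  shows "has_bochner_integral lborel (\<lambda>y. gdens \<sigma> (y - a) *\<^sub>R g y) (\<integral>e. g (a + e) \<partial>gauss_vec \<sigma>)"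
proof -
  interpret prob_space "gauss_vec \<sigma> :: 'a measure" by (rule prob_space_gauss_vec[OF assms(1)])
  have "integrable (gauss_vec \<sigma>) (\<lambda>e. g (a + e))"
    using assms(3) by (intro integrable_const_bound[of _ b]) auto
  hence "has_bochner_integral lborel (\<lambda>e. gdens \<sigma> ((a + e) - a) *\<^sub>R g (a + e))
      (\<integral>e. g (a + e) \<partial>gauss_vec \<sigma>)"
    unfolding gauss_vec_def by (simp add: has_bochner_integral_iff integrable_density
      integral_density)
  hence "has_bochner_integral (distr lborel borel ((+) a)) (\<lambda>y. gdens \<sigma> (y - a) *\<^sub>R g y)
      (\<integral>e. g (a + e) \<partial>gauss_vec \<sigma>)"
    by (intro has_bochner_integral_distr) auto
  thus ?thesis by (simp only: lborel_distr_plus)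
qed

lemma has_bochner_integral_gauss_vec_exp_norm:
  assumes "\<sigma> > 0"
  shows "has_bochner_integral (gauss_vec \<sigma> :: 'a::euclidean_space measure)
      (\<lambda>y. exp ((norm y)\<^sup>2 / (4 * \<sigma>\<^sup>2)))
           (2 powr (real DIM('a) / 2))"
  unfolding gauss_vec_def
proof (rule has_bochner_integral_density)
  have "has_bochner_integral lborel (\<lambda>y::'a. 2 powr (real DIM('a) / 2) * gdens (sqrt 2 * \<sigma>) y)
      (2 powr (real DIM('a) / 2) * 1)"
    using assms by (intro has_bochner_integral_mult_right has_bochner_integral_gdens) auto
  thus "has_bochner_integral lborel (\<lambda>y::'a. gdens \<sigma> y *\<^sub>R exp ((norm y)\<^sup>2 / (4 * \<sigma>\<^sup>2)))
      (2 powr (real DIM('a) / 2))"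
    by (simp add: gdens_mult_exp_eq_gdens_sqrt2[OF assms])
qed auto

definition gauss_tail :: "nat \<Rightarrow> real \<Rightarrow> real \<Rightarrow> real" where
  "gauss_tail d \<sigma> r = 2 powr (real d / 2) * exp (- r\<^sup>2 / (4 * \<sigma>\<^sup>2))"

lemma gauss_vec_norm_tail:
  fixes r \<sigma> :: real
  assumes "\<sigma> > 0" "r \<ge> 0"
  shows "measure (gauss_vec \<sigma> :: 'a::euclidean_space measure) {e. norm e > r}
           \<le> gauss_tail DIM('a) \<sigma> r"
proof -
  interpret prob_space "gauss_vec \<sigma> :: 'a measure" by (rule prob_space_gauss_vec[OF assms(1)])
  note moment = has_bochner_integral_gauss_vec_exp_norm[OF assms(1),
      where 'a = 'a, unfolded has_bochner_integral_iff]
  have "prob {e. norm e > r} \<le> prob {e\<in>space (gauss_vec \<sigma>). exp ((norm e)\<^sup>2 / (4 * \<sigma>\<^sup>2))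
      \<ge> exp (r\<^sup>2 / (4 * \<sigma>\<^sup>2))}"
    using assms by (intro finite_measure_mono) (auto intro!: divide_right_mono power_mono)
  also have "\<dots> \<le> (\<integral>(e::'a). exp ((norm e)\<^sup>2 / (4 * \<sigma>\<^sup>2)) \<partial>gauss_vec \<sigma>) / exp (r\<^sup>2 / (4 * \<sigma>\<^sup>2))"
    by (rule integral_Markov_inequality_measure[where A = "{}"]) (use moment in auto)
  finally show ?thesis using moment by (simp add: gauss_tail_def exp_minus field_simps)
qed

subsection \<open>Couplings of finitely supported measures\<close>

definition prob_weights :: "'i set \<Rightarrow> ('i \<Rightarrow> real) \<Rightarrow> bool" where
  "prob_weights I w \<longleftrightarrow> (\<forall>i\<in>I. 0 \<le> w i) \<and> sum w I = 1"

definition coupling_on ::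
    "'i set \<Rightarrow> 'j set \<Rightarrow> ('i \<Rightarrow> real) \<Rightarrow> ('j \<Rightarrow> real) \<Rightarrow> ('i \<Rightarrow> 'j \<Rightarrow> real) \<Rightarrow> bool" where
  "coupling_on I J u v \<gamma> \<longleftrightarrow>
     (\<forall>i\<in>I. \<forall>j\<in>J. 0 \<le> \<gamma> i j) \<and> (\<forall>i\<in>I. (\<Sum>j\<in>J. \<gamma> i j) = u i) \<and> (\<forall>j\<in>J. (\<Sum>i\<in>I. \<gamma> i j) = v j)"

definition transport_cost :: "'i set \<Rightarrow> 'j set \<Rightarrow> ('i \<Rightarrow> 'j \<Rightarrow> real) \<Rightarrow> ('i \<Rightarrow> 'j \<Rightarrow> real) \<Rightarrow> real" where
  "transport_cost I J c \<gamma> = (\<Sum>i\<in>I. \<Sum>j\<in>J. \<gamma> i j * c i j)"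

definition wasserstein2_le :: "'i set \<Rightarrow> ('i \<Rightarrow> real) \<Rightarrow> ('i \<Rightarrow> 'a::real_normed_vector) \<Rightarrow>
    'j set \<Rightarrow> ('j \<Rightarrow> real) \<Rightarrow> ('j \<Rightarrow> 'a) \<Rightarrow> real \<Rightarrow> bool" where
  "wasserstein2_le I u x J v y b \<longleftrightarrow>
     (\<exists>\<gamma>. coupling_on I J u v \<gamma> \<and> transport_cost I J (\<lambda>i j. (norm (x i - y j))\<^sup>2) \<gamma> \<le> b)"

lemma prob_weights_nonneg: "prob_weights I w \<Longrightarrow> i \<in> I \<Longrightarrow> 0 \<le> w i"
  by (simp add: prob_weights_def)

lemma prob_weights_sum: "prob_weights I w \<Longrightarrow> sum w I = 1"
  by (simp add: prob_weights_def)

lemma prob_weights_finite: "prob_weights I w \<Longrightarrow> finite I"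
  by (metis prob_weights_sum sum.infinite zero_neq_one)

lemma prob_weights_uniform: "n > 0 \<Longrightarrow> prob_weights {..<n} (\<lambda>_. 1 / real n)"
  by (simp add: prob_weights_def)

lemma prob_weights_mean_const: "prob_weights I w \<Longrightarrow> (\<Sum>i\<in>I. w i * b) = b"
  by (simp add: prob_weights_def flip: sum_distrib_right)

lemma prob_weights_mean_mono:
  fixes b :: real
  assumes "prob_weights I w" "\<And>i. i \<in> I \<Longrightarrow> f i \<le> b"
  shows "(\<Sum>i\<in>I. w i * f i) \<le> b"
  using sum_mono[of I "\<lambda>i. w i * f i" "\<lambda>i. w i * b"] assms
  by (simp add: prob_weights_mean_const prob_weights_nonneg mult_left_mono)

lemma is_coupling_iff_coupling_on:
  "is_coupling n p \<alpha> \<gamma> \<longleftrightarrow> coupling_on {..<n} {..<p} (\<lambda>_. 1 / real n) \<alpha> \<gamma>"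
  by (auto simp: is_coupling_def coupling_on_def)

lemma wasserstein2_le_mono:
  "wasserstein2_le I u x J v y b \<Longrightarrow> b \<le> b' \<Longrightarrow> wasserstein2_le I u x J v y b'"
  by (auto simp: wasserstein2_le_def)

lemma wasserstein2_le_permute:
  assumes \<pi>: "\<pi> permutes I" and "wasserstein2_le I (\<lambda>i. u (\<pi> i)) (\<lambda>i. x (\<pi> i)) J v y b"
  shows "wasserstein2_le I u x J v y b"
proof -
  obtain \<gamma> where \<gamma>: "coupling_on I J (\<lambda>i. u (\<pi> i)) v \<gamma>"
      "transport_cost I J (\<lambda>i j. (norm (x (\<pi> i) - y j))\<^sup>2) \<gamma> \<le> b"
    using assms(2) by (auto simp: wasserstein2_le_def)
  define \<gamma>' where "\<gamma>' i = \<gamma> (inv \<pi> i)" for i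
  have reindex: "sum g I = (\<Sum>i\<in>I. g (\<pi> i))" for g :: "_ \<Rightarrow> real"
    using sum.permute[OF \<pi>, of g] by (simp add: o_def)
  have inv: "inv \<pi> i \<in> I" "\<pi> (inv \<pi> i) = i" "inv \<pi> (\<pi> i) = i" if "i \<in> I" for i
    using permutes_in_image[OF permutes_inv[OF \<pi>]] that by (auto simp: permutes_inverses[OF \<pi>])
  have "coupling_on I J u v \<gamma>'"
    using \<gamma>(1) inv by (force simp: coupling_on_def \<gamma>'_def reindex[of "\<lambda>i. \<gamma> (inv \<pi> i) _"])
  moreover have "transport_cost I J (\<lambda>i j. (norm (x i - y j))\<^sup>2) \<gamma>' \<le> b"
    using \<gamma>(2) unfolding transport_cost_def reindex[of "\<lambda>i. \<Sum>j\<in>J. \<gamma>' i j * _ i j"]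
    by (simp add: \<gamma>'_def inv)
  ultimately show ?thesis by (auto simp: wasserstein2_le_def)
qed

lemma transport_cost_mono:
  assumes "coupling_on I J u v \<gamma>" "\<And>i j. i \<in> I \<Longrightarrow> j \<in> J \<Longrightarrow> c i j \<le> c' i j"
  shows "transport_cost I J c \<gamma> \<le> transport_cost I J c' \<gamma>"
  using assms unfolding transport_cost_def coupling_on_def by (intro sum_mono mult_left_mono) auto

lemma coupling_on_swap: "coupling_on I J u v \<gamma> \<Longrightarrow> coupling_on J I v u (\<lambda>j i. \<gamma> i j)"
  by (auto simp: coupling_on_def)

lemma transport_cost_swap: "transport_cost J I (\<lambda>j i. c i j) (\<lambda>j i. \<gamma> i j) = transport_cost I J c \<gamma>"
  unfolding transport_cost_def by (rule sum.swap)

lemma weight_mult_sum_divide_sum: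
  fixes a :: "'i \<Rightarrow> real"
  assumes "finite I" "\<And>i. i \<in> I \<Longrightarrow> 0 \<le> a i" "i \<in> I"
  shows "a i * sum a I / sum a I = a i"
  using assms by (cases "sum a I = 0") (auto simp: sum_nonneg_eq_0_iff)

lemma gluing_of_couplings:
  assumes fin: "finite I" "finite J" and g: "g \<in> G"
    and \<gamma>\<^sub>1: "coupling_on I G u P \<gamma>\<^sub>1" and \<gamma>\<^sub>2: "coupling_on G J P v \<gamma>\<^sub>2"
  defines "w \<equiv> \<lambda>i j. \<gamma>\<^sub>1 i g * \<gamma>\<^sub>2 g j / P g"
  shows "\<lbrakk>i \<in> I; j \<in> J\<rbrakk> \<Longrightarrow> 0 \<le> w i j"
    and "i \<in> I \<Longrightarrow> (\<Sum>j\<in>J. w i j) = \<gamma>\<^sub>1 i g"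
    and "j \<in> J \<Longrightarrow> (\<Sum>i\<in>I. w i j) = \<gamma>\<^sub>2 g j"
proof -
  have nonneg: "0 \<le> \<gamma>\<^sub>1 i g" "0 \<le> \<gamma>\<^sub>2 g j" if "i \<in> I" "j \<in> J" for i j
    using that g \<gamma>\<^sub>1 \<gamma>\<^sub>2 by (auto simp: coupling_on_def)
  have P: "P g = (\<Sum>i\<in>I. \<gamma>\<^sub>1 i g)" "P g = (\<Sum>j\<in>J. \<gamma>\<^sub>2 g j)"
    using g \<gamma>\<^sub>1 \<gamma>\<^sub>2 by (auto simp: coupling_on_def)
  show "0 \<le> w i j" if "i \<in> I" "j \<in> J"
    unfolding w_def P(1) using that nonneg
    by (intro divide_nonneg_nonneg mult_nonneg_nonneg sum_nonneg) auto
  show "(\<Sum>j\<in>J. w i j) = \<gamma>\<^sub>1 i g" if "i \<in> I"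
  proof -
    have "(\<Sum>j\<in>J. w i j) = \<gamma>\<^sub>1 i g * P g / P g"
      by (simp add: w_def P(2) flip: sum_distrib_left sum_divide_distrib)
    also have "\<dots> = \<gamma>\<^sub>1 i g"
      unfolding P(1) using \<gamma>\<^sub>1 g that fin
      by (intro weight_mult_sum_divide_sum[of I "\<lambda>i. \<gamma>\<^sub>1 i g"]) (auto simp: coupling_on_def)
    finally show ?thesis .
  qed
  show "(\<Sum>i\<in>I. w i j) = \<gamma>\<^sub>2 g j" if "j \<in> J"
  proof -
    have "(\<Sum>i\<in>I. w i j) = \<gamma>\<^sub>2 g j * P g / P g"
      by (simp add: w_def P(1) mult.commute flip: sum_distrib_right sum_divide_distrib)
    also have "\<dots> = \<gamma>\<^sub>2 g j"
      unfolding P(2) using \<gamma>\<^sub>2 g that fin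
      by (intro weight_mult_sum_divide_sum) (auto simp: coupling_on_def)
    finally show ?thesis .
  qed
qed

lemma transport_cost_glue_le:
  assumes fin: "finite I" "finite G" "finite J"
    and \<gamma>\<^sub>1: "coupling_on I G u P \<gamma>\<^sub>1" and \<gamma>\<^sub>2: "coupling_on G J P v \<gamma>\<^sub>2"
    and cost: "\<And>i j g. i \<in> I \<Longrightarrow> j \<in> J \<Longrightarrow> g \<in> G \<Longrightarrow> c i j \<le> c\<^sub>1 i g + c\<^sub>2 g j"
  obtains \<gamma> where "coupling_on I J u v \<gamma>"
    "transport_cost I J c \<gamma> \<le> transport_cost I G c\<^sub>1 \<gamma>\<^sub>1 + transport_cost G J c\<^sub>2 \<gamma>\<^sub>2"
proof
  define w where "w g i j = \<gamma>\<^sub>1 i g * \<gamma>\<^sub>2 g j / P g" for g i j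
  define \<gamma> where "\<gamma> i j = (\<Sum>g\<in>G. w g i j)" for i j
  note w_nonneg = gluing_of_couplings(1)[OF fin(1,3) _ \<gamma>\<^sub>1 \<gamma>\<^sub>2, folded w_def]
    and sum_w_J = gluing_of_couplings(2)[OF fin(1,3) _ \<gamma>\<^sub>1 \<gamma>\<^sub>2, folded w_def]
    and sum_w_I = gluing_of_couplings(3)[OF fin(1,3) _ \<gamma>\<^sub>1 \<gamma>\<^sub>2, folded w_def]
  show "coupling_on I J u v \<gamma>"
    unfolding coupling_on_def
  proof (intro conjI ballI)
    show "0 \<le> \<gamma> i j" if "i \<in> I" "j \<in> J" for i j
      unfolding \<gamma>_def using that w_nonneg by (intro sum_nonneg) auto
    show "(\<Sum>j\<in>J. \<gamma> i j) = u i" if "i \<in> I" for i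
      unfolding \<gamma>_def using that \<gamma>\<^sub>1 by (subst sum.swap) (simp add: sum_w_J coupling_on_def)
    show "(\<Sum>i\<in>I. \<gamma> i j) = v j" if "j \<in> J" for j
      unfolding \<gamma>_def using that \<gamma>\<^sub>2 by (subst sum.swap) (simp add: sum_w_I coupling_on_def)
  qed
  have "transport_cost I J c \<gamma> = (\<Sum>i\<in>I. \<Sum>j\<in>J. \<Sum>g\<in>G. w g i j * c i j)"
    by (simp add: transport_cost_def \<gamma>_def sum_distrib_right)
  also have "\<dots> \<le> (\<Sum>i\<in>I. \<Sum>j\<in>J. \<Sum>g\<in>G. w g i j * (c\<^sub>1 i g + c\<^sub>2 g j))"
    by (intro sum_mono mult_left_mono cost w_nonneg) auto
  also have "\<dots> = (\<Sum>i\<in>I. \<Sum>j\<in>J. \<Sum>g\<in>G. w g i j * c\<^sub>1 i g) + (\<Sum>i\<in>I. \<Sum>j\<in>J. \<Sum>g\<in>G. w g i j * c\<^sub>2 g j)"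
    by (simp add: distrib_left sum.distrib)
  also have "(\<Sum>i\<in>I. \<Sum>j\<in>J. \<Sum>g\<in>G. w g i j * c\<^sub>1 i g) = transport_cost I G c\<^sub>1 \<gamma>\<^sub>1"
    unfolding transport_cost_def
    by (subst sum.swap[of _ G J]) (simp add: sum_w_J flip: sum_distrib_right)
  also have "(\<Sum>i\<in>I. \<Sum>j\<in>J. \<Sum>g\<in>G. w g i j * c\<^sub>2 g j) = transport_cost G J c\<^sub>2 \<gamma>\<^sub>2"
    unfolding transport_cost_def
    by (subst sum.swap, subst sum.swap[of _ G I], subst sum.swap)
      (simp add: sum_w_I flip: sum_distrib_right)
  finally show "transport_cost I J c \<gamma> \<le> transport_cost I G c\<^sub>1 \<gamma>\<^sub>1 + transport_cost G J c\<^sub>2 \<gamma>\<^sub>2" .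
qed

lemma coupling_on_kernel:
  assumes u: "\<And>i. i \<in> I \<Longrightarrow> 0 \<le> u i" and k: "\<And>i. i \<in> I \<Longrightarrow> prob_weights G (k i)"
  shows "coupling_on I G u (\<lambda>g. \<Sum>i\<in>I. u i * k i g) (\<lambda>i g. u i * k i g)"
  using assms by (auto simp: coupling_on_def prob_weights_def simp flip: sum_distrib_left)

lemma prob_weights_kernel_image:
  assumes "prob_weights I u" "\<And>i. i \<in> I \<Longrightarrow> prob_weights G (k i)"
  shows "prob_weights G (\<lambda>g. \<Sum>i\<in>I. u i * k i g)"
  unfolding prob_weights_def
proof
  show "\<forall>g\<in>G. 0 \<le> (\<Sum>i\<in>I. u i * k i g)"
    using assms by (auto simp: prob_weights_def intro!: sum_nonneg)
  show "(\<Sum>g\<in>G. \<Sum>i\<in>I. u i * k i g) = 1"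
    using assms by (subst sum.swap) (simp add: prob_weights_def flip: sum_distrib_left)
qed

lemma coupling_on_add:
  "coupling_on I J u v \<gamma> \<Longrightarrow> coupling_on I J u' v' \<gamma>' \<Longrightarrow>
    coupling_on I J (\<lambda>i. u i + u' i) (\<lambda>j. v j + v' j) (\<lambda>i j. \<gamma> i j + \<gamma>' i j)"
  by (simp add: coupling_on_def sum.distrib)

lemma coupling_on_diagonal:
  assumes "finite I" "\<And>i. i \<in> I \<Longrightarrow> 0 \<le> u i"
  shows "coupling_on I I u u (\<lambda>i j. if i = j then u i else 0)"
  using assms by (simp add: coupling_on_def)

lemma coupling_on_product:
  assumes "finite I" "finite J" and "sum u I = sum v J"
    and nonneg: "\<And>i. i \<in> I \<Longrightarrow> 0 \<le> u i" "\<And>j. j \<in> J \<Longrightarrow> 0 \<le> v j"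
  shows "coupling_on I J u v (\<lambda>i j. u i * v j / sum u I)"
  unfolding coupling_on_def
proof (intro conjI ballI)
  show "0 \<le> u i * v j / sum u I" if "i \<in> I" "j \<in> J" for i j
    using that nonneg by (simp add: sum_nonneg)
  show "(\<Sum>j\<in>J. u i * v j / sum u I) = u i" if "i \<in> I" for i
    using weight_mult_sum_divide_sum[of I u i] assms that
    by (simp flip: sum_distrib_left sum_divide_distrib)
  show "(\<Sum>i\<in>I. u i * v j / sum u I) = v j" if "j \<in> J" for j
    using weight_mult_sum_divide_sum[of J v j] assms that
    by (simp add: mult.commute flip: sum_distrib_right sum_divide_distrib)
qed

lemma total_variation_coupling:
  assumes P: "prob_weights G P" and Q: "prob_weights G Q"
  obtains \<kappa> where "coupling_on G G P Q \<kappa>"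
    "transport_cost G G (\<lambda>g g'. of_bool (g \<noteq> g')) \<kappa> \<le> (\<Sum>g\<in>G. \<bar>P g - Q g\<bar>)"
proof
  define m where "m g = min (P g) (Q g)" for g
  define R where "R = (\<Sum>g\<in>G. P g - m g)"
  define diagonal product where "diagonal g g' = (if g = g' then m g else 0)"
    and "product g g' = (P g - m g) * (Q g' - m g') / R" for g g'
  have fin: "finite G" using P by (rule prob_weights_finite)
  have m: "0 \<le> m g" "m g \<le> P g" "m g \<le> Q g" if "g \<in> G" for g
    using that P Q by (auto simp: m_def prob_weights_def)
  have R_Q: "R = (\<Sum>g\<in>G. Q g - m g)"
    using P Q by (simp add: R_def prob_weights_def sum_subtractf)
  have diagonal: "coupling_on G G m m diagonal"
    unfolding diagonal_def[abs_def] using m fin by (intro coupling_on_diagonal)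
  have product: "coupling_on G G (\<lambda>g. P g - m g) (\<lambda>g. Q g - m g) product"
    unfolding product_def[abs_def] R_def using m fin R_Q
    by (intro coupling_on_product) (auto simp: R_def)
  show "coupling_on G G P Q (\<lambda>g g'. diagonal g g' + product g g')"
    using coupling_on_add[OF diagonal product] by simp
  have "transport_cost G G (\<lambda>g g'. of_bool (g \<noteq> g')) (\<lambda>g g'. diagonal g g' + product g g')
      \<le> (\<Sum>g\<in>G. \<Sum>g'\<in>G. product g g')"
    unfolding transport_cost_def diagonal_def using product
    by (intro sum_mono) (auto simp: coupling_on_def)
  also have "\<dots> = R" using product by (simp add: coupling_on_def R_def)
  also have "R \<le> (\<Sum>g\<in>G. \<bar>P g - Q g\<bar>)"
    unfolding R_def by (intro sum_mono) (auto simp: m_def)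
  finally show "transport_cost G G (\<lambda>g g'. of_bool (g \<noteq> g')) (\<lambda>g g'. diagonal g g' + product g g')
      \<le> (\<Sum>g\<in>G. \<bar>P g - Q g\<bar>)" .
qed

text \<open>Transport each marginal to \<open>G\<close> by its kernel, and couple the two images optimally in total
  variation.\<close>
lemma coupling_via_smoothing:
  assumes u: "prob_weights I u" and v: "prob_weights J v"
    and k: "\<And>i. i \<in> I \<Longrightarrow> prob_weights G (k i)" and h: "\<And>j. j \<in> J \<Longrightarrow> prob_weights G (h j)"
    and cost: "\<And>i j g. i \<in> I \<Longrightarrow> j \<in> J \<Longrightarrow> g \<in> G \<Longrightarrow> c i j \<le> c\<^sub>1 i g + c\<^sub>2 j g"
    and D: "\<And>i g. i \<in> I \<Longrightarrow> g \<in> G \<Longrightarrow> c\<^sub>1 i g \<le> D" "\<And>i g. i \<in> I \<Longrightarrow> g \<in> G \<Longrightarrow> 0 \<le> c\<^sub>1 i g"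
  obtains \<gamma> where "coupling_on I J u v \<gamma>"
    "transport_cost I J c \<gamma> \<le> (\<Sum>i\<in>I. u i * (\<Sum>g\<in>G. k i g * c\<^sub>1 i g))
        + (\<Sum>j\<in>J. v j * (\<Sum>g\<in>G. h j g * c\<^sub>2 j g))
        + D * (\<Sum>g\<in>G. \<bar>(\<Sum>i\<in>I. u i * k i g) - (\<Sum>j\<in>J. v j * h j g)\<bar>)"
proof -
  define P where "P = (\<lambda>g. \<Sum>i\<in>I. u i * k i g)"
  define Q where "Q = (\<lambda>g. \<Sum>j\<in>J. v j * h j g)"
  have PQ: "prob_weights G P" "prob_weights G Q"
    unfolding P_def Q_def by (intro prob_weights_kernel_image u v k h; assumption)+
  have fin: "finite I" "finite J" "finite G" using u v PQ(1) by (auto dest: prob_weights_finite)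
  have "I \<noteq> {}" "G \<noteq> {}" using u PQ(1) by (auto simp: prob_weights_def)
  then obtain i g where "i \<in> I" "g \<in> G" by blast
  hence D_nonneg: "D \<ge> 0" using D[of i g] by linarith
  have \<gamma>\<^sub>1: "coupling_on I G u P (\<lambda>i g. u i * k i g)"
    unfolding P_def using u k by (intro coupling_on_kernel) (auto simp: prob_weights_def)
  have \<gamma>\<^sub>2: "coupling_on G J Q v (\<lambda>g j. v j * h j g)"
    unfolding Q_def using v h by (intro coupling_on_kernel[THEN coupling_on_swap])
      (auto simp: prob_weights_def)
  obtain \<kappa> where \<kappa>: "coupling_on G G P Q \<kappa>"
    "transport_cost G G (\<lambda>g g'. of_bool (g \<noteq> g')) \<kappa> \<le> (\<Sum>g\<in>G. \<bar>P g - Q g\<bar>)"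
    using total_variation_coupling[OF PQ] .
  obtain \<gamma>\<^sub>3 where \<gamma>\<^sub>3: "coupling_on I G u Q \<gamma>\<^sub>3"
    "transport_cost I G c\<^sub>1 \<gamma>\<^sub>3 \<le> transport_cost I G c\<^sub>1 (\<lambda>i g. u i * k i g)
        + transport_cost G G (\<lambda>g g'. D * of_bool (g \<noteq> g')) \<kappa>"
    by (rule transport_cost_glue_le[OF fin(1,3,3) \<gamma>\<^sub>1 \<kappa>(1),
      of c\<^sub>1 c\<^sub>1 "\<lambda>g g'. D * of_bool (g \<noteq> g')"]) (use D in \<open>auto simp: add_increasing\<close>)
  obtain \<gamma> where \<gamma>: "coupling_on I J u v \<gamma>"
    "transport_cost I J c \<gamma> \<le> transport_cost I G c\<^sub>1 \<gamma>\<^sub>3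
        + transport_cost G J (\<lambda>g j. c\<^sub>2 j g) (\<lambda>g j. v j * h j g)"
    by (rule transport_cost_glue_le[OF fin(1,3,2) \<gamma>\<^sub>3(1) \<gamma>\<^sub>2, of c c\<^sub>1 "\<lambda>g j. c\<^sub>2 j g"])
      (use cost in auto)
  have "transport_cost G G (\<lambda>g g'. D * of_bool (g \<noteq> g')) \<kappa>
      = D * transport_cost G G (\<lambda>g g'. of_bool (g \<noteq> g')) \<kappa>"
    by (simp add: transport_cost_def sum_distrib_left mult_ac)
  also have "\<dots> \<le> D * (\<Sum>g\<in>G. \<bar>P g - Q g\<bar>)"
    by (intro mult_left_mono \<kappa>(2) D_nonneg)
  finally have "transport_cost I J c \<gamma> \<le> transport_cost I G c\<^sub>1 (\<lambda>i g. u i * k i g)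
      + transport_cost J G c\<^sub>2 (\<lambda>j g. v j * h j g) + D * (\<Sum>g\<in>G. \<bar>P g - Q g\<bar>)"
    using \<gamma>(2) \<gamma>\<^sub>3(2) by (simp add: transport_cost_swap[of J G "\<lambda>g j. c\<^sub>2 j g", symmetric])
  thus ?thesis using that \<gamma>(1) by (simp add: transport_cost_def P_def Q_def sum_distrib_left
      mult.assoc)
qed

subsection \<open>Stability of optimal couplings\<close>

definition bregman_div :: "('a::real_inner \<Rightarrow> real) \<Rightarrow> ('a \<Rightarrow> 'a) \<Rightarrow> 'a \<Rightarrow> 'a \<Rightarrow> real" where
  "bregman_div \<psi> f x z = \<psi> x - \<psi> z - f z \<bullet> (x - z)"

definition smooth_strongly_convex :: "real \<Rightarrow> real \<Rightarrow> ('a::real_inner \<Rightarrow> real) \<Rightarrow> ('a \<Rightarrow> 'a) \<Rightarrow> bool" where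
  "smooth_strongly_convex l L \<psi> f \<longleftrightarrow> 0 < l \<and> 0 < L \<and> (\<forall>x. GDERIV \<psi> x :> f x)
     \<and> (\<forall>x z. \<psi> x + f x \<bullet> (z - x) + l / 2 * (norm (x - z))\<^sup>2 \<le> \<psi> z)
     \<and> (\<forall>x z. \<psi> z \<le> \<psi> x + f x \<bullet> (z - x) + L / 2 * (norm (x - z))\<^sup>2)"

lemma bregman_div_ge:
  fixes \<psi> :: "'a::real_inner \<Rightarrow> real"
  assumes "L > 0"
    and convex: "\<And>x z. \<psi> z \<ge> \<psi> x + f x \<bullet> (z - x)"
    and smooth: "\<And>x z. \<psi> z \<le> \<psi> x + f x \<bullet> (z - x) + L / 2 * (norm (x - z))\<^sup>2"
  shows "(norm (f x - f z))\<^sup>2 \<le> 2 * L * bregman_div \<psi> f x z"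
proof -
  define v where "v = f x - f z"
  define w where "w = x - (1 / L) *\<^sub>R v"
  have "\<psi> z + f z \<bullet> (w - z) \<le> \<psi> x + f x \<bullet> (w - x) + L / 2 * (norm (x - w))\<^sup>2"
    using convex[where x = z and z = w] smooth[where x = x and z = w] by linarith
  moreover have "f z \<bullet> (w - z) = f z \<bullet> (w - x) + f z \<bullet> (x - z)"
    by (simp add: inner_diff_right)
  moreover have "f x \<bullet> (w - x) - f z \<bullet> (w - x) = - (v \<bullet> v) / L"
    by (simp add: w_def v_def inner_diff_left diff_divide_distrib)
  moreover have "L / 2 * (norm (x - w))\<^sup>2 = (v \<bullet> v) / (2 * L)"
    using \<open>L > 0\<close> power2_norm_eq_inner[of v]
    by (simp add: w_def power_mult_distrib power2_eq_square field_simps)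
  ultimately have "v \<bullet> v / L - v \<bullet> v / (2 * L) \<le> bregman_div \<psi> f x z"
    by (simp add: bregman_div_def)
  thus ?thesis
    using \<open>L > 0\<close> by (simp add: v_def power2_norm_eq_inner field_simps)
qed

lemma bregman_div_le:
  fixes \<psi> :: "'a::real_inner \<Rightarrow> real"
  assumes "l > 0"
    and strongly_convex: "\<And>x z. \<psi> z \<ge> \<psi> x + f x \<bullet> (z - x) + l / 2 * (norm (x - z))\<^sup>2"
  shows "2 * l * bregman_div \<psi> f x z \<le> (norm (f x - f z))\<^sup>2"
proof -
  define v where "v = f x - f z"
  have "bregman_div \<psi> f x z \<le> v \<bullet> (x - z) - l / 2 * (norm (x - z))\<^sup>2"
    using strongly_convex[where x=x and z=z]
    by (simp add: bregman_div_def v_def inner_diff_left inner_diff_right)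
  hence "2 * l * bregman_div \<psi> f x z \<le> 2 * l * (v \<bullet> (x - z)) - l\<^sup>2 * (norm (x - z))\<^sup>2"
    using \<open>l > 0\<close> mult_left_mono[of _ _ "2 * l"]
    by (fastforce simp: power2_eq_square right_diff_distrib)
  also have "\<dots> = (norm v)\<^sup>2 - (norm (v - l *\<^sub>R (x - z)))\<^sup>2"
    unfolding power2_norm_eq_inner
    by (simp add: inner_diff_left[of v] inner_diff_right[of _ v] inner_commute[of "x - z" v]
      power2_eq_square right_diff_distrib)
  also have "\<dots> \<le> (norm v)\<^sup>2" by simp
  finally show ?thesis by (simp add: v_def)
qed

lemma strongly_convex_gradient_surj:
  fixes \<psi> :: "'a::euclidean_space \<Rightarrow> real"
  assumes "l > 0"
    and grad: "\<And>x. GDERIV \<psi> x :> f x"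
    and strongly_convex: "\<And>x z. \<psi> z \<ge> \<psi> x + f x \<bullet> (z - x) + l / 2 * (norm (x - z))\<^sup>2"
  shows "surj f"
proof -
  have "\<exists>x. f x = \<theta>" for \<theta>
  proof -
    define g where "g = (\<lambda>x. \<psi> x - \<theta> \<bullet> x)"
    have g_derivative: "(g has_derivative (\<lambda>h. (f x - \<theta>) \<bullet> h)) (at x)" for x
      using grad[of x] unfolding gderiv_def g_def
      by (auto intro!: derivative_eq_intros simp: inner_diff_left inner_diff_right inner_commute)
    have continuous: "continuous_on S g" for S
      by (intro continuous_at_imp_continuous_on ballI has_derivative_continuous[OF g_derivative])
    define r where "r = 2 * norm (f 0 - \<theta>) / l"
    have r: "r \<ge> 0" using \<open>l > 0\<close> by (simp add: r_def)
    have outside: "g z > g 0" if "norm z > r" for z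
    proof -
      have z: "norm z > 0" using that r by linarith
      have "(f 0 - \<theta>) \<bullet> z \<ge> - (norm (f 0 - \<theta>) * norm z)"
        using Cauchy_Schwarz_ineq2[of "f 0 - \<theta>" z] by linarith
      moreover have "norm (f 0 - \<theta>) * norm z < l / 2 * norm z * norm z"
        using that z \<open>l > 0\<close> by (simp add: r_def field_simps)
      moreover have "g z \<ge> g 0 + (f 0 - \<theta>) \<bullet> z + l / 2 * (norm z)\<^sup>2"
        using strongly_convex[where x=0 and z=z] by (simp add: g_def inner_diff_left)
      ultimately show ?thesis by (simp add: power2_eq_square)
    qed
    obtain x where x: "x \<in> cball 0 r" "\<And>y. y \<in> cball 0 r \<Longrightarrow> g x \<le> g y"
      using continuous_attains_inf[OF compact_cball _ continuous, of 0 r] r by auto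
    have minimum: "g x \<le> g y" for y
      using x(2)[of y] x(2)[of 0] outside[of y] r by (cases "norm y \<le> r") auto
    have "(\<lambda>h. (f x - \<theta>) \<bullet> h) = (\<lambda>h. 0)"
      by (rule differential_zero_maxmin[OF _ open_UNIV g_derivative]) (use minimum in auto)
    hence "(f x - \<theta>) \<bullet> (f x - \<theta>) = 0" by metis
    thus ?thesis by auto
  qed
  thus ?thesis by (metis surjI)
qed

lemma smooth_strongly_convex_gradient_surj:
  fixes \<psi> :: "'a::euclidean_space \<Rightarrow> real"
  shows "smooth_strongly_convex l L \<psi> f \<Longrightarrow> surj f"
  using strongly_convex_gradient_surj[of l \<psi> f] by (simp add: smooth_strongly_convex_def)

lemma smooth_strongly_convex_bregman_div:
  assumes "smooth_strongly_convex l L \<psi> f"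
  shows "(norm (f x - f z))\<^sup>2 \<le> 2 * L * bregman_div \<psi> f x z"
    and "2 * l * bregman_div \<psi> f x z \<le> (norm (f x - f z))\<^sup>2"
proof -
  have "0 < l" "0 < L"
    and strongly_convex: "\<And>x z. \<psi> x + f x \<bullet> (z - x) + l / 2 * (norm (x - z))\<^sup>2 \<le> \<psi> z"
    and smooth: "\<And>x z. \<psi> z \<le> \<psi> x + f x \<bullet> (z - x) + L / 2 * (norm (x - z))\<^sup>2"
    using assms by (auto simp: smooth_strongly_convex_def)
  have "\<psi> x + f x \<bullet> (z - x) \<le> \<psi> z" for x z
    by (rule order_trans[OF _ strongly_convex[of x]]) (use \<open>0 < l\<close> in simp)
  thus "(norm (f x - f z))\<^sup>2 \<le> 2 * L * bregman_div \<psi> f x z"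
    by (intro bregman_div_ge smooth \<open>0 < L\<close>)
  show "2 * l * bregman_div \<psi> f x z \<le> (norm (f x - f z))\<^sup>2"
    by (intro bregman_div_le strongly_convex \<open>0 < l\<close>)
qed

lemma power2_norm_weighted_mean_le:
  fixes x :: "'i \<Rightarrow> 'a::real_inner"
  assumes "prob_weights I w"
  shows "(norm (\<Sum>i\<in>I. w i *\<^sub>R x i))\<^sup>2 \<le> (\<Sum>i\<in>I. w i * (norm (x i))\<^sup>2)"
proof -
  define m where "m = (\<Sum>i\<in>I. w i *\<^sub>R x i)"
  have "0 \<le> (\<Sum>i\<in>I. w i * (norm (x i - m))\<^sup>2)"
    using assms by (intro sum_nonneg) (simp add: prob_weights_def)
  also have "\<dots> = (\<Sum>i\<in>I. w i * (norm (x i))\<^sup>2 - 2 * (w i * (m \<bullet> x i)) + w i * (norm m)\<^sup>2)"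
    by (intro sum.cong refl) (simp add: power2_norm_eq_inner inner_diff_left inner_diff_right
      inner_commute algebra_simps)
  also have "\<dots> = (\<Sum>i\<in>I. w i * (norm (x i))\<^sup>2) - 2 * (m \<bullet> m) + (norm m)\<^sup>2"
    using prob_weights_mean_const[OF assms]
    by (simp add: sum.distrib sum_subtractf sum_distrib_left[symmetric])
      (simp add: m_def inner_sum_right)
  finally show ?thesis by (simp add: m_def power2_norm_eq_inner)
qed

lemma bary_proj_error_le:
  fixes \<theta> :: "nat \<Rightarrow> 'a::euclidean_space"
  assumes "is_coupling n p \<alpha> \<Gamma>"
  shows "(1 / real n) * (\<Sum>i<n. (norm (bary_proj n p \<Gamma> \<theta> i - a i))\<^sup>2)
           \<le> transport_cost {..<n} {..<p} (\<lambda>i j. (norm (a i - \<theta> j))\<^sup>2) \<Gamma>"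
  unfolding transport_cost_def sum_distrib_left
proof (rule sum_mono)
  fix i assume "i \<in> {..<n}"
  hence n: "real n > 0" and weights: "prob_weights {..<p} (\<lambda>j. real n * \<Gamma> i j)"
    using assms by (auto simp: is_coupling_def prob_weights_def simp flip: sum_distrib_left)
  have "bary_proj n p \<Gamma> \<theta> i - a i = (\<Sum>j<p. (real n * \<Gamma> i j) *\<^sub>R (\<theta> j - a i))"
    using prob_weights_sum[OF weights]
    by (simp add: bary_proj_def scaleR_diff_right sum_subtractf
      scaleR_sum_right flip: scaleR_sum_left)
  hence "(norm (bary_proj n p \<Gamma> \<theta> i - a i))\<^sup>2 \<le> real n * (\<Sum>j<p. \<Gamma> i j * (norm (a i - \<theta> j))\<^sup>2)"
    using power2_norm_weighted_mean_le[OF weights, of "\<lambda>j. \<theta> j - a i"]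
    by (simp add: sum_distrib_left mult.assoc norm_minus_commute)
  thus "1 / real n * (norm (bary_proj n p \<Gamma> \<theta> i - a i))\<^sup>2 \<le> (\<Sum>j<p. \<Gamma> i j * (norm (a i - \<theta> j))\<^sup>2)"
    using n by (simp add: field_simps)
qed

lemma opt_coupling_minimises_additive_perturbation:
  assumes opt: "is_opt_coupling n p X \<theta> \<alpha> \<Gamma>" and \<gamma>: "is_coupling n p \<alpha> \<gamma>"
    and c: "\<And>i j. c i j = a i + b j + (1/2) * (norm (X i - \<theta> j))\<^sup>2"
  shows "transport_cost {..<n} {..<p} c \<Gamma> \<le> transport_cost {..<n} {..<p} c \<gamma>"
proof -
  have cost: "transport_cost {..<n} {..<p} c g = (\<Sum>i<n. a i / real n) + (\<Sum>j<p. b j * \<alpha> j)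
      + coupling_cost n p X \<theta> g"
    if "is_coupling n p \<alpha> g" for g
  proof -
    have "transport_cost {..<n} {..<p} c g
        = (\<Sum>i<n. \<Sum>j<p. a i * g i j) + (\<Sum>i<n. \<Sum>j<p. b j * g i j) + coupling_cost n p X \<theta> g"
      unfolding transport_cost_def c coupling_cost_def by (simp add: algebra_simps sum.distrib)
    also have "(\<Sum>i<n. \<Sum>j<p. a i * g i j) = (\<Sum>i<n. a i / real n)"
      using that by (simp add: is_coupling_def flip: sum_distrib_left)
    also have "(\<Sum>i<n. \<Sum>j<p. b j * g i j) = (\<Sum>j<p. b j * \<alpha> j)"
      using that by (subst sum.swap) (simp add: is_coupling_def flip: sum_distrib_left)
    finally show ?thesis .
  qed
  have "is_coupling n p \<alpha> \<Gamma>" "coupling_cost n p X \<theta> \<Gamma> \<le> coupling_cost n p X \<theta> \<gamma>"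
    using opt \<gamma> by (auto simp: is_opt_coupling_def)
  thus ?thesis using cost \<gamma> by simp
qed

text \<open>If \<open>f z = \<theta>\<close> then the Bregman divergence of \<open>x\<close> from \<open>z\<close> is \<open>\<psi> x + \<psi>\<^sup>* \<theta> - x \<bullet> \<theta>\<close>, with
  \<open>\<psi>\<^sup>*\<close> the conjugate of \<open>\<psi>\<close>; this differs from \<open>|x - \<theta>|\<^sup>2 / 2\<close> by a function of \<open>x\<close> plus a
  function of \<open>\<theta>\<close>.\<close>
lemma opt_coupling_stability:
  fixes X :: "nat \<Rightarrow> 'a::euclidean_space"
  assumes regular: "smooth_strongly_convex l L \<psi> f" and opt: "is_opt_coupling n p X \<theta> \<alpha> \<Gamma>"
    and close: "wasserstein2_le {..<n} (\<lambda>_. 1 / real n) (\<lambda>i. f (X i)) {..<p} \<alpha> \<theta> b"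
  shows "(1 / real n) * (\<Sum>i<n. (norm (bary_proj n p \<Gamma> \<theta> i - f (X i)))\<^sup>2) \<le> (L / l) * b"
proof -
  have "l > 0" "L > 0" using regular by (auto simp: smooth_strongly_convex_def)
  have \<Gamma>: "is_coupling n p \<alpha> \<Gamma>" using opt by (simp add: is_opt_coupling_def)
  let ?cost = "transport_cost {..<n} {..<p}"
  obtain \<gamma> where \<gamma>: "is_coupling n p \<alpha> \<gamma>" "?cost (\<lambda>i j. (norm (f (X i) - \<theta> j))\<^sup>2) \<gamma> \<le> b"
    using close by (auto simp: wasserstein2_le_def is_coupling_iff_coupling_on)
  define Z where "Z j = inv f (\<theta> j)" for j
  have Z: "f (Z j) = \<theta> j" for j
    by (simp add: Z_def surj_f_inv_f[OF smooth_strongly_convex_gradient_surj[OF regular]])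
  define D where "D i j = bregman_div \<psi> f (X i) (Z j)" for i j
  have lower: "(norm (f (X i) - \<theta> j))\<^sup>2 \<le> 2 * L * D i j"
    and upper: "2 * l * D i j \<le> (norm (f (X i) - \<theta> j))\<^sup>2" for i j
    using smooth_strongly_convex_bregman_div[OF regular, of "X i" "Z j"] by (simp_all add: D_def Z)
  have D_split: "D i j = (\<psi> (X i) - (norm (X i))\<^sup>2 / 2) + (\<theta> j \<bullet> Z j - \<psi> (Z j) - (norm (\<theta> j))\<^sup>2 / 2)
      + (1/2) * (norm (X i - \<theta> j))\<^sup>2" for i j
    by (simp add: D_def bregman_div_def Z power2_norm_eq_inner inner_diff_left inner_diff_right
      inner_commute field_simps)
  have scale: "?cost (\<lambda>i j. a * D i j) g = a * ?cost D g" for a g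
    by (simp add: transport_cost_def sum_distrib_left mult_ac)
  have "(1 / real n) * (\<Sum>i<n. (norm (bary_proj n p \<Gamma> \<theta> i - f (X i)))\<^sup>2)
      \<le> ?cost (\<lambda>i j. (norm (f (X i) - \<theta> j))\<^sup>2) \<Gamma>"
    by (rule bary_proj_error_le[OF \<Gamma>])
  also have "\<dots> \<le> ?cost (\<lambda>i j. 2 * L * D i j) \<Gamma>"
    by (intro transport_cost_mono[OF \<Gamma>[unfolded is_coupling_iff_coupling_on]] lower)
  also have "\<dots> \<le> (L / l) * ?cost (\<lambda>i j. 2 * l * D i j) \<gamma>"
    using opt_coupling_minimises_additive_perturbation[OF opt \<gamma>(1) D_split] \<open>L > 0\<close> \<open>l > 0\<close>
    by (simp add: scale)
  also have "\<dots> \<le> (L / l) * ?cost (\<lambda>i j. (norm (f (X i) - \<theta> j))\<^sup>2) \<gamma>"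
    using \<open>L > 0\<close> \<open>l > 0\<close>
    by (intro mult_left_mono transport_cost_mono[OF \<gamma>(1)[unfolded is_coupling_iff_coupling_on]]
      upper) simp
  also have "\<dots> \<le> (L / l) * b" using \<open>L > 0\<close> \<open>l > 0\<close> by (intro mult_left_mono \<gamma>(2)) simp
  finally show ?thesis .
qed

subsection \<open>Fejer--Korovkin kernels\<close>

lemma fejer_korovkin_coefficients:
  obtains a :: "nat \<Rightarrow> real" where "\<And>m. m \<le> N \<Longrightarrow> a m \<ge> 0" "(\<Sum>m\<le>N. (a m)\<^sup>2) = 1"
    "(\<Sum>m<N. a m * a (Suc m)) = cos (pi / real (N + 2))"
proof -
  define q where "q = pi / real (N + 2)"
  define s where "s = (\<lambda>k::nat. sin (q * real k))"
  define S where "S = (\<Sum>m\<le>N. (s (Suc m))\<^sup>2)"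
  define T where "T = (\<Sum>m<N. s (Suc m) * s (Suc (Suc m)))"
  have q: "q > 0" "q * real (N + 2) = pi" by (auto simp: q_def)
  have pos: "s (Suc m) > 0" if "m \<le> N" for m
  proof -
    have "q * real (Suc m) < q * real (N + 2)" using that q(1) by (intro mult_strict_left_mono) auto
    hence "q * real (Suc m) < pi" using q(2) by linarith
    thus ?thesis unfolding s_def using q(1) by (intro sin_gt_zero) auto
  qed
  hence S: "S > 0" unfolding S_def by (intro sum_pos zero_less_power) auto
  have endpoints: "s 0 = 0" "s (N + 2) = 0" using q(2) by (simp_all add: s_def)
  have recurrence: "s (Suc (Suc m)) + s m = 2 * cos q * s (Suc m)" for m
    using sin_add[of "q * real (Suc m)" q] sin_diff[of "q * real (Suc m)" q]
    by (simp add: s_def algebra_simps)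
  have "(\<Sum>m\<le>N. s (Suc m) * s (Suc (Suc m))) = T"
    using endpoints(2) by (simp add: T_def lessThan_Suc_atMost[symmetric])
  moreover have "(\<Sum>m\<le>N. s (Suc m) * s m) = T"
    unfolding T_def lessThan_Suc_atMost[symmetric]
    by (subst sum.lessThan_Suc_shift) (simp add: endpoints mult.commute)
  ultimately have "2 * T = (\<Sum>m\<le>N. s (Suc m) * (s (Suc (Suc m)) + s m))"
    by (simp add: distrib_left sum.distrib)
  also have "\<dots> = 2 * cos q * S"
    unfolding recurrence S_def sum_distrib_left by (intro sum.cong) (auto simp: power2_eq_square)
  finally have T: "T = cos q * S" by simp
  show ?thesis
  proof (rule that[of "\<lambda>m. s (Suc m) / sqrt S"])
    show "s (Suc m) / sqrt S \<ge> 0" if "m \<le> N" for m using pos[OF that] S by auto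
    show "(\<Sum>m\<le>N. (s (Suc m) / sqrt S)\<^sup>2) = 1"
      using S by (simp add: power_divide S_def[symmetric] flip: sum_divide_distrib)
    show "(\<Sum>m<N. s (Suc m) / sqrt S * (s (Suc (Suc m)) / sqrt S)) = cos (pi / real (N + 2))"
      using S T by (simp add: T_def[symmetric] q_def flip: sum_divide_distrib)
  qed
qed

lemma sum_cis_roots_of_unity:
  fixes z :: int and x :: real
  assumes "\<bar>z\<bar> < int Q"
  shows "(\<Sum>g<Q. cis (of_int z * (x - 2 * pi * real g / real Q))) = (if z = 0 then of_nat Q else 0)"
proof (cases "z = 0")
  case False
  have Q: "real Q > 0" using assms by auto
  define w where "w = cis (- 2 * pi * of_int z / real Q)"
  have "w ^ Q = cis (2 * pi * of_int (- z))"
    using Q by (simp add: w_def Complex.DeMoivre)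
  hence power: "w ^ Q = 1" using cis_multiple_2pi[of "of_int (- z)"] by simp
  have "w \<noteq> 1"
  proof
    assume "w = 1"
    then obtain k :: int where "- 2 * pi * of_int z / real Q = of_int k * (2 * pi)"
      unfolding w_def cis_eq_1_iff by blast
    hence "pi * real_of_int (- z) = pi * real_of_int (k * int Q)" using Q by (simp add: field_simps)
    hence "real_of_int (- z) = real_of_int (k * int Q)"
      by (simp only: mult_left_cancel[OF pi_neq_zero])
    hence "int Q dvd z" by (simp only: of_int_eq_iff) (metis dvd_minus_iff dvd_triv_right)
    thus False using zdvd_not_zless[of "\<bar>z\<bar>" "int Q"] assms False by simp
  qed
  have "cis (of_int z * (x - 2 * pi * real g / real Q)) = cis (of_int z * x) * w ^ g" for g
    unfolding w_def Complex.DeMoivre cis_mult by (simp add: algebra_simps)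
  hence "(\<Sum>g<Q. cis (of_int z * (x - 2 * pi * real g / real Q)))
      = cis (of_int z * x) * (\<Sum>g<Q. w ^ g)"
    by (simp add: sum_distrib_left)
  also have "(\<Sum>g<Q. w ^ g) = 0"
    using \<open>w \<noteq> 1\<close> power by (simp add: geometric_sum)
  finally show ?thesis using False by simp
qed simp

definition trig_kernel :: "(nat \<Rightarrow> real) \<Rightarrow> nat \<Rightarrow> real \<Rightarrow> real" where
  "trig_kernel a N x = (cmod (\<Sum>m\<le>N. a m * cis (real m * x)))\<^sup>2"

lemma trig_kernel_nonneg [simp]: "trig_kernel a N x \<ge> 0"
  by (simp add: trig_kernel_def)

lemma power2_norm_trig_poly_expand:
  fixes s :: "'m \<Rightarrow> 'a::real_inner"
  shows "complex_of_real ((cmod (\<Sum>\<mu>\<in>M. z \<mu> * cis (s \<mu> \<bullet> x)))\<^sup>2)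
     = (\<Sum>\<mu>\<in>M. \<Sum>\<nu>\<in>M. z \<mu> * cnj (z \<nu>) * cis ((s \<mu> - s \<nu>) \<bullet> x))"
proof -
  have "complex_of_real ((cmod (\<Sum>\<mu>\<in>M. z \<mu> * cis (s \<mu> \<bullet> x)))\<^sup>2)
      = (\<Sum>\<mu>\<in>M. z \<mu> * cis (s \<mu> \<bullet> x)) * cnj (\<Sum>\<mu>\<in>M. z \<mu> * cis (s \<mu> \<bullet> x))"
    by (rule complex_norm_square)
  also have "\<dots> = (\<Sum>\<mu>\<in>M. \<Sum>\<nu>\<in>M. z \<mu> * cnj (z \<nu>) * (cis (s \<mu> \<bullet> x) * cis (- (s \<nu> \<bullet> x))))"
    by (simp add: sum_product cis_cnj mult_ac)
  finally show ?thesis by (simp add: cis_mult inner_diff_left)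
qed

lemma trig_kernel_grid_average_cis:
  fixes r :: int and x :: real
  assumes "\<bar>r\<bar> \<le> 1" "Q \<ge> N + 2"
  defines "y \<equiv> \<lambda>g. x - 2 * pi * real g / real Q"
  shows "(\<Sum>g<Q. complex_of_real (trig_kernel a N (y g) / real Q) * cis (of_int r * y g))
       = complex_of_real (\<Sum>m\<le>N. \<Sum>m'\<le>N. if int m' = int m + r then a m * a m' else 0)"
proof -
  have Q: "Q > 0" using assms by simp
  have expand: "complex_of_real (trig_kernel a N t) * cis (of_int r * t)
      = (\<Sum>m\<le>N. \<Sum>m'\<le>N. complex_of_real (a m * a m') * cis (of_int (int m - int m' + r) * t))" for t
    unfolding trig_kernel_def
    using power2_norm_trig_poly_expand[of "\<lambda>m. complex_of_real (a m)" real t "{..N}"]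
    by (simp add: sum_distrib_right mult.assoc cis_mult distrib_right)
  have "(\<Sum>g<Q. complex_of_real (trig_kernel a N (y g) / real Q) * cis (of_int r * y g))
      = (\<Sum>g<Q. (\<Sum>m\<le>N. \<Sum>m'\<le>N. complex_of_real (a m * a m')
        * cis (of_int (int m - int m' + r) * y g))) / of_nat Q"
    unfolding expand[symmetric] by (simp add: sum_divide_distrib)
  also have "(\<Sum>g<Q. (\<Sum>m\<le>N. \<Sum>m'\<le>N. complex_of_real (a m * a m')
      * cis (of_int (int m - int m' + r) * y g)))
      = (\<Sum>m\<le>N. \<Sum>m'\<le>N. complex_of_real (a m * a m')
        * (\<Sum>g<Q. cis (of_int (int m - int m' + r) * y g)))"
    by (subst sum.swap, subst sum.swap[of _ _ "{..<Q}"]) (simp add: sum_distrib_left)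
  also have "\<dots> = (\<Sum>m\<le>N. \<Sum>m'\<le>N. of_nat Q
      * complex_of_real (if int m' = int m + r then a m * a m' else 0))"
  proof (intro sum.cong refl)
    fix m m' assume "m \<in> {..N}" "m' \<in> {..N}"
    hence "\<bar>int m - int m' + r\<bar> < int Q" using assms(1,2) by auto
    thus "complex_of_real (a m * a m') * (\<Sum>g<Q. cis (of_int (int m - int m' + r) * y g))
       = of_nat Q * complex_of_real (if int m' = int m + r then a m * a m' else 0)"
      unfolding y_def by (subst sum_cis_roots_of_unity) auto
  qed
  finally show ?thesis using Q by (simp flip: sum_distrib_left)
qed

lemma trig_kernel_grid_average:
  assumes "Q \<ge> N + 2" "(\<Sum>m\<le>N. (a m)\<^sup>2) = 1"
  shows "(\<Sum>g<Q. trig_kernel a N (x - 2 * pi * real g / real Q) / real Q) = 1"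
proof -
  have "complex_of_real (\<Sum>g<Q. trig_kernel a N (x - 2 * pi * real g / real Q) / real Q)
      = complex_of_real (\<Sum>m\<le>N. \<Sum>m'\<le>N. if m' = m then a m * a m' else 0)"
    using trig_kernel_grid_average_cis[of 0 N Q a x] assms(1) by simp
  also have "(\<Sum>m\<le>N. \<Sum>m'\<le>N. if m' = m then a m * a m' else 0) = (\<Sum>m\<le>N. (a m)\<^sup>2)"
    by (intro sum.cong) (auto simp: power2_eq_square)
  finally show ?thesis using assms(2) by (simp only: of_real_eq_iff)
qed

lemma trig_kernel_grid_average_cos:
  fixes x :: real
  assumes "Q \<ge> N + 2"
  defines "y \<equiv> \<lambda>g. x - 2 * pi * real g / real Q"
  shows "(\<Sum>g<Q. trig_kernel a N (y g) / real Q * cos (y g)) = (\<Sum>m<N. a m * a (Suc m))"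
proof -
  have "(\<Sum>g<Q. complex_of_real (trig_kernel a N (y g) / real Q) * cis (y g))
      = complex_of_real (\<Sum>m\<le>N. \<Sum>m'\<le>N. if int m' = int m + 1 then a m * a m' else 0)"
    using trig_kernel_grid_average_cis[of 1 N Q a x] assms(1) by (simp add: y_def)
  hence "(\<Sum>g<Q. trig_kernel a N (y g) / real Q * cos (y g))
      = (\<Sum>m\<le>N. \<Sum>m'\<le>N. if int m' = int m + 1 then a m * a m' else 0)"
    by (simp add: complex_eq_iff)
  also have "\<dots> = (\<Sum>m\<le>N. \<Sum>m'\<le>N. if m' = Suc m then a m * a m' else 0)"
    by (intro sum.cong) auto
  also have "\<dots> = (\<Sum>m\<le>N. if Suc m \<le> N then a m * a (Suc m) else 0)"
    by (intro sum.cong) auto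
  also have "\<dots> = (\<Sum>m<N. a m * a (Suc m))"
    by (intro sum.mono_neutral_cong_right) auto
  finally show ?thesis .
qed

subsection \<open>Chords of the circle\<close>

lemma power2_norm_diff_le:
  fixes x y z :: "'a::real_normed_vector"
  shows "(norm (x - z))\<^sup>2 \<le> 2 * (norm (x - y))\<^sup>2 + 2 * (norm (z - y))\<^sup>2"
proof -
  have "(norm (x - z))\<^sup>2 \<le> (norm (x - y) + norm (z - y))\<^sup>2"
    using norm_triangle_ineq4[of "x - y" "z - y"] by (intro power_mono) auto
  also have "\<dots> \<le> 2 * (norm (x - y))\<^sup>2 + 2 * (norm (z - y))\<^sup>2"
    using zero_le_power2[of "norm (x - y) - norm (z - y)"] by (simp add: power2_sum power2_diff)
  finally show ?thesis .
qed

lemma power2_norm_cis_diff: "(cmod (cis u - cis v))\<^sup>2 = 2 * (1 - cos (u - v))"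
proof -
  have "(cmod (cis u - cis v))\<^sup>2 = ((cos u)\<^sup>2 + (sin u)\<^sup>2) + ((cos v)\<^sup>2 + (sin v)\<^sup>2)
      - 2 * (cos u * cos v + sin u * sin v)"
    unfolding cmod_power2 by (simp add: power2_eq_square algebra_simps)
  thus ?thesis by (simp add: cos_diff)
qed

lemma power2_norm_cis_diff_eq_sin: "(cmod (cis u - cis v))\<^sup>2 = 4 * (sin ((u - v) / 2))\<^sup>2"
proof -
  define w where "w = (u - v) / 2"
  have "u - v = 2 * w" by (simp only: w_def times_divide_eq_right) simp
  thus ?thesis by (simp add: power2_norm_cis_diff cos_double_sin flip: w_def)
qed

lemma power2_norm_cis_diff_le: "(cmod (cis u - cis v))\<^sup>2 \<le> (u - v)\<^sup>2"
  using abs_sin_x_le_abs_x[of "(u - v) / 2"]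
  unfolding power2_norm_cis_diff_eq_sin abs_le_square_iff by (simp add: power_divide)

lemma power2_norm_cis_diff_ge:
  assumes "\<bar>u - v\<bar> \<le> 2"
  shows "(u - v)\<^sup>2 \<le> 4 * (cmod (cis u - cis v))\<^sup>2"
proof -
  define w where "w = \<bar>u - v\<bar> / 2"
  have w: "0 \<le> w" "w \<le> 1" using assms by (auto simp: w_def)
  have "\<bar>sin w - w\<bar> \<le> w ^ 3 / 6"
    using Maclaurin_sin_bound[of w 3] w by (simp add: sin_coeff_def eval_nat_numeral)
  moreover have "w ^ 3 \<le> w" using w power_decreasing[of 1 3 w] by simp
  ultimately have "w / 2 \<le> sin w" using w by linarith
  hence "(w / 2)\<^sup>2 \<le> (sin w)\<^sup>2" using w by (intro power_mono) auto
  moreover have "w = (u - v) / 2 \<or> w = - ((u - v) / 2)" unfolding w_def by linarith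
  hence "(sin w)\<^sup>2 = (sin ((u - v) / 2))\<^sup>2" by (metis sin_minus power2_minus)
  ultimately show ?thesis
    unfolding power2_norm_cis_diff_eq_sin by (simp add: w_def power_divide)
qed

subsection \<open>Couplings from characteristic functions\<close>

definition atomic_char :: "'i set \<Rightarrow> ('i \<Rightarrow> real) \<Rightarrow> ('i \<Rightarrow> 'a::real_inner) \<Rightarrow> 'a \<Rightarrow> complex" where
  "atomic_char I w x t = (\<Sum>i\<in>I. w i *\<^sub>R cis (t \<bullet> x i))"

definition int_grid :: "real \<Rightarrow> nat \<Rightarrow> 'a::euclidean_space set" where
  "int_grid \<delta> N = {t. \<forall>b\<in>Basis. \<exists>z::int. \<bar>z\<bar> \<le> int N \<and> t \<bullet> b = \<delta> * of_int z}"

lemma zero_mem_int_grid: "0 \<in> int_grid \<delta> N"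
  by (auto simp: int_grid_def intro!: exI[of _ 0])

definition torus_grid :: "nat \<Rightarrow> ('a::euclidean_space \<Rightarrow> nat) set" where
  "torus_grid Q = Basis \<rightarrow>\<^sub>E {..<Q}"

text \<open>The point \<open>x\<close> of the torus of period \<open>2 \<pi> R\<close> has angles \<open>x \<bullet> b / R\<close>, the grid point \<open>g\<close> has
  angles \<open>2 \<pi> g b / Q\<close>.\<close>
definition torus_kernel ::
    "(nat \<Rightarrow> real) \<Rightarrow> nat \<Rightarrow> nat \<Rightarrow> real \<Rightarrow> 'a::euclidean_space \<Rightarrow> ('a \<Rightarrow> nat) \<Rightarrow> real" where
  "torus_kernel a N Q R x g =
     (\<Prod>b\<in>Basis. trig_kernel a N (x \<bullet> b / R - 2 * pi * real (g b) / real Q) / real Q)"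

text \<open>Squared chords have trigonometric sums as their means under the kernel; the factor \<open>8 * R\<^sup>2\<close>
  makes the cost dominate squared distances.\<close>
definition torus_cost :: "nat \<Rightarrow> real \<Rightarrow> 'a::euclidean_space \<Rightarrow> ('a \<Rightarrow> nat) \<Rightarrow> real" where
  "torus_cost Q R x g =
     8 * R\<^sup>2 * (\<Sum>b\<in>Basis. (cmod (cis (x \<bullet> b / R) - cis (2 * pi * real (g b) / real Q)))\<^sup>2)"

lemma torus_cost_nonneg: "0 \<le> torus_cost Q R x g"
  unfolding torus_cost_def by (intro mult_nonneg_nonneg sum_nonneg) auto

lemma torus_cost_le: "torus_cost Q R (x::'a::euclidean_space) g \<le> 32 * real DIM('a) * R\<^sup>2"
proof -
  have "torus_cost Q R x g \<le> 8 * R\<^sup>2 * (\<Sum>b\<in>(Basis::'a set). 2\<^sup>2)"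
    unfolding torus_cost_def
    by (intro mult_left_mono sum_mono power_mono) (auto intro: order_trans[OF norm_triangle_ineq4])
  thus ?thesis by (simp add: mult_ac)
qed

lemma power2_norm_eq_sum_Basis: "(norm (x::'a::euclidean_space))\<^sup>2 = (\<Sum>b\<in>Basis. (x \<bullet> b)\<^sup>2)"
  unfolding power2_norm_eq_inner euclidean_inner[of x x] by (simp add: power2_eq_square)

lemma torus_cost_quasi_triangle:
  fixes x z :: "'a::euclidean_space"
  assumes R: "R > 0" and norms: "norm x \<le> R" "norm z \<le> R"
  shows "(norm (x - z))\<^sup>2 \<le> torus_cost Q R x g + torus_cost Q R z g"
proof -
  let ?c = "\<lambda>x b. (cmod (cis (x \<bullet> b / R) - cis (2 * pi * real (g b) / real Q)))\<^sup>2"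
  have "((x - z) \<bullet> b)\<^sup>2 \<le> 8 * R\<^sup>2 * ?c x b + 8 * R\<^sup>2 * ?c z b" if b: "b \<in> Basis" for b
  proof -
    define u where "u = x \<bullet> b / R"
    define w where "w = z \<bullet> b / R"
    have "\<bar>x \<bullet> b\<bar> \<le> R" "\<bar>z \<bullet> b\<bar> \<le> R"
      using Basis_le_norm[OF b] norms order_trans by blast+
    hence "\<bar>u\<bar> \<le> 1" "\<bar>w\<bar> \<le> 1" using R by (auto simp: u_def w_def)
    hence "(u - w)\<^sup>2 \<le> 4 * (cmod (cis u - cis w))\<^sup>2" by (intro power2_norm_cis_diff_ge) linarith
    also have "\<dots> \<le> 4 * (2 * ?c x b + 2 * ?c z b)"
      using power2_norm_diff_le[of "cis u" "cis w" "cis (2 * pi * real (g b) / real Q)"]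
      by (simp add: u_def w_def)
    finally have "R\<^sup>2 * (u - w)\<^sup>2 \<le> R\<^sup>2 * (4 * (2 * ?c x b + 2 * ?c z b))"
      by (rule mult_left_mono) simp
    moreover have "(x - z) \<bullet> b = R * (u - w)"
      using R by (simp add: u_def w_def inner_diff_left field_simps)
    hence "R\<^sup>2 * (u - w)\<^sup>2 = ((x - z) \<bullet> b)\<^sup>2" by (simp add: power_mult_distrib)
    ultimately show ?thesis by (simp add: algebra_simps)
  qed
  hence "(\<Sum>b\<in>Basis. ((x - z) \<bullet> b)\<^sup>2) \<le> (\<Sum>b\<in>Basis. 8 * R\<^sup>2 * ?c x b + 8 * R\<^sup>2 * ?c z b)"
    by (rule sum_mono)
  thus ?thesis by (simp add: power2_norm_eq_sum_Basis torus_cost_def sum.distrib sum_distrib_left)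
qed

lemma sum_PiE_prod_mult_coordinate:
  fixes k :: "'i \<Rightarrow> 'q \<Rightarrow> real"
  assumes "finite B" "finite S" "b \<in> B" and total: "\<And>b'. b' \<in> B \<Longrightarrow> (\<Sum>q\<in>S. k b' q) = 1"
  shows "(\<Sum>g\<in>B \<rightarrow>\<^sub>E S. (\<Prod>b'\<in>B. k b' (g b')) * f (g b)) = (\<Sum>q\<in>S. k b q * f q)"
proof -
  define F where "F b' q = k b' q * (if b' = b then f q else 1)" for b' q
  have "(\<Prod>b'\<in>B. k b' (g b')) * f (g b) = (\<Prod>b'\<in>B. F b' (g b'))" for g
    using assms(1,3) by (simp add: F_def prod.distrib prod.delta)
  hence "(\<Sum>g\<in>B \<rightarrow>\<^sub>E S. (\<Prod>b'\<in>B. k b' (g b')) * f (g b)) = (\<Prod>b'\<in>B. \<Sum>q\<in>S. F b' q)"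
    using assms(1,2) by (simp add: prod_sum_PiE)
  also have "\<dots> = (\<Prod>b'\<in>B. if b' = b then \<Sum>q\<in>S. k b q * f q else 1)"
    by (intro prod.cong) (auto simp: F_def total)
  finally show ?thesis using assms(1,3) by (simp add: prod.delta)
qed

lemma prob_weights_torus_kernel:
  fixes x :: "'a::euclidean_space"
  assumes "Q \<ge> N + 2" "(\<Sum>m\<le>N. (a m)\<^sup>2) = 1"
  shows "prob_weights (torus_grid Q) (torus_kernel a N Q R x)"
  unfolding prob_weights_def
proof
  show "\<forall>g\<in>torus_grid Q. 0 \<le> torus_kernel a N Q R x g"
    by (auto simp: torus_kernel_def intro!: prod_nonneg)
  have "(\<Sum>g\<in>torus_grid Q. torus_kernel a N Q R x g)
      = (\<Prod>b\<in>Basis. \<Sum>q<Q. trig_kernel a N (x \<bullet> b / R - 2 * pi * real q / real Q) / real Q)"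
    unfolding torus_grid_def torus_kernel_def by (subst prod_sum_PiE) auto
  thus "(\<Sum>g\<in>torus_grid Q. torus_kernel a N Q R x g) = 1"
    using trig_kernel_grid_average[OF assms] by simp
qed

lemma torus_kernel_mean_cost_le:
  fixes x :: "'a::euclidean_space"
  assumes Q: "Q \<ge> N + 2" and a: "(\<Sum>m\<le>N. (a m)\<^sup>2) = 1" "(\<Sum>m<N. a m * a (Suc m)) = cos q"
  shows "(\<Sum>g\<in>torus_grid Q. torus_kernel a N Q R x g * torus_cost Q R x g)
      \<le> 8 * real DIM('a) * (R * q)\<^sup>2"
proof -
  let ?c = "\<lambda>b q. (cmod (cis (x \<bullet> b / R) - cis (2 * pi * real q / real Q)))\<^sup>2"
  have "(\<Sum>g\<in>torus_grid Q. torus_kernel a N Q R x g * ?c b (g b)) \<le> q\<^sup>2" if b: "b \<in> Basis" for b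
  proof -
    let ?y = "\<lambda>g. x \<bullet> b / R - 2 * pi * real g / real Q"
    let ?k = "\<lambda>g. trig_kernel a N (?y g) / real Q"
    have "(\<Sum>g\<in>torus_grid Q. torus_kernel a N Q R x g * ?c b (g b)) = (\<Sum>g<Q. ?k g * ?c b g)"
      unfolding torus_grid_def torus_kernel_def using b trig_kernel_grid_average[OF Q a(1)]
      by (intro sum_PiE_prod_mult_coordinate) auto
    also have "\<dots> = 2 * ((\<Sum>g<Q. ?k g) - (\<Sum>g<Q. ?k g * cos (?y g)))"
      unfolding power2_norm_cis_diff sum_subtractf[symmetric] sum_distrib_left
      by (intro sum.cong) (simp_all add: algebra_simps)
    also have "\<dots> = (cmod (cis q - cis 0))\<^sup>2"
      using trig_kernel_grid_average[OF Q a(1)] trig_kernel_grid_average_cos[OF Q, of a "x \<bullet> b / R"]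
        a(2)
      unfolding power2_norm_cis_diff by simp
    also have "\<dots> \<le> q\<^sup>2" using power2_norm_cis_diff_le[of q 0] by simp
    finally show ?thesis .
  qed
  hence "(\<Sum>b\<in>Basis. \<Sum>g\<in>torus_grid Q. torus_kernel a N Q R x g * ?c b (g b))
      \<le> (\<Sum>b\<in>(Basis::'a set). q\<^sup>2)"
    by (rule sum_mono)
  hence "8 * R\<^sup>2 * (\<Sum>b\<in>Basis. \<Sum>g\<in>torus_grid Q. torus_kernel a N Q R x g * ?c b (g b))
      \<le> 8 * R\<^sup>2 * (\<Sum>b\<in>(Basis::'a set). q\<^sup>2)"
    by (rule mult_left_mono) simp
  moreover have "(\<Sum>g\<in>torus_grid Q. torus_kernel a N Q R x g * torus_cost Q R x g)
      = 8 * R\<^sup>2 * (\<Sum>b\<in>Basis. \<Sum>g\<in>torus_grid Q. torus_kernel a N Q R x g * ?c b (g b))"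
    by (subst sum.swap) (simp add: torus_cost_def sum_distrib_left mult_ac)
  ultimately show ?thesis by (simp add: power_mult_distrib mult_ac)
qed

lemma mean_power2_norm_trig_poly:
  fixes s :: "'m \<Rightarrow> 'a::real_inner"
  shows "complex_of_real (\<Sum>i\<in>I. u i * (cmod (\<Sum>\<mu>\<in>M. z \<mu> * cis (s \<mu> \<bullet> x i)))\<^sup>2)
      = (\<Sum>\<mu>\<in>M. \<Sum>\<nu>\<in>M. z \<mu> * cnj (z \<nu>) * atomic_char I u x (s \<mu> - s \<nu>))"
proof -
  have "complex_of_real (\<Sum>i\<in>I. u i * (cmod (\<Sum>\<mu>\<in>M. z \<mu> * cis (s \<mu> \<bullet> x i)))\<^sup>2)
      = (\<Sum>i\<in>I. \<Sum>\<mu>\<in>M. \<Sum>\<nu>\<in>M. complex_of_real (u i) * (z \<mu> * cnj (z \<nu>) * cis ((s \<mu> - s \<nu>) \<bullet> x i)))"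
    unfolding of_real_sum of_real_mult power2_norm_trig_poly_expand sum_distrib_left ..
  also have "\<dots> = (\<Sum>\<mu>\<in>M. \<Sum>\<nu>\<in>M. \<Sum>i\<in>I. complex_of_real (u i)
      * (z \<mu> * cnj (z \<nu>) * cis ((s \<mu> - s \<nu>) \<bullet> x i)))"
    by (subst sum.swap, subst sum.swap[of _ _ I]) (rule refl)
  finally show ?thesis
    by (simp add: atomic_char_def sum_distrib_left scaleR_conv_of_real mult_ac)
qed

lemma trig_poly_mean_diff_le:
  fixes s :: "'m \<Rightarrow> 'a::real_inner" and z :: "'m \<Rightarrow> complex"
  assumes close: "\<And>\<mu> \<nu>. \<mu> \<in> M \<Longrightarrow> \<nu> \<in> M
      \<Longrightarrow> cmod (atomic_char I u x (s \<mu> - s \<nu>) - atomic_char J v y (s \<mu> - s \<nu>)) \<le> \<eta>"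
  defines "F \<equiv> \<lambda>x. (cmod (\<Sum>\<mu>\<in>M. z \<mu> * cis (s \<mu> \<bullet> x)))\<^sup>2"
  shows "\<bar>(\<Sum>i\<in>I. u i * F (x i)) - (\<Sum>j\<in>J. v j * F (y j))\<bar> \<le> (\<Sum>\<mu>\<in>M. cmod (z \<mu>))\<^sup>2 * \<eta>"
proof -
  let ?\<Delta> = "\<lambda>t. atomic_char I u x t - atomic_char J v y t"
  have "\<bar>(\<Sum>i\<in>I. u i * F (x i)) - (\<Sum>j\<in>J. v j * F (y j))\<bar>
      = cmod (complex_of_real (\<Sum>i\<in>I. u i * F (x i)) - complex_of_real (\<Sum>j\<in>J. v j * F (y j)))"
    by (simp only: norm_of_real flip: of_real_diff)
  also have "\<dots> = cmod (\<Sum>\<mu>\<in>M. \<Sum>\<nu>\<in>M. z \<mu> * cnj (z \<nu>) * ?\<Delta> (s \<mu> - s \<nu>))"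
    unfolding F_def mean_power2_norm_trig_poly by (simp only: right_diff_distrib sum_subtractf)
  also have "\<dots> \<le> (\<Sum>\<mu>\<in>M. \<Sum>\<nu>\<in>M. cmod (z \<mu>) * cmod (z \<nu>) * \<eta>)"
    using close by (intro sum_norm_le) (auto simp: norm_mult intro!: mult_left_mono)
  also have "\<dots> = (\<Sum>\<mu>\<in>M. cmod (z \<mu>))\<^sup>2 * \<eta>"
    by (simp only: power2_eq_square sum_product) (simp only: sum_distrib_right)
  finally show ?thesis .
qed

definition torus_freq :: "real \<Rightarrow> ('a::euclidean_space \<Rightarrow> nat) \<Rightarrow> 'a" where
  "torus_freq R \<mu> = (\<Sum>b\<in>Basis. (real (\<mu> b) / R) *\<^sub>R b)"

definition torus_coeff ::
    "(nat \<Rightarrow> real) \<Rightarrow> nat \<Rightarrow> ('a::euclidean_space \<Rightarrow> nat) \<Rightarrow> ('a \<Rightarrow> nat) \<Rightarrow> complex" where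
  "torus_coeff a Q g \<mu> = complex_of_real (\<Prod>b\<in>Basis. a (\<mu> b))
      * cis (- (\<Sum>b\<in>Basis. real (\<mu> b) * (2 * pi * real (g b) / real Q)))"

lemma torus_kernel_eq_power2_norm:
  fixes x :: "'a::euclidean_space"
  shows "torus_kernel a N Q R x g
    = (cmod (\<Sum>\<mu>\<in>torus_grid (Suc N). torus_coeff a Q g \<mu> * cis (torus_freq R \<mu> \<bullet> x)))\<^sup>2
      / real Q ^ DIM('a)"
proof -
  let ?y = "\<lambda>b. x \<bullet> b / R - 2 * pi * real (g b) / real Q"
  have "torus_coeff a Q g \<mu> * cis (torus_freq R \<mu> \<bullet> x)
      = (\<Prod>b\<in>Basis. complex_of_real (a (\<mu> b)) * cis (real (\<mu> b) * ?y b))" for \<mu> :: "'a \<Rightarrow> nat"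
  proof -
    have "(\<Prod>b\<in>Basis. cis (real (\<mu> b) * ?y b)) = cis (\<Sum>b\<in>Basis. real (\<mu> b) * ?y b)"
      by (simp add: cis_conv_exp sum_distrib_left exp_sum)
    also have "(\<Sum>b\<in>Basis. real (\<mu> b) * ?y b)
        = - (\<Sum>b\<in>Basis. real (\<mu> b) * (2 * pi * real (g b) / real Q)) + torus_freq R \<mu> \<bullet> x"
      unfolding torus_freq_def inner_sum_left sum_negf[symmetric] sum.distrib[symmetric]
      by (intro sum.cong refl) (simp add: inner_commute algebra_simps)
    finally show ?thesis by (simp only: torus_coeff_def prod.distrib of_real_prod
        mult.assoc flip: cis_mult)
  qed
  hence "(\<Sum>\<mu>\<in>torus_grid (Suc N). torus_coeff a Q g \<mu> * cis (torus_freq R \<mu> \<bullet> x))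
      = (\<Prod>b\<in>Basis. \<Sum>m\<le>N. complex_of_real (a m) * cis (real m * ?y b))"
    unfolding torus_grid_def lessThan_Suc_atMost by (simp add: prod_sum_PiE)
  thus ?thesis
    by (simp add: torus_kernel_def trig_kernel_def prod_dividef prod_power_distrib flip: prod_norm)
qed

lemma torus_freq_diff_mem_int_grid:
  fixes \<mu> \<nu> :: "'a::euclidean_space \<Rightarrow> nat"
  assumes "\<mu> \<in> torus_grid (Suc N)" "\<nu> \<in> torus_grid (Suc N)"
  shows "torus_freq R \<mu> - torus_freq R \<nu> \<in> int_grid (1 / R) N"
  unfolding int_grid_def
proof clarify
  fix b :: 'a assume b: "b \<in> Basis"
  have "\<mu> b < Suc N" "\<nu> b < Suc N" using assms b by (auto simp: torus_grid_def PiE_iff)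
  hence "\<bar>int (\<mu> b) - int (\<nu> b)\<bar> \<le> int N" by auto
  moreover have "(torus_freq R \<mu> - torus_freq R \<nu>) \<bullet> b = 1 / R * of_int (int (\<mu> b) - int (\<nu> b))"
    unfolding torus_freq_def inner_diff_left using b
    by (simp only: inner_sum_left_Basis) (simp add: diff_divide_distrib)
  ultimately show "\<exists>z. \<bar>z\<bar> \<le> int N \<and> (torus_freq R \<mu> - torus_freq R \<nu>) \<bullet> b = 1 / R * real_of_int z"
    by blast
qed

lemma power2_sum_norm_torus_coeff_le:
  fixes g :: "'a::euclidean_space \<Rightarrow> nat"
  assumes "\<And>m. m \<le> N \<Longrightarrow> 0 \<le> a m" "(\<Sum>m\<le>N. (a m)\<^sup>2) = 1"
  shows "(\<Sum>\<mu>\<in>torus_grid (Suc N). cmod (torus_coeff a Q g \<mu>))\<^sup>2 \<le> real (N + 1) ^ DIM('a)"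
proof -
  have "(\<Sum>\<mu>\<in>torus_grid (Suc N). cmod (torus_coeff a Q g \<mu>))
      = (\<Sum>\<mu>\<in>torus_grid (Suc N). \<Prod>b\<in>(Basis::'a set). a (\<mu> b))"
  proof (intro sum.cong refl)
    fix \<mu> :: "'a \<Rightarrow> nat" assume "\<mu> \<in> torus_grid (Suc N)"
    hence "0 \<le> (\<Prod>b\<in>(Basis::'a set). a (\<mu> b))"
      using assms(1) by (intro prod_nonneg) (auto simp: torus_grid_def PiE_iff less_Suc_eq_le)
    thus "cmod (torus_coeff a Q g \<mu>) = (\<Prod>b\<in>(Basis::'a set). a (\<mu> b))"
      by (simp add: torus_coeff_def norm_mult del: of_real_prod)
  qed
  also have "\<dots> = (\<Sum>m\<le>N. a m) ^ DIM('a)"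
    unfolding torus_grid_def lessThan_Suc_atMost by (subst prod_sum_PiE[symmetric]) auto
  finally have "(\<Sum>\<mu>\<in>torus_grid (Suc N). cmod (torus_coeff a Q g \<mu>))\<^sup>2 = ((\<Sum>m\<le>N. a m)\<^sup>2) ^ DIM('a)"
    by (simp add: mult.commute flip: power_mult)
  also have "\<dots> \<le> real (N + 1) ^ DIM('a)"
    using Cauchy_Schwarz_ineq_sum[of "\<lambda>_. 1" a "{..N}"] assms(2) by (intro power_mono) simp_all
  finally show ?thesis .
qed

lemma torus_kernel_mean_diff_le:
  fixes x :: "'i \<Rightarrow> 'a::euclidean_space" and y :: "'j \<Rightarrow> 'a"
  assumes a: "\<And>m. m \<le> N \<Longrightarrow> 0 \<le> a m" "(\<Sum>m\<le>N. (a m)\<^sup>2) = 1"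
    and close: "\<And>t. t \<in> int_grid (1 / R) N \<Longrightarrow> cmod (atomic_char I u x t - atomic_char J v y t) \<le> \<eta>"
  shows "\<bar>(\<Sum>i\<in>I. u i * torus_kernel a N Q R (x i) g) - (\<Sum>j\<in>J. v j * torus_kernel a N Q R (y j) g)\<bar>
     \<le> real (N + 1) ^ DIM('a) * \<eta> / real Q ^ DIM('a)"
proof -
  let ?M = "torus_grid (Suc N) :: ('a \<Rightarrow> nat) set"
  define F where "F x = (cmod (\<Sum>\<mu>\<in>?M. torus_coeff a Q g \<mu> * cis (torus_freq R \<mu> \<bullet> x)))\<^sup>2" for x
  have K: "torus_kernel a N Q R x g = F x / real Q ^ DIM('a)" for x
    unfolding F_def by (rule torus_kernel_eq_power2_norm)
  have "\<eta> \<ge> 0" using close[OF zero_mem_int_grid] norm_ge_zero order_trans by blast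
  have "\<bar>(\<Sum>i\<in>I. u i * F (x i)) - (\<Sum>j\<in>J. v j * F (y j))\<bar> \<le> (\<Sum>\<mu>\<in>?M. cmod (torus_coeff a Q g \<mu>))\<^sup>2 * \<eta>"
    unfolding F_def by (intro trig_poly_mean_diff_le close torus_freq_diff_mem_int_grid)
  also have "\<dots> \<le> real (N + 1) ^ DIM('a) * \<eta>"
    using power2_sum_norm_torus_coeff_le[OF a] \<open>\<eta> \<ge> 0\<close> by (rule mult_right_mono)
  finally have "\<bar>(\<Sum>i\<in>I. u i * F (x i)) - (\<Sum>j\<in>J. v j * F (y j))\<bar> / real Q ^ DIM('a)
      \<le> real (N + 1) ^ DIM('a) * \<eta> / real Q ^ DIM('a)"
    by (rule divide_right_mono) simp
  thus ?thesis by (simp add: K abs_divide sum_divide_distrib[symmetric] flip: diff_divide_distrib)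
qed

lemma torus_kernel_total_variation_le:
  fixes x :: "'i \<Rightarrow> 'a::euclidean_space" and y :: "'j \<Rightarrow> 'a"
  assumes Q: "Q > 0" and a: "\<And>m. m \<le> N \<Longrightarrow> 0 \<le> a m" "(\<Sum>m\<le>N. (a m)\<^sup>2) = 1"
    and close: "\<And>t. t \<in> int_grid (1 / R) N \<Longrightarrow> cmod (atomic_char I u x t - atomic_char J v y t) \<le> \<eta>"
  shows "(\<Sum>g\<in>torus_grid Q. \<bar>(\<Sum>i\<in>I. u i * torus_kernel a N Q R (x i) g)
      - (\<Sum>j\<in>J. v j * torus_kernel a N Q R (y j) g)\<bar>)
     \<le> real (N + 1) ^ DIM('a) * \<eta>"
proof -
  have "(\<Sum>g\<in>torus_grid Q. \<bar>(\<Sum>i\<in>I. u i * torus_kernel a N Q R (x i) g)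
      - (\<Sum>j\<in>J. v j * torus_kernel a N Q R (y j) g)\<bar>)
      \<le> (\<Sum>g\<in>(torus_grid Q :: ('a \<Rightarrow> nat) set). real (N + 1) ^ DIM('a) * \<eta> / real Q ^ DIM('a))"
    by (intro sum_mono torus_kernel_mean_diff_le a close)
  also have "\<dots> = real (N + 1) ^ DIM('a) * \<eta>" using Q by (simp add: torus_grid_def card_PiE)
  finally show ?thesis .
qed

text \<open>The Fejer--Korovkin kernels have mean square width \<open>O(R\<^sup>2/N\<^sup>2)\<close> on the torus of period \<open>2 \<pi>
  R\<close>, and only see the characteristic functions at finitely many frequencies.\<close>
lemma wasserstein2_le_of_close_atomic_char:
  fixes x :: "'i \<Rightarrow> 'a::euclidean_space" and y :: "'j \<Rightarrow> 'a"
  assumes R: "R > 0" and u: "prob_weights I u" and v: "prob_weights J v"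
    and x: "\<And>i. i \<in> I \<Longrightarrow> norm (x i) \<le> R" and y: "\<And>j. j \<in> J \<Longrightarrow> norm (y j) \<le> R"
    and close: "\<And>t. t \<in> int_grid (1 / R) N \<Longrightarrow> cmod (atomic_char I u x t - atomic_char J v y t) \<le> \<eta>"
  shows "wasserstein2_le I u x J v y
    (16 * real DIM('a) * (R * (pi / real (N + 2)))\<^sup>2
      + 32 * real DIM('a) * R\<^sup>2 * real (N + 1) ^ DIM('a) * \<eta>)"
proof -
  define q where "q = pi / real (N + 2)"
  obtain a where a: "\<And>m. m \<le> N \<Longrightarrow> a m \<ge> 0" "(\<Sum>m\<le>N. (a m)\<^sup>2) = 1" "(\<Sum>m<N. a m * a (Suc m)) = cos q"
    unfolding q_def using fejer_korovkin_coefficients by blast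
  let ?G = "torus_grid (N + 2) :: ('a \<Rightarrow> nat) set" and ?K = "torus_kernel a N (N + 2) R :: 'a \<Rightarrow> _"
    and ?cost = "torus_cost (N + 2) R :: 'a \<Rightarrow> _"
  let ?TV = "\<Sum>g\<in>?G. \<bar>(\<Sum>i\<in>I. u i * ?K (x i) g) - (\<Sum>j\<in>J. v j * ?K (y j) g)\<bar>"
  obtain \<gamma> where \<gamma>: "coupling_on I J u v \<gamma>"
    "transport_cost I J (\<lambda>i j. (norm (x i - y j))\<^sup>2) \<gamma>
       \<le> (\<Sum>i\<in>I. u i * (\<Sum>g\<in>?G. ?K (x i) g * ?cost (x i) g))
         + (\<Sum>j\<in>J. v j * (\<Sum>g\<in>?G. ?K (y j) g * ?cost (y j) g))
        + 32 * real DIM('a) * R\<^sup>2 * ?TV"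
  proof (rule coupling_via_smoothing[OF u v,
      where c\<^sub>1 = "\<lambda>i. ?cost (x i)" and D = "32 * real DIM('a) * R\<^sup>2"])
    show "prob_weights ?G (?K (x i))" for i using a(2) by (simp add: prob_weights_torus_kernel)
    show "prob_weights ?G (?K (y j))" for j using a(2) by (simp add: prob_weights_torus_kernel)
    show "(norm (x i - y j))\<^sup>2 \<le> ?cost (x i) g + ?cost (y j) g" if "i \<in> I" "j \<in> J" for i j g
      using that x y R by (intro torus_cost_quasi_triangle) auto
  qed (rule torus_cost_le torus_cost_nonneg)+
  have mean_cost: "(\<Sum>g\<in>?G. ?K z g * ?cost z g) \<le> 8 * real DIM('a) * (R * q)\<^sup>2" for z
    by (intro torus_kernel_mean_cost_le a(2,3)) simp
  have "(\<Sum>i\<in>I. u i * (\<Sum>g\<in>?G. ?K (x i) g * ?cost (x i) g)) \<le> 8 * real DIM('a) * (R * q)\<^sup>2"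
    "(\<Sum>j\<in>J. v j * (\<Sum>g\<in>?G. ?K (y j) g * ?cost (y j) g)) \<le> 8 * real DIM('a) * (R * q)\<^sup>2"
    by (intro prob_weights_mean_mono u v mean_cost)+
  moreover have "32 * real DIM('a) * R\<^sup>2 * ?TV
      \<le> 32 * real DIM('a) * R\<^sup>2 * (real (N + 1) ^ DIM('a) * \<eta>)"
    by (intro mult_left_mono torus_kernel_total_variation_le a(1,2) close) simp_all
  ultimately have "transport_cost I J (\<lambda>i j. (norm (x i - y j))\<^sup>2) \<gamma>
      \<le> 16 * real DIM('a) * (R * q)\<^sup>2 + 32 * real DIM('a) * R\<^sup>2 * real (N + 1) ^ DIM('a) * \<eta>"
    using \<gamma>(2) unfolding mult.assoc by linarith
  thus ?thesis using \<gamma>(1) unfolding wasserstein2_le_def q_def by blast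
qed

subsection \<open>Gaussian mixtures\<close>

definition gauss_mixture ::
    "real \<Rightarrow> 'j set \<Rightarrow> ('j \<Rightarrow> real) \<Rightarrow> ('j \<Rightarrow> 'a::euclidean_space) \<Rightarrow> 'a \<Rightarrow> real" where
  "gauss_mixture \<sigma> J w u y = (\<Sum>j\<in>J. w j * gdens \<sigma> (y - u j))"

definition mixture_law ::
    "real \<Rightarrow> 'j set \<Rightarrow> ('j \<Rightarrow> real) \<Rightarrow> ('j \<Rightarrow> 'a::euclidean_space) \<Rightarrow> 'a measure" where
  "mixture_law \<sigma> J w u = density lborel (\<lambda>y. ennreal (gauss_mixture \<sigma> J w u y))"

lemma borel_measurable_gauss_mixture [measurable]: "gauss_mixture \<sigma> J w u \<in> borel_measurable borel"
  unfolding gauss_mixture_def by measurable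

lemma gauss_mixture_nonneg: "prob_weights J w \<Longrightarrow> 0 \<le> gauss_mixture \<sigma> J w u y"
  unfolding gauss_mixture_def by (intro sum_nonneg) (simp add: prob_weights_def)

lemma gauss_mixture_pos:
  assumes "\<sigma> > 0" "prob_weights J w"
  shows "gauss_mixture \<sigma> J w u y > 0"
proof -
  obtain j where j: "j \<in> J" "w j \<noteq> 0"
    using prob_weights_sum[OF assms(2)] by (metis sum.neutral zero_neq_one)
  hence "w j > 0" using assms(2) by (auto simp: prob_weights_def less_le)
  hence "w j * gdens \<sigma> (y - u j) > 0" by (intro mult_pos_pos gdens_pos assms(1))
  thus ?thesis
    unfolding gauss_mixture_def using j(1) assms(2) prob_weights_finite[OF assms(2)]
    by (intro sum_pos2[of J j]) (auto simp: prob_weights_def)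
qed

lemma gauss_mixture_le_peak:
  fixes u :: "'j \<Rightarrow> 'a::euclidean_space"
  assumes "prob_weights J w"
  shows "gauss_mixture \<sigma> J w u y \<le> gdens \<sigma> (0::'a)"
  unfolding gauss_mixture_def by (intro prob_weights_mean_mono assms gdens_le_peak)

lemma gauss_mixture_ge:
  fixes u :: "'j \<Rightarrow> 'a::euclidean_space"
  assumes "prob_weights J w" "\<And>j. j \<in> J \<Longrightarrow> norm (u j) \<le> B" "norm y \<le> R"
  shows "gdens \<sigma> (0::'a) * exp (- (R + B)\<^sup>2 / (2 * \<sigma>\<^sup>2)) \<le> gauss_mixture \<sigma> J w u y"
proof -
  have "norm (y - u j) \<le> R + B" if "j \<in> J" for j
    using norm_triangle_ineq4[of y "u j"] assms(2)[OF that] assms(3) by linarith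
  hence "(\<Sum>j\<in>J. w j * (gdens \<sigma> (0::'a) * exp (- (R + B)\<^sup>2 / (2 * \<sigma>\<^sup>2)))) \<le> gauss_mixture \<sigma> J w u y"
    unfolding gauss_mixture_def using assms(1)
    by (intro sum_mono mult_left_mono gdens_ge) (auto simp: prob_weights_def)
  thus ?thesis by (simp only: prob_weights_mean_const[OF assms(1)])
qed

lemma sets_mixture_law [simp, measurable_cong]: "sets (mixture_law \<sigma> J w u) = sets borel"
  by (simp add: mixture_law_def)

lemma space_mixture_law [simp]: "space (mixture_law \<sigma> J w u) = UNIV"
  by (simp add: mixture_law_def)

lemma has_bochner_integral_mixture_law:
  fixes g :: "'a::euclidean_space \<Rightarrow> 'b::{banach, second_countable_topology}"
  assumes "\<sigma> > 0" "prob_weights J w" and [measurable]: "g \<in> borel_measurable borel"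
    and bounded: "\<And>y. norm (g y) \<le> b"
  shows "has_bochner_integral (mixture_law \<sigma> J w u) g
      (\<Sum>j\<in>J. w j *\<^sub>R (\<integral>e. g (u j + e) \<partial>gauss_vec \<sigma>))"
  unfolding mixture_law_def
proof (rule has_bochner_integral_density)
  have "has_bochner_integral lborel (\<lambda>y. \<Sum>j\<in>J. w j *\<^sub>R (gdens \<sigma> (y - u j) *\<^sub>R g y))
      (\<Sum>j\<in>J. w j *\<^sub>R (\<integral>e. g (u j + e) \<partial>gauss_vec \<sigma>))"
    by (intro has_bochner_integral_sum has_bochner_integral_scaleR_right
      has_bochner_integral_gdens_shift[OF assms(1,3) bounded])
  thus "has_bochner_integral lborel (\<lambda>y. gauss_mixture \<sigma> J w u y *\<^sub>R g y)
      (\<Sum>j\<in>J. w j *\<^sub>R (\<integral>e. g (u j + e) \<partial>gauss_vec \<sigma>))"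
    by (simp add: gauss_mixture_def scaleR_sum_left)
qed (use gauss_mixture_nonneg[OF assms(2)] in auto)

lemma prob_space_mixture_law:
  fixes u :: "'j \<Rightarrow> 'a::euclidean_space"
  assumes "\<sigma> > 0" "prob_weights J w"
  shows "prob_space (mixture_law \<sigma> J w u)"
proof
  interpret prob_space "gauss_vec \<sigma> :: 'a measure" by (rule prob_space_gauss_vec[OF assms(1)])
  have "has_bochner_integral (mixture_law \<sigma> J w u) (\<lambda>y. 1::real) 1"
    using has_bochner_integral_mixture_law[OF assms, of "\<lambda>_. 1::real" 1 u]
      prob_weights_sum[OF assms(2)]
      prob_space by simp
  hence "(\<integral>\<^sup>+ y. ennreal 1 \<partial>mixture_law \<sigma> J w u) = 1"
    by (auto simp: has_bochner_integral_iff nn_integral_eq_integral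
      simp del: ennreal_1 nn_integral_const)
  thus "emeasure (mixture_law \<sigma> J w u) (space (mixture_law \<sigma> J w u)) = 1" by simp
qed

lemma integral_mixture_law_ratio:
  assumes "\<sigma> > 0" and w: "prob_weights J w" and v: "prob_weights K v"
    and [measurable]: "g \<in> borel_measurable borel"
  shows "(\<integral>y. g y * (gauss_mixture \<sigma> K v x y / gauss_mixture \<sigma> J w u y) \<partial>mixture_law \<sigma> J w u)
       = (\<integral>y. g y \<partial>mixture_law \<sigma> K v x)"
proof -
  have "(\<integral>y. g y * (gauss_mixture \<sigma> K v x y / gauss_mixture \<sigma> J w u y) \<partial>mixture_law \<sigma> J w u)
      = (\<integral>y. gauss_mixture \<sigma> K v x y * g y \<partial>lborel)"
    unfolding mixture_law_def using gauss_mixture_nonneg[OF w]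
      gauss_mixture_pos[OF assms(1) w, of u]
    by (subst integral_real_density) (auto simp: less_imp_neq[symmetric] mult_ac)
  thus ?thesis
    unfolding mixture_law_def using gauss_mixture_nonneg[OF v] by (subst integral_real_density) auto
qed

lemma mixture_law_tail:
  fixes u :: "'j \<Rightarrow> 'a::euclidean_space"
  assumes \<sigma>: "\<sigma> > 0" and w: "prob_weights J w" and u: "\<And>j. j \<in> J \<Longrightarrow> norm (u j) \<le> B" and "B \<le> R"
  shows "measure (mixture_law \<sigma> J w u) (- cball 0 R) \<le> gauss_tail DIM('a) \<sigma> (R - B)"
proof -
  interpret prob_space "gauss_vec \<sigma> :: 'a measure" by (rule prob_space_gauss_vec[OF \<sigma>])
  let ?I = "indicator (- cball 0 R) :: 'a \<Rightarrow> real"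
  have "(\<integral>e. ?I (u j + e) \<partial>gauss_vec \<sigma>) \<le> gauss_tail DIM('a) \<sigma> (R - B)"
    if j: "j \<in> J" for j
  proof -
    have "(\<integral>e. ?I (u j + e) \<partial>gauss_vec \<sigma>) \<le> (\<integral>e. indicator {e::'a. norm e > R - B} e \<partial>gauss_vec \<sigma>)"
    proof (rule integral_mono)
      fix e :: 'a
      have "norm (u j + e) \<le> B + norm e" using norm_triangle_ineq[of "u j" e] u[OF j] by linarith
      thus "?I (u j + e) \<le> indicator {e. norm e > R - B} e" by (auto simp: indicator_def)
      show "integrable (gauss_vec \<sigma>) (\<lambda>e. ?I (u j + e))"
        by (rule integrable_const_bound[of _ 1]) (auto simp: indicator_def)
      show "integrable (gauss_vec \<sigma>) (indicator {e::'a. norm e > R - B} :: _ \<Rightarrow> real)"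
        by (rule integrable_const_bound[of _ 1]) (auto simp: indicator_def)
    qed
    also have "\<dots> = prob {e. norm e > R - B}" by simp
    also have "\<dots> \<le> gauss_tail DIM('a) \<sigma> (R - B)"
      using assms(4) by (intro gauss_vec_norm_tail \<sigma>) auto
    finally show ?thesis .
  qed
  hence "(\<Sum>j\<in>J. w j * (\<integral>e. ?I (u j + e) \<partial>gauss_vec \<sigma>)) \<le> gauss_tail DIM('a) \<sigma> (R - B)"
    by (intro prob_weights_mean_mono w)
  thus ?thesis
    using has_bochner_integral_mixture_law[OF \<sigma> w, of ?I 1 u]
    by (simp add: has_bochner_integral_iff)
qed

lemma has_bochner_integral_mixture_law_cis:
  fixes u :: "'j \<Rightarrow> 'a::euclidean_space"
  assumes "\<sigma> > 0" "prob_weights J w"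
  shows "has_bochner_integral (mixture_law \<sigma> J w u) (\<lambda>y. cis (t \<bullet> y))
           (complex_of_real (exp (- \<sigma>\<^sup>2 * (norm t)\<^sup>2 / 2)) * atomic_char J w u t)"
proof -
  have shift: "(\<integral>e. cis (t \<bullet> (u j + e)) \<partial>gauss_vec \<sigma>)
      = cis (t \<bullet> u j) * complex_of_real (exp (- \<sigma>\<^sup>2 * (norm t)\<^sup>2 / 2))" for j
    by (simp only: inner_add_right cis_mult[symmetric] integral_mult_right_zero
      gauss_vec_char[OF assms(1)])
  have "(\<lambda>y. cis (t \<bullet> y)) \<in> borel_measurable borel"
    by (intro borel_measurable_continuous_onI) (auto simp: cis_conv_exp intro!: continuous_intros)
  hence "has_bochner_integral (mixture_law \<sigma> J w u) (\<lambda>y. cis (t \<bullet> y))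
      (\<Sum>j\<in>J. w j *\<^sub>R (\<integral>e. cis (t \<bullet> (u j + e)) \<partial>gauss_vec \<sigma>))"
    by (rule has_bochner_integral_mixture_law[OF assms, where b = 1]) simp
  also have "(\<Sum>j\<in>J. w j *\<^sub>R (\<integral>e. cis (t \<bullet> (u j + e)) \<partial>gauss_vec \<sigma>))
      = complex_of_real (exp (- \<sigma>\<^sup>2 * (norm t)\<^sup>2 / 2)) * atomic_char J w u t"
    unfolding shift atomic_char_def sum_distrib_left
    by (intro sum.cong refl) (simp add: mult.commute)
  finally show ?thesis .
qed

lemma integral_mixture_law_trig:
  fixes u :: "'j \<Rightarrow> 'a::euclidean_space"
  assumes "\<sigma> > 0" "prob_weights J w"
  shows "(\<integral>y. cos (t \<bullet> y) \<partial>mixture_law \<sigma> J w u)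
      = exp (- \<sigma>\<^sup>2 * (norm t)\<^sup>2 / 2) * Re (atomic_char J w u t)"
    and "(\<integral>y. sin (t \<bullet> y) \<partial>mixture_law \<sigma> J w u)
        = exp (- \<sigma>\<^sup>2 * (norm t)\<^sup>2 / 2) * Im (atomic_char J w u t)"
  using has_bochner_integral_bounded_linear[OF bounded_linear_Re
    has_bochner_integral_mixture_law_cis[OF assms, of u t]]
    has_bochner_integral_bounded_linear[OF bounded_linear_Im
        has_bochner_integral_mixture_law_cis[OF assms, of u t]]
  by (simp_all add: has_bochner_integral_iff)

lemma mixture_dens_point_measure:
  fixes u :: "'j \<Rightarrow> 'a::euclidean_space"
  assumes "prob_weights J w"
  defines "\<nu> \<equiv> distr (point_measure J w) borel u"
  shows "prob_space \<nu>" and "sets \<nu> = sets borel" and "mixture_dens \<sigma> \<nu> y = gauss_mixture \<sigma> J w u y"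
proof -
  have fin: "finite J" and nonneg: "\<And>j. j \<in> J \<Longrightarrow> 0 \<le> w j" and total: "sum w J = 1"
    using assms(1) prob_weights_finite by (auto simp: prob_weights_def)
  have "emeasure (point_measure J w) (space (point_measure J w)) = ennreal (sum w J)"
    using nonneg fin by (simp add: space_point_measure emeasure_point_measure_finite sum_ennreal)
  hence "prob_space (point_measure J w)" using total by (intro prob_spaceI) simp
  thus "prob_space \<nu>" unfolding \<nu>_def by (rule prob_space.prob_space_distr) simp
  show "sets \<nu> = sets borel" by (simp add: \<nu>_def)
  have "mixture_dens \<sigma> \<nu> y = (\<integral>j. gdens \<sigma> (y - u j) \<partial>point_measure J w)"
    unfolding mixture_dens_def \<nu>_def by (subst integral_distr) auto
  also have "\<dots> = (\<Sum>j\<in>J. w j *\<^sub>R gdens \<sigma> (y - u j))"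
    using nonneg fin by (intro lebesgue_integral_point_measure_finite) auto
  finally show "mixture_dens \<sigma> \<nu> y = gauss_mixture \<sigma> J w u y" by (simp add: gauss_mixture_def)
qed

subsection \<open>The maximum likelihood estimator\<close>

lemma npmle_prob_weights: "is_npmle \<sigma> n Y p \<alpha> \<theta> \<Longrightarrow> prob_weights {..<p} \<alpha>"
  by (auto simp: is_npmle_def prob_weights_def less_imp_le)

lemma npmle_likelihood_ge:
  assumes "is_npmle \<sigma> n Y p \<alpha> \<theta>" "prob_weights J w"
  shows "(\<Sum>i<n. ln (gauss_mixture \<sigma> J w u (Y i))) \<le> (\<Sum>i<n. ln (gauss_mixture \<sigma> {..<p} \<alpha> \<theta> (Y i)))"
proof -
  let ?\<nu> = "distr (point_measure J w) borel u"
  have "- (\<Sum>i<n. ln (gauss_mixture \<sigma> {..<p} \<alpha> \<theta> (Y i))) \<le> - (\<Sum>i<n. ln (mixture_dens \<sigma> ?\<nu> (Y i)))"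
    using assms(1) mixture_dens_point_measure(1,2)[OF assms(2), of u]
    unfolding is_npmle_def gauss_mixture_def by blast
  thus ?thesis by (simp add: mixture_dens_point_measure(3)[OF assms(2)])
qed

lemma power2_norm_diff_closest_point_le:
  fixes x y :: "'a::euclidean_space"
  assumes "convex S" "closed S" "y \<in> S"
  shows "(norm (y - closest_point S x))\<^sup>2 + (norm (x - closest_point S x))\<^sup>2 \<le> (norm (y - x))\<^sup>2"
proof -
  define z where "z = closest_point S x"
  have "(x - z) \<bullet> (y - z) \<le> 0"
    unfolding z_def by (rule closest_point_dot[OF assms])
  moreover have "(norm (y - x))\<^sup>2 = (norm (y - z))\<^sup>2 + (norm (x - z))\<^sup>2 - 2 * ((x - z) \<bullet> (y - z))"
    by (simp add: power2_norm_eq_inner inner_diff_left inner_diff_right inner_commute)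
  ultimately show ?thesis unfolding z_def by linarith
qed

text \<open>Projecting the atoms onto \<open>S\<close> brings them closer to every observation, hence increases the
  likelihood.\<close>
lemma npmle_atoms_mem_closed_convex:
  fixes Y :: "nat \<Rightarrow> 'a::euclidean_space"
  assumes \<sigma>: "\<sigma> > 0" and n: "n > 0" and npmle: "is_npmle \<sigma> n Y p \<alpha> \<theta>"
    and S: "convex S" "closed S" and Y: "\<And>i. i < n \<Longrightarrow> Y i \<in> S" and j: "j < p"
  shows "\<theta> j \<in> S"
proof (rule ccontr)
  assume out: "\<theta> j \<notin> S"
  let ?\<theta>' = "\<lambda>j. closest_point S (\<theta> j)"
  have \<alpha>: "\<And>j. j < p \<Longrightarrow> \<alpha> j > 0" using npmle by (simp add: is_npmle_def)
  have w: "prob_weights {..<p} \<alpha>" by (rule npmle_prob_weights[OF npmle])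
  have "gauss_mixture \<sigma> {..<p} \<alpha> \<theta> (Y i) < gauss_mixture \<sigma> {..<p} \<alpha> ?\<theta>' (Y i)" if i: "i < n" for i
    unfolding gauss_mixture_def
  proof (rule sum_strict_mono_ex1)
    note closer = power2_norm_diff_closest_point_le[OF S Y[OF i]]
    show "\<forall>k\<in>{..<p}. \<alpha> k * gdens \<sigma> (Y i - \<theta> k) \<le> \<alpha> k * gdens \<sigma> (Y i - ?\<theta>' k)"
    proof
      fix k assume "k \<in> {..<p}"
      have "norm (Y i - ?\<theta>' k) \<le> norm (Y i - \<theta> k)"
        using closer[of "\<theta> k"] zero_le_power2[of "norm (\<theta> k - ?\<theta>' k)"]
        by (intro power2_le_imp_le[OF _ norm_ge_zero]) linarith
      thus "\<alpha> k * gdens \<sigma> (Y i - \<theta> k) \<le> \<alpha> k * gdens \<sigma> (Y i - ?\<theta>' k)"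
        using \<alpha>[of k] \<open>k \<in> {..<p}\<close> by (intro mult_left_mono gdens_antimono \<sigma>) auto
    qed
    have "?\<theta>' j \<in> S" using S Y[OF i] by (intro closest_point_in_set) auto
    hence "\<theta> j \<noteq> ?\<theta>' j" using out by metis
    hence "(norm (\<theta> j - ?\<theta>' j))\<^sup>2 > 0" by simp
    hence "norm (Y i - ?\<theta>' j) < norm (Y i - \<theta> j)"
      using closer[of "\<theta> j"] by (intro power2_less_imp_less[OF _ norm_ge_zero]) linarith
    hence "\<alpha> j * gdens \<sigma> (Y i - \<theta> j) < \<alpha> j * gdens \<sigma> (Y i - ?\<theta>' j)"
      using \<alpha>[OF j] by (intro mult_strict_left_mono gdens_strict_antimono \<sigma>)
    thus "\<exists>k\<in>{..<p}. \<alpha> k * gdens \<sigma> (Y i - \<theta> k) < \<alpha> k * gdens \<sigma> (Y i - ?\<theta>' k)"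
      using j by auto
  qed auto
  hence "ln (gauss_mixture \<sigma> {..<p} \<alpha> \<theta> (Y i)) < ln (gauss_mixture \<sigma> {..<p} \<alpha> ?\<theta>' (Y i))"
    if "i < n" for i
    using that gauss_mixture_pos[OF \<sigma> w] by (subst ln_less_cancel_iff) auto
  hence "(\<Sum>i<n. ln (gauss_mixture \<sigma> {..<p} \<alpha> \<theta> (Y i)))
      < (\<Sum>i<n. ln (gauss_mixture \<sigma> {..<p} \<alpha> ?\<theta>' (Y i)))"
    using n by (intro sum_strict_mono) auto
  thus False using npmle_likelihood_ge[OF npmle w, of ?\<theta>'] by simp
qed

subsection \<open>Empirical Hellinger distance\<close>

definition emp_mean :: "nat \<Rightarrow> (nat \<Rightarrow> 'a) \<Rightarrow> ('a \<Rightarrow> real) \<Rightarrow> real" where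
  "emp_mean n Y g = (\<Sum>i<n. g (Y i)) / real n"

definition emp_dev :: "nat \<Rightarrow> (nat \<Rightarrow> 'a) \<Rightarrow> 'a measure \<Rightarrow> ('a \<Rightarrow> real) \<Rightarrow> real" where
  "emp_dev n Y P g = \<bar>emp_mean n Y g - (\<integral>y. g y \<partial>P)\<bar>"

lemma emp_mean_add: "emp_mean n Y (\<lambda>y. f y + g y) = emp_mean n Y f + emp_mean n Y g"
  by (simp add: emp_mean_def sum.distrib add_divide_distrib)

lemma emp_mean_diff: "emp_mean n Y (\<lambda>y. f y - g y) = emp_mean n Y f - emp_mean n Y g"
  by (simp add: emp_mean_def sum_subtractf diff_divide_distrib)

lemma emp_mean_cmult: "emp_mean n Y (\<lambda>y. b * g y) = b * emp_mean n Y g"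
  by (simp add: emp_mean_def sum_distrib_left)

lemma emp_mean_const: "n > 0 \<Longrightarrow> emp_mean n Y (\<lambda>_. b) = b"
  by (simp add: emp_mean_def)

lemma emp_mean_mono: "(\<And>i. i < n \<Longrightarrow> f (Y i) \<le> g (Y i)) \<Longrightarrow> emp_mean n Y f \<le> emp_mean n Y g"
  unfolding emp_mean_def by (intro divide_right_mono sum_mono) auto

lemma emp_mean_nonneg: "(\<And>i. i < n \<Longrightarrow> 0 \<le> f (Y i)) \<Longrightarrow> 0 \<le> emp_mean n Y f"
  unfolding emp_mean_def by (intro divide_nonneg_nonneg sum_nonneg) auto

lemma emp_mean_Cauchy_Schwarz:
  "(emp_mean n Y (\<lambda>y. f y * g y))\<^sup>2 \<le> emp_mean n Y (\<lambda>y. (f y)\<^sup>2) * emp_mean n Y (\<lambda>y. (g y)\<^sup>2)"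
proof -
  have "(emp_mean n Y (\<lambda>y. f y * g y))\<^sup>2 = (\<Sum>i<n. f (Y i) * g (Y i))\<^sup>2 / (real n)\<^sup>2"
    by (simp add: emp_mean_def power_divide)
  also have "\<dots> \<le> ((\<Sum>i<n. (f (Y i))\<^sup>2) * (\<Sum>i<n. (g (Y i))\<^sup>2)) / (real n)\<^sup>2"
    by (intro divide_right_mono Cauchy_Schwarz_ineq_sum) auto
  finally show ?thesis by (simp add: emp_mean_def power2_eq_square)
qed

lemma ln_le_minus_hellinger:
  fixes x :: real
  assumes "x > 0"
  shows "ln x \<le> x - 1 - (sqrt x - 1)\<^sup>2"
proof -
  have "ln x = 2 * ln (sqrt x)" using assms by (simp add: ln_sqrt)
  also have "\<dots> \<le> 2 * (sqrt x - 1)" using ln_le_minus_one[of "sqrt x"] assms by simp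
  also have "\<dots> = x - 1 - (sqrt x - 1)\<^sup>2" using assms by (simp add: power2_diff)
  finally show ?thesis .
qed

lemma emp_hellinger_le:
  assumes n: "n > 0" and pos: "\<And>i. i < n \<Longrightarrow> 0 < x (Y i)" and bound: "\<And>i. i < n \<Longrightarrow> x (Y i) \<le> exp V"
    and likelihood: "0 \<le> (\<Sum>i<n. ln (x (Y i)))"
  shows "emp_mean n Y (\<lambda>y. indicator W y * (sqrt (x y) - 1)\<^sup>2)
    \<le> emp_mean n Y (\<lambda>y. indicator W y * x y) - emp_mean n Y (indicator W)
      + V * (1 - emp_mean n Y (indicator W))"
proof -
  have "0 \<le> emp_mean n Y (\<lambda>y. ln (x y))" using likelihood by (simp add: emp_mean_def)
  also have "\<dots> \<le> emp_mean n Y (\<lambda>y. (indicator W y * x y - indicator W y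
      - indicator W y * (sqrt (x y) - 1)\<^sup>2) + V * (1 - indicator W y))"
  proof (rule emp_mean_mono)
    fix i assume i: "i < n"
    have "ln (x (Y i)) \<le> V"
      using bound[OF i] pos[OF i] by (metis ln_exp ln_le_cancel_iff exp_gt_zero)
    thus "ln (x (Y i)) \<le> (indicator W (Y i) * x (Y i) - indicator W (Y i)
        - indicator W (Y i) * (sqrt (x (Y i)) - 1)\<^sup>2)
        + V * (1 - indicator W (Y i))"
      using ln_le_minus_hellinger[OF pos[OF i]] by (auto simp: indicator_def)
  qed
  finally show ?thesis using n by (simp add: emp_mean_add emp_mean_diff emp_mean_cmult
      emp_mean_const)
qed

lemma emp_L1_le_hellinger:
  assumes nonneg: "\<And>y. 0 \<le> x y"
  shows "(emp_mean n Y (\<lambda>y. indicator W y * \<bar>x y - 1\<bar>))\<^sup>2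
    \<le> emp_mean n Y (\<lambda>y. indicator W y * (sqrt (x y) - 1)\<^sup>2)
      * (2 * emp_mean n Y (\<lambda>y. indicator W y * x y) + 2 * emp_mean n Y (indicator W))"
proof -
  let ?f = "\<lambda>y. indicator W y * \<bar>sqrt (x y) - 1\<bar>" and ?g = "\<lambda>y. indicator W y * (sqrt (x y) + 1)"
  have "\<bar>x y - 1\<bar> = \<bar>sqrt (x y) - 1\<bar> * (sqrt (x y) + 1)" for y
  proof -
    have "x y - 1 = (sqrt (x y) - 1) * (sqrt (x y) + 1)"
      using nonneg[of y] by (simp add: algebra_simps)
    thus ?thesis using nonneg[of y] by (simp add: abs_mult)
  qed
  hence "(\<lambda>y. indicator W y * \<bar>x y - 1\<bar>) = (\<lambda>y. ?f y * ?g y)" by (auto simp: indicator_def)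
  hence "(emp_mean n Y (\<lambda>y. indicator W y * \<bar>x y - 1\<bar>))\<^sup>2
      \<le> emp_mean n Y (\<lambda>y. (?f y)\<^sup>2) * emp_mean n Y (\<lambda>y. (?g y)\<^sup>2)"
    using emp_mean_Cauchy_Schwarz[of n Y ?f ?g] by simp
  also have "(\<lambda>y. (?f y)\<^sup>2) = (\<lambda>y. indicator W y * (sqrt (x y) - 1)\<^sup>2)"
    by (auto simp: indicator_def)
  also have "emp_mean n Y (\<lambda>y. (?g y)\<^sup>2)
      \<le> emp_mean n Y (\<lambda>y. 2 * (indicator W y * x y) + 2 * indicator W y)"
  proof (rule emp_mean_mono)
    fix i
    have "(sqrt (x (Y i)) + 1)\<^sup>2 \<le> 2 * x (Y i) + 2"
      using zero_le_power2[of "sqrt (x (Y i)) - 1"] nonneg[of "Y i"]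
      by (simp add: power2_sum power2_diff)
    thus "(?g (Y i))\<^sup>2 \<le> 2 * (indicator W (Y i) * x (Y i)) + 2 * indicator W (Y i)"
      by (auto simp: indicator_def)
  qed
  finally show ?thesis
    by (simp add: emp_mean_add emp_mean_cmult mult_left_mono emp_mean_nonneg)
qed

definition hellinger_error :: "real \<Rightarrow> real \<Rightarrow> real \<Rightarrow> real" where
  "hellinger_error V \<tau> \<eta> = 2 * sqrt (6 * ((V + 2) * (\<eta> + \<tau>))) + 4 * \<tau> + 2 * \<eta>"

subsection \<open>Test functions of a likelihood dominating density\<close>

text \<open>\<open>x\<close> is the density, with respect to the true law, of a law with at least the likelihood of
  the true law on the sample \<open>Y\<close>; \<open>W\<close> is the set on which the empirical averages are controlled.\<close>
locale dominating_likelihood_ratio = prob_space P for P :: "'a measure" +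
  fixes x :: "'a \<Rightarrow> real" and n :: nat and Y :: "nat \<Rightarrow> 'a" and W :: "'a set"
    and T :: "('a \<Rightarrow> real) set" and V \<tau> \<eta> :: real
  assumes n_pos: "0 < n"
    and ratio_pos: "0 < x y" and ratio_integrable: "integrable P x"
    and ratio_total: "expectation x = 1"
    and likelihood: "0 \<le> (\<Sum>i<n. ln (x (Y i)))" and ratio_bound: "i < n \<Longrightarrow> x (Y i) \<le> exp V"
    and V_nonneg: "0 \<le> V"
    and W_event: "W \<in> events" and tail: "prob (space P - W) \<le> \<eta>"
    and test_measurable: "h \<in> T \<Longrightarrow> random_variable borel h" and test_bound: "h \<in> T \<Longrightarrow> \<bar>h y\<bar> \<le> 1"
    and test_one: "(\<lambda>_. 1) \<in> T"
    and dev: "h \<in> T \<Longrightarrow> emp_dev n Y P (\<lambda>y. indicator W y * h y) \<le> \<tau>"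
    and dev_ratio: "h \<in> T \<Longrightarrow> emp_dev n Y P (\<lambda>y. indicator W y * h y * x y) \<le> \<tau>"
    and \<tau>_le_1: "\<tau> \<le> 1"
begin

abbreviation "in_W \<equiv> indicator W :: 'a \<Rightarrow> real"

lemma \<tau>_nonneg: "0 \<le> \<tau>"
  using dev[OF test_one] by (simp add: emp_dev_def)

lemma \<eta>_nonneg: "0 \<le> \<eta>"
  using tail measure_nonneg order_trans by blast

lemma integrable_test:
  assumes "h \<in> T"
  shows "integrable P h" and "integrable P (\<lambda>y. h y * x y)"
proof -
  note [measurable] = test_measurable[OF assms] borel_measurable_integrable[OF ratio_integrable]
  show "integrable P h"
    using test_bound[OF assms] by (intro integrable_const_bound[of _ 1]) auto
  show "integrable P (\<lambda>y. h y * x y)"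
    using test_bound[OF assms] ratio_pos
    by (intro Bochner_Integration.integrable_bound[OF ratio_integrable])
       (auto simp: abs_mult mult_left_le_one_le less_imp_le)
qed

lemma expectation_split_inside:
  assumes "integrable P g"
  shows "expectation g = expectation (\<lambda>y. in_W y * g y) + expectation (\<lambda>y. (1 - in_W y) * g y)"
proof -
  have "integrable P (\<lambda>y. in_W y * g y)"
    using integrable_mult_indicator[OF W_event assms] by simp
  thus ?thesis using assms by (simp add: left_diff_distrib)
qed

lemma expectation_in_W_ge: "1 - \<eta> \<le> expectation in_W"
  using tail prob_compl[OF W_event] W_event by simp

lemma expectation_outside_le: "expectation (\<lambda>y. 1 - in_W y) \<le> \<eta>"
  using expectation_split_inside[of "\<lambda>_. 1"] expectation_in_W_ge by (simp add: prob_space)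

lemma emp_mean_inside:
  shows "1 - \<eta> - \<tau> \<le> emp_mean n Y in_W" and "emp_mean n Y in_W \<le> 1"
proof -
  show "1 - \<eta> - \<tau> \<le> emp_mean n Y in_W"
    using expectation_in_W_ge dev[OF test_one] by (simp add: emp_dev_def)
  show "emp_mean n Y in_W \<le> 1"
    using emp_mean_mono[of n in_W Y "\<lambda>_. 1"] emp_mean_const[OF n_pos, of Y 1]
    by (simp add: indicator_def)
qed

lemma emp_mean_ratio_inside_le: "emp_mean n Y (\<lambda>y. in_W y * x y) \<le> 1 + \<tau>"
proof -
  have "0 \<le> expectation (\<lambda>y. (1 - in_W y) * x y)"
    using ratio_pos by (intro integral_nonneg_AE AE_I2) (auto simp: indicator_def less_imp_le)
  hence "expectation (\<lambda>y. in_W y * x y) \<le> 1"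
    using expectation_split_inside[OF ratio_integrable] ratio_total by simp
  thus ?thesis using dev_ratio[OF test_one] by (simp add: emp_dev_def)
qed

lemma emp_mean_hellinger_inside_le:
  "emp_mean n Y (\<lambda>y. in_W y * (sqrt (x y) - 1)\<^sup>2) \<le> (V + 2) * (\<eta> + \<tau>)"
proof -
  have "V * (1 - emp_mean n Y in_W) \<le> V * (\<eta> + \<tau>)"
    using emp_mean_inside(1) by (intro mult_left_mono V_nonneg) linarith
  moreover have "(V + 2) * (\<eta> + \<tau>) = 2 * \<eta> + 2 * \<tau> + V * (\<eta> + \<tau>)" by (simp add: algebra_simps)
  ultimately show ?thesis
    using emp_hellinger_le[OF n_pos, of x Y V W] ratio_pos ratio_bound likelihood emp_mean_inside(1)
      emp_mean_ratio_inside_le \<eta>_nonneg by fastforce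
qed

lemma emp_mean_L1_inside_le:
  "emp_mean n Y (\<lambda>y. in_W y * \<bar>x y - 1\<bar>) \<le> sqrt (6 * ((V + 2) * (\<eta> + \<tau>)))"
proof (rule real_le_rsqrt)
  have "(emp_mean n Y (\<lambda>y. in_W y * \<bar>x y - 1\<bar>))\<^sup>2
      \<le> emp_mean n Y (\<lambda>y. in_W y * (sqrt (x y) - 1)\<^sup>2)
        * (2 * emp_mean n Y (\<lambda>y. in_W y * x y) + 2 * emp_mean n Y in_W)"
    using ratio_pos by (intro emp_L1_le_hellinger) (simp add: less_imp_le)
  also have "\<dots> \<le> ((V + 2) * (\<eta> + \<tau>)) * 6"
  proof (rule mult_mono[OF emp_mean_hellinger_inside_le])
    show "2 * emp_mean n Y (\<lambda>y. in_W y * x y) + 2 * emp_mean n Y in_W \<le> 6"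
      using emp_mean_ratio_inside_le emp_mean_inside(2) \<tau>_le_1 by linarith
    show "0 \<le> 2 * emp_mean n Y (\<lambda>y. in_W y * x y) + 2 * emp_mean n Y in_W"
      using ratio_pos by (intro add_nonneg_nonneg mult_nonneg_nonneg emp_mean_nonneg)
        (auto simp: less_imp_le)
  qed (use V_nonneg \<eta>_nonneg \<tau>_nonneg in simp)
  finally show "(emp_mean n Y (\<lambda>y. in_W y * \<bar>x y - 1\<bar>))\<^sup>2 \<le> 6 * ((V + 2) * (\<eta> + \<tau>))"
    by (simp add: mult.commute)
qed

lemma expectation_test_inside_diff_le:
  assumes h: "h \<in> T"
  shows "\<bar>expectation (\<lambda>y. in_W y * h y * x y) - expectation (\<lambda>y. in_W y * h y)\<bar>
    \<le> sqrt (6 * ((V + 2) * (\<eta> + \<tau>))) + 2 * \<tau>"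
proof -
  have "\<bar>h y * (x y - 1)\<bar> \<le> \<bar>x y - 1\<bar>" for y
    using mult_right_mono[OF test_bound[OF h, of y], of "\<bar>x y - 1\<bar>"] by (simp add: abs_mult)
  hence pointwise: "in_W y * h y * x y - in_W y * h y \<le> in_W y * \<bar>x y - 1\<bar>"
    "in_W y * h y - in_W y * h y * x y \<le> in_W y * \<bar>x y - 1\<bar>" for y
    by (auto simp: indicator_def abs_le_iff algebra_simps)
  have "emp_mean n Y (\<lambda>y. in_W y * h y * x y - in_W y * h y)
      \<le> emp_mean n Y (\<lambda>y. in_W y * \<bar>x y - 1\<bar>)"
    "emp_mean n Y (\<lambda>y. in_W y * h y - in_W y * h y * x y) \<le> emp_mean n Y (\<lambda>y. in_W y * \<bar>x y - 1\<bar>)"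
    by (intro emp_mean_mono pointwise)+
  thus ?thesis
    using dev[OF h] dev_ratio[OF h] emp_mean_L1_inside_le unfolding emp_mean_diff emp_dev_def
    by linarith
qed

lemma abs_expectation_outside_le:
  assumes h: "h \<in> T" and g: "integrable P g" "\<And>y. 0 \<le> g y"
  shows "\<bar>expectation (\<lambda>y. (1 - in_W y) * (h y * g y))\<bar> \<le> expectation (\<lambda>y. (1 - in_W y) * g y)"
proof (rule order_trans[OF integral_abs_bound integral_mono_AE'])
  show "integrable P (\<lambda>y. (1 - in_W y) * g y)"
    using integrable_mult_indicator[OF W_event g(1)] g(1) by (simp add: left_diff_distrib)
  show "AE y in P. \<bar>(1 - in_W y) * (h y * g y)\<bar> \<le> (1 - in_W y) * g y"
    using test_bound[OF h] g(2) by (intro AE_I2)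
      (auto simp: indicator_def abs_mult mult_left_le_one_le)
  show "AE y in P. 0 \<le> (1 - in_W y) * g y"
    using g(2) by (intro AE_I2) (auto simp: indicator_def)
qed

theorem expectation_test_diff_le:
  assumes h: "h \<in> T"
  shows "\<bar>expectation (\<lambda>y. h y * x y) - expectation h\<bar> \<le> hellinger_error V \<tau> \<eta>"
proof -
  define e where "e = sqrt (6 * ((V + 2) * (\<eta> + \<tau>))) + 2 * \<tau>"
  have inside: "\<bar>expectation (\<lambda>y. in_W y * h y * x y) - expectation (\<lambda>y. in_W y * h y)\<bar> \<le> e"
    if "h \<in> T" for h
    using expectation_test_inside_diff_le[OF that] by (simp add: e_def)
  have "expectation (\<lambda>y. in_W y * x y) \<ge> 1 - \<eta> - e"
    using inside[OF test_one] expectation_in_W_ge by simp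
  hence ratio_outside: "expectation (\<lambda>y. (1 - in_W y) * x y) \<le> \<eta> + e"
    using expectation_split_inside[OF ratio_integrable] ratio_total by simp
  have "\<bar>expectation (\<lambda>y. (1 - in_W y) * (h y * x y))\<bar> \<le> \<eta> + e"
    using abs_expectation_outside_le[OF h ratio_integrable] ratio_pos ratio_outside
    by (simp add: less_imp_le)
  moreover have "\<bar>expectation (\<lambda>y. (1 - in_W y) * h y)\<bar> \<le> \<eta>"
    using abs_expectation_outside_le[OF h, of "\<lambda>_. 1"] expectation_outside_le by simp
  ultimately show ?thesis
    using inside[OF h] expectation_split_inside[OF integrable_test(1)[OF h]]
      expectation_split_inside[OF integrable_test(2)[OF h]]
    by (simp add: hellinger_error_def e_def mult.assoc)
qed

end

subsection \<open>Integer grids\<close>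

lemma finite_int_grid: "finite (int_grid \<delta> N :: 'a::euclidean_space set)"
  and card_int_grid_le: "card (int_grid \<delta> N :: 'a::euclidean_space set) \<le> (2 * N + 1) ^ DIM('a)"
proof -
  define S where "S = (Basis::'a set) \<rightarrow>\<^sub>E {- int N..int N}"
  define \<Phi> where "\<Phi> z = (\<Sum>b\<in>Basis. (\<delta> * of_int (z b)) *\<^sub>R (b::'a))" for z :: "'a \<Rightarrow> int"
  have fin: "finite S" unfolding S_def by (intro finite_PiE) auto
  have sub: "int_grid \<delta> N \<subseteq> \<Phi> ` S"
  proof
    fix t :: 'a assume "t \<in> int_grid \<delta> N"
    then obtain z :: "'a \<Rightarrow> int" where z: "\<And>b. b \<in> Basis \<Longrightarrow> \<bar>z b\<bar> \<le> int N \<and> t \<bullet> b = \<delta> * of_int (z b)"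
      unfolding int_grid_def by (simp only: mem_Collect_eq) metis
    have "restrict z Basis \<in> S" using z by (fastforce simp: S_def PiE_iff abs_le_iff)
    moreover have "t = \<Phi> (restrict z Basis)"
      by (rule euclidean_eqI) (simp add: \<Phi>_def z)
    ultimately show "t \<in> \<Phi> ` S" by blast
  qed
  show "finite (int_grid \<delta> N :: 'a set)" by (rule finite_subset[OF sub]) (use fin in auto)
  have "card (int_grid \<delta> N :: 'a set) \<le> card S"
    using card_mono[OF _ sub] card_image_le[OF fin, of \<Phi>] fin by auto
  also have "\<dots> = nat (2 * int N + 1) ^ DIM('a)" by (simp add: S_def card_PiE)
  also have "nat (2 * int N + 1) = 2 * N + 1" by simp
  finally show "card (int_grid \<delta> N :: 'a set) \<le> (2 * N + 1) ^ DIM('a)" .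
qed

lemma int_grid_approx:
  fixes x :: "'a::euclidean_space"
  assumes "\<delta> > 0" "norm x \<le> \<delta> * real N"
  obtains x' where "x' \<in> int_grid \<delta> N" "norm (x - x') \<le> \<delta> * real DIM('a)"
proof -
  define x' where "x' = (\<Sum>b\<in>Basis. (\<delta> * of_int \<lfloor>(x \<bullet> b) / \<delta>\<rfloor>) *\<^sub>R b)"
  have x': "x' \<bullet> b = \<delta> * of_int \<lfloor>(x \<bullet> b) / \<delta>\<rfloor>" if "b \<in> Basis" for b
    unfolding x'_def using that by (simp only: inner_sum_left_Basis)
  show ?thesis
  proof
    show "x' \<in> int_grid \<delta> N"
      unfolding int_grid_def
    proof clarify
      fix b :: 'a assume b: "b \<in> Basis"
      have "\<bar>x \<bullet> b\<bar> \<le> \<delta> * real N" using Basis_le_norm[OF b, of x] assms(2) by linarith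
      hence "x \<bullet> b / \<delta> \<le> real N" "- real N \<le> x \<bullet> b / \<delta>" using assms(1)
        by (auto simp: field_simps abs_le_iff)
      hence "\<bar>\<lfloor>(x \<bullet> b) / \<delta>\<rfloor>\<bar> \<le> int N" by linarith
      thus "\<exists>z. \<bar>z\<bar> \<le> int N \<and> x' \<bullet> b = \<delta> * real_of_int z" using x'[OF b] by blast
    qed
    have "\<bar>(x - x') \<bullet> b\<bar> \<le> \<delta>" if b: "b \<in> Basis" for b
    proof -
      have "(x - x') \<bullet> b = \<delta> * (x \<bullet> b / \<delta> - of_int \<lfloor>(x \<bullet> b) / \<delta>\<rfloor>)"
        using assms(1) x'[OF b] by (simp add: inner_diff_left right_diff_distrib)
      moreover have "\<bar>x \<bullet> b / \<delta> - of_int \<lfloor>(x \<bullet> b) / \<delta>\<rfloor>\<bar> \<le> 1" by linarith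
      ultimately show ?thesis using assms(1) by (simp add: abs_mult mult_left_le)
    qed
    hence "(\<Sum>b\<in>Basis. \<bar>(x - x') \<bullet> b\<bar>) \<le> (\<Sum>b\<in>(Basis::'a set). \<delta>)" by (rule sum_mono)
    thus "norm (x - x') \<le> \<delta> * real DIM('a)"
      using norm_le_l1[of "x - x'"] by (simp add: mult.commute)
  qed
qed

lemma power2_norm_int_grid_le:
  assumes "t \<in> int_grid \<delta> N" "\<delta> \<ge> 0"
  shows "(norm (t::'a::euclidean_space))\<^sup>2 \<le> real DIM('a) * (\<delta> * real N)\<^sup>2"
proof -
  have "(t \<bullet> b)\<^sup>2 \<le> (\<delta> * real N)\<^sup>2" if "b \<in> Basis" for b
  proof -
    have "\<exists>z::int. \<bar>z\<bar> \<le> int N \<and> t \<bullet> b = \<delta> * of_int z"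
      using assms(1) that by (simp add: int_grid_def)
    then obtain z :: int where z: "\<bar>z\<bar> \<le> int N" "t \<bullet> b = \<delta> * of_int z" by blast
    have "\<bar>real_of_int z\<bar> \<le> real N" using z(1) by linarith
    hence "\<bar>t \<bullet> b\<bar> \<le> \<bar>\<delta> * real N\<bar>" using z(2) assms(2) by (simp add: abs_mult mult_left_mono)
    thus ?thesis by (simp only: abs_le_square_iff)
  qed
  hence "(\<Sum>b\<in>Basis. (t \<bullet> b)\<^sup>2) \<le> (\<Sum>b\<in>(Basis::'a set). (\<delta> * real N)\<^sup>2)" by (rule sum_mono)
  thus ?thesis by (simp add: power2_norm_eq_sum_Basis)
qed

subsection \<open>Concentration of empirical means\<close>

definition holds_with_prob :: "'a measure \<Rightarrow> real \<Rightarrow> ('a \<Rightarrow> bool) \<Rightarrow> bool" where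
  "holds_with_prob M q P \<longleftrightarrow> (\<exists>A\<in>sets M. q \<le> measure M A \<and> (\<forall>\<omega>\<in>A. P \<omega>))"

lemma holds_with_prob_mono:
  "holds_with_prob M q P \<Longrightarrow> q' \<le> q \<Longrightarrow> (\<And>\<omega>. P \<omega> \<Longrightarrow> P' \<omega>) \<Longrightarrow> holds_with_prob M q' P'"
  unfolding holds_with_prob_def by (meson order_trans)

lemma indep_vars_PiM_components:
  assumes "I \<noteq> {}" "\<And>i. i \<in> I \<Longrightarrow> prob_space (M i)"
  shows "prob_space.indep_vars (PiM I M) M (\<lambda>i x. x i) I"
proof -
  interpret prob_space "PiM I M" using assms(2) by (rule prob_space_PiM)
  have "distr (PiM I M) (PiM I M) (\<lambda>x. \<lambda>i\<in>I. x i) = distr (PiM I M) (PiM I M) (\<lambda>x. x)"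
    by (intro distr_cong) (auto simp: space_PiM)
  also have "\<dots> = PiM I M" by (simp add: distr_id2)
  also have "\<dots> = PiM I (\<lambda>i. distr (PiM I M) (M i) (\<lambda>x. x i))"
    using assms(2) by (intro PiM_cong) (simp_all add: distr_PiM_component)
  finally show ?thesis
    by (subst indep_vars_iff_distr_eq_PiM') (use assms in auto)
qed

lemma PiM_Hoeffding_mean:
  fixes N :: "nat \<Rightarrow> 'a measure" and g :: "nat \<Rightarrow> 'a \<Rightarrow> real"
  assumes n: "n > 0" and N: "\<And>i. i < n \<Longrightarrow> prob_space (N i)"
    and g: "\<And>i. i < n \<Longrightarrow> g i \<in> borel_measurable (N i)"
    and b: "b > 0" "\<And>i y. \<bar>g i y\<bar> \<le> b" and \<tau>: "\<tau> \<ge> 0"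
  defines "M \<equiv> PiM {..<n} N"
  shows "measure M {\<omega>\<in>space M. \<tau> \<le> \<bar>(\<Sum>i<n. g i (\<omega> i)) / real n - (\<Sum>i<n. \<integral>y. g i y \<partial>N i) / real n\<bar>}
       \<le> 2 * exp (- real n * \<tau>\<^sup>2 / (2 * b\<^sup>2))"
proof -
  interpret prob_space M unfolding M_def by (intro prob_space_PiM N) simp
  let ?X = "\<lambda>i \<omega>. g i (\<omega> i)"
  have indep: "indep_vars (\<lambda>_. borel) ?X {..<n}"
  proof (rule indep_vars_compose2[where X = "\<lambda>i x. x i" and M' = N])
    show "indep_vars N (\<lambda>i x. x i) {..<n}"
      unfolding M_def by (rule indep_vars_PiM_components) (use n N in auto)
  qed (use g in simp)
  interpret H: Hoeffding_ineq M "{..<n}" ?X "\<lambda>_. - b" "\<lambda>_. b" "\<Sum>i<n. expectation (?X i)"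
    using indep b(2) by unfold_locales (auto simp: abs_le_iff intro!: AE_I2, metis minus_le_iff)
  have expectation: "expectation (?X i) = (\<integral>y. g i y \<partial>N i)" if i: "i < n" for i
  proof -
    have "(\<integral>y. g i y \<partial>distr M (N i) (\<lambda>\<omega>. \<omega> i)) = expectation (?X i)"
      unfolding M_def using i g by (intro integral_distr) auto
    moreover have "distr M (N i) (\<lambda>\<omega>. \<omega> i) = N i"
      unfolding M_def using i N by (intro distr_PiM_component) auto
    ultimately show ?thesis by simp
  qed
  have "{\<omega>\<in>space M. \<tau> \<le> \<bar>(\<Sum>i<n. ?X i \<omega>) / real n - (\<Sum>i<n. \<integral>y. g i y \<partial>N i) / real n\<bar>}
      = {\<omega>\<in>space M. real n * \<tau> \<le> \<bar>(\<Sum>i<n. ?X i \<omega>) - (\<Sum>i<n. expectation (?X i))\<bar>}"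
    using n by (simp add: expectation abs_divide pos_le_divide_eq
      mult.commute flip: diff_divide_distrib)
  moreover have "prob {\<omega>\<in>space M. real n * \<tau> \<le> \<bar>(\<Sum>i<n. ?X i \<omega>) - (\<Sum>i<n. expectation (?X i))\<bar>}
      \<le> 2 * exp (-2 * (real n * \<tau>)\<^sup>2 / (\<Sum>i<n. (b - - b)\<^sup>2))"
    by (rule H.Hoeffding_ineq_abs_ge) (use n b \<tau> in auto)
  moreover have "-2 * (real n * \<tau>)\<^sup>2 / (\<Sum>i<n. (b - - b)\<^sup>2) = - real n * \<tau>\<^sup>2 / (2 * b\<^sup>2)"
    using n b(1) by (simp add: field_simps power2_eq_square)
  ultimately show ?thesis by simp
qed

lemma emp_dev_perturb:
  assumes "prob_space P" "n > 0" "integrable P f" "integrable P g" and close: "\<And>y. \<bar>f y - g y\<bar> \<le> \<rho>"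
  shows "emp_dev n Y P f \<le> emp_dev n Y P g + 2 * \<rho>"
proof -
  interpret prob_space P by (rule assms(1))
  have "f y - g y \<le> \<rho>" "g y - f y \<le> \<rho>" for y
    using close[of y] by linarith+
  hence "emp_mean n Y (\<lambda>y. f y - g y) \<le> emp_mean n Y (\<lambda>_. \<rho>)"
    "emp_mean n Y (\<lambda>y. g y - f y) \<le> emp_mean n Y (\<lambda>_. \<rho>)"
    by (intro emp_mean_mono; simp)+
  moreover have "\<bar>expectation f - expectation g\<bar> \<le> \<rho>"
  proof -
    have "\<bar>expectation (\<lambda>y. f y - g y)\<bar> \<le> expectation (\<lambda>y. \<bar>f y - g y\<bar>)"
      by (rule integral_abs_bound)
    also have "\<dots> \<le> expectation (\<lambda>_. \<rho>)" using assms(3,4) close by (intro integral_mono) auto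
    finally show ?thesis using assms(3,4) by (simp add: prob_space)
  qed
  ultimately show ?thesis
    unfolding emp_dev_def emp_mean_diff emp_mean_const[OF assms(2)] by linarith
qed

lemma emp_dev_weighted_mean_le:
  assumes w: "prob_weights J w" and "\<And>j. j \<in> J \<Longrightarrow> integrable P (g j)"
    and dev: "\<And>j. j \<in> J \<Longrightarrow> emp_dev n Y P (g j) \<le> \<tau>"
  shows "emp_dev n Y P (\<lambda>y. \<Sum>j\<in>J. w j * g j y) \<le> \<tau>"
proof -
  have "emp_mean n Y (\<lambda>y. \<Sum>j\<in>J. w j * g j y) = (\<Sum>j\<in>J. w j * emp_mean n Y (g j))"
    unfolding emp_mean_def by (subst sum.swap) (simp add: sum_distrib_left sum_divide_distrib)
  moreover have "(\<integral>y. (\<Sum>j\<in>J. w j * g j y) \<partial>P) = (\<Sum>j\<in>J. w j * (\<integral>y. g j y \<partial>P))"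
    using assms(2) by (subst Bochner_Integration.integral_sum) auto
  ultimately have "emp_dev n Y P (\<lambda>y. \<Sum>j\<in>J. w j * g j y)
      = \<bar>\<Sum>j\<in>J. w j * (emp_mean n Y (g j) - (\<integral>y. g j y \<partial>P))\<bar>"
    by (simp add: emp_dev_def right_diff_distrib sum_subtractf)
  also have "\<dots> \<le> (\<Sum>j\<in>J. w j * emp_dev n Y P (g j))"
    using w by (intro order_trans[OF sum_abs] sum_mono)
      (simp add: emp_dev_def abs_mult prob_weights_def)
  also have "\<dots> \<le> \<tau>" by (intro prob_weights_mean_mono w dev)
  finally show ?thesis .
qed

subsection \<open>Gaussian location samples\<close>

text \<open>On \<open>cball 0 R\<close>, a Gaussian mixture with atoms in \<open>cball 0 B\<close> is at least its largest
  possible value times \<open>exp (- log_range \<sigma> B R)\<close>.\<close>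
definition log_range :: "real \<Rightarrow> real \<Rightarrow> real \<Rightarrow> real" where
  "log_range \<sigma> B R = (R + B)\<^sup>2 / (2 * \<sigma>\<^sup>2)"

definition score_dev :: "nat \<Rightarrow> real \<Rightarrow> real \<Rightarrow> real \<Rightarrow> real \<Rightarrow> real \<Rightarrow> real" where
  "score_dev d \<sigma> B S \<delta> \<tau> = \<tau> + 2 * (exp (log_range \<sigma> B S) * (\<delta> * real d / \<sigma>))"

definition char_error :: "nat \<Rightarrow> real \<Rightarrow> real \<Rightarrow> real \<Rightarrow> real \<Rightarrow> real \<Rightarrow> real \<Rightarrow> real" where
  "char_error d \<sigma> B S R \<delta> \<tau> = hellinger_error (log_range \<sigma> B R) (score_dev d \<sigma> B S \<delta> \<tau>)
      (gauss_tail d \<sigma> (S - B))"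

definition wasserstein_bound :: "nat \<Rightarrow> real \<Rightarrow> real \<Rightarrow> real \<Rightarrow> real \<Rightarrow> nat \<Rightarrow> real \<Rightarrow> real \<Rightarrow> real" where
  "wasserstein_bound d \<sigma> B S R N \<delta> \<tau> = 16 * real d * (R * (pi / real (N + 2)))\<^sup>2
     + 32 * real d * R\<^sup>2 * real (N + 1) ^ d
         * (2 * (exp (\<sigma>\<^sup>2 * (real d * (1 / R * real N)\<^sup>2) / 2) * char_error d \<sigma> B S R \<delta> \<tau>))"

definition failure_bound :: "nat \<Rightarrow> real \<Rightarrow> real \<Rightarrow> real \<Rightarrow> nat \<Rightarrow> nat \<Rightarrow> nat \<Rightarrow> real \<Rightarrow> real \<Rightarrow> real" where
  "failure_bound d \<sigma> B S n N Z r \<tau> = real n * gauss_tail d \<sigma> r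
     + 2 * (2 * real N + 1) ^ d * (1 + (2 * real Z + 1) ^ d)
         * (2 * exp (- real n * \<tau>\<^sup>2 / (2 * (exp (log_range \<sigma> B S))\<^sup>2)))"

definition npmle_within :: "real \<Rightarrow> nat \<Rightarrow> (nat \<Rightarrow> 'a) \<Rightarrow> (nat \<Rightarrow> 'a::euclidean_space) \<Rightarrow> real \<Rightarrow> bool" where
  "npmle_within \<sigma> n Y c b \<longleftrightarrow>
     (\<forall>p \<alpha> \<theta>. is_npmle \<sigma> n Y p \<alpha> \<theta> \<longrightarrow> wasserstein2_le {..<n} (\<lambda>_. 1 / real n) c {..<p} \<alpha> \<theta> b)"

lemma npmle_within_mono: "npmle_within \<sigma> n Y c b \<Longrightarrow> b \<le> b' \<Longrightarrow> npmle_within \<sigma> n Y c b'"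
  unfolding npmle_within_def by (blast intro: wasserstein2_le_mono)

abbreviation gauss_noise :: "real \<Rightarrow> nat \<Rightarrow> (nat \<Rightarrow> 'a::euclidean_space) measure" where
  "gauss_noise \<sigma> n \<equiv> PiM {..<n} (\<lambda>_. gauss_vec \<sigma>)"

locale gauss_location_sample =
  fixes \<sigma> B :: real and n :: nat and c :: "nat \<Rightarrow> 'a::euclidean_space"
  assumes \<sigma>_pos: "0 < \<sigma>" and n_pos: "0 < n" and norm_location_le: "i < n \<Longrightarrow> norm (c i) \<le> B"
begin

abbreviation noise :: "(nat \<Rightarrow> 'a) measure" where
  "noise \<equiv> gauss_noise \<sigma> n"

abbreviation obs :: "(nat \<Rightarrow> 'a) \<Rightarrow> nat \<Rightarrow> 'a" where
  "obs \<epsilon> \<equiv> \<lambda>i. c i + \<epsilon> i"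

abbreviation dens :: "'a \<Rightarrow> real" where
  "dens \<equiv> gauss_mixture \<sigma> {..<n} (\<lambda>_. 1 / real n) c"

abbreviation law :: "'a measure" where
  "law \<equiv> mixture_law \<sigma> {..<n} (\<lambda>_. 1 / real n) c"

abbreviation ratio :: "nat \<Rightarrow> (nat \<Rightarrow> real) \<Rightarrow> (nat \<Rightarrow> 'a) \<Rightarrow> 'a \<Rightarrow> real" where
  "ratio p \<alpha> \<theta> \<equiv> \<lambda>y. gauss_mixture \<sigma> {..<p} \<alpha> \<theta> y / dens y"

definition good_noise :: "('a \<Rightarrow> real) set \<Rightarrow> real \<Rightarrow> real \<Rightarrow> (nat \<Rightarrow> 'a) set" where
  "good_noise G r \<tau> = {\<epsilon>\<in>space noise. (\<forall>i<n. norm (\<epsilon> i) \<le> r) \<and> (\<forall>g\<in>G. emp_dev n (obs \<epsilon>) law g \<le> \<tau>)}"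

lemmas uniform_weights = prob_weights_uniform[OF n_pos]
lemmas dens_pos = gauss_mixture_pos[OF \<sigma>_pos uniform_weights]

lemma prob_space_noise: "prob_space noise"
  by (intro prob_space_PiM prob_space_gauss_vec \<sigma>_pos)

lemma prob_space_law: "prob_space law"
  by (rule prob_space_mixture_law[OF \<sigma>_pos uniform_weights])

lemma measurable_noise_component: "i < n \<Longrightarrow> (\<lambda>\<epsilon>. \<epsilon> i) \<in> borel_measurable noise"
  using measurable_component_singleton[of i "{..<n}" "\<lambda>_. gauss_vec \<sigma>"]
  by (simp add: measurable_cong_sets[OF refl sets_gauss_vec])

lemma borel_measurable_emp_dev_obs:
  assumes "g \<in> borel_measurable borel"
  shows "(\<lambda>\<epsilon>. emp_dev n (obs \<epsilon>) law g) \<in> borel_measurable noise"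
  unfolding emp_dev_def emp_mean_def
  by (intro borel_measurable_abs borel_measurable_diff borel_measurable_divide borel_measurable_sum
      borel_measurable_add borel_measurable_const measurable_compose[OF _ assms]
      measurable_noise_component) auto

lemma noise_norm_tail:
  assumes "i < n" "r \<ge> 0"
  shows "measure noise {\<epsilon>\<in>space noise. r < norm (\<epsilon> i)} \<le> gauss_tail DIM('a) \<sigma> r"
proof -
  have "distr noise (gauss_vec \<sigma>) (\<lambda>\<epsilon>. \<epsilon> i) = gauss_vec \<sigma>"
    using assms(1) by (intro distr_PiM_component prob_space_gauss_vec \<sigma>_pos) auto
  moreover have "measure (distr noise (gauss_vec \<sigma>) (\<lambda>\<epsilon>. \<epsilon> i)) {e. norm e > r}
      = measure noise {\<epsilon>\<in>space noise. r < norm (\<epsilon> i)}"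
    using assms(1) by (subst measure_distr) (auto intro!: arg_cong[where f = "measure noise"])
  ultimately show ?thesis using gauss_vec_norm_tail[OF \<sigma>_pos assms(2), where 'a = 'a] by simp
qed

lemma emp_dev_obs_tail:
  assumes g: "g \<in> borel_measurable borel" and b: "b > 0" "\<And>y. \<bar>g y\<bar> \<le> b" and "\<tau> \<ge> 0"
  shows "measure noise {\<epsilon>\<in>space noise. \<tau> < emp_dev n (obs \<epsilon>) law g}
      \<le> 2 * exp (- real n * \<tau>\<^sup>2 / (2 * b\<^sup>2))"
proof -
  interpret prob_space noise by (rule prob_space_noise)
  note [measurable] = borel_measurable_emp_dev_obs[OF g]
  have mean: "(\<integral>y. g y \<partial>law) = (\<Sum>i<n. \<integral>e. g (c i + e) \<partial>gauss_vec \<sigma>) / real n"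
    using has_bochner_integral_mixture_law[OF \<sigma>_pos uniform_weights g, of b c] b(2)
    by (simp add: has_bochner_integral_iff sum_divide_distrib)
  have "prob {\<epsilon>\<in>space noise. \<tau> < emp_dev n (obs \<epsilon>) law g}
      \<le> prob {\<epsilon>\<in>space noise. \<tau> \<le> emp_dev n (obs \<epsilon>) law g}"
    by (intro finite_measure_mono) auto
  also have "\<dots> \<le> 2 * exp (- real n * \<tau>\<^sup>2 / (2 * b\<^sup>2))"
    unfolding emp_dev_def emp_mean_def mean using n_pos g b \<open>\<tau> \<ge> 0\<close> prob_space_gauss_vec[OF \<sigma>_pos]
    by (intro PiM_Hoeffding_mean) (auto intro: measurable_compose)
  finally show ?thesis .
qed

lemma good_noise_event:
  assumes G: "finite G" "\<And>g. g \<in> G \<Longrightarrow> g \<in> borel_measurable borel"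
    and b: "b > 0" "\<And>g y. g \<in> G \<Longrightarrow> \<bar>g y\<bar> \<le> b" and \<tau>: "\<tau> \<ge> 0" and r: "r \<ge> 0"
  shows "good_noise G r \<tau> \<in> sets noise"
    and "measure noise (good_noise G r \<tau>)
      \<ge> 1 - (real n * gauss_tail DIM('a) \<sigma> r
        + real (card G) * (2 * exp (- real n * \<tau>\<^sup>2 / (2 * b\<^sup>2))))"
proof -
  interpret prob_space noise by (rule prob_space_noise)
  define large_noise where "large_noise i = {\<epsilon>\<in>space noise. r < norm (\<epsilon> i)}" for i
  define large_dev where "large_dev g = {\<epsilon>\<in>space noise. \<tau> < emp_dev n (obs \<epsilon>) law g}" for g
  let ?Bad = "(\<Union>i<n. large_noise i) \<union> (\<Union>g\<in>G. large_dev g)"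
  have large_noise: "large_noise i \<in> events" if "i < n" for i
    unfolding large_noise_def using measurable_noise_component[OF that] by measurable
  have large_dev: "large_dev g \<in> events" if "g \<in> G" for g
    unfolding large_dev_def using borel_measurable_emp_dev_obs[OF G(2)[OF that]] by measurable
  have Bad: "?Bad \<in> events" using large_noise large_dev G(1) by auto
  have good: "good_noise G r \<tau> = space noise - ?Bad"
    by (auto simp: good_noise_def large_noise_def large_dev_def not_le not_less)
  show "good_noise G r \<tau> \<in> events" unfolding good using Bad by auto
  have "prob ?Bad \<le> (\<Sum>i<n. prob (large_noise i)) + (\<Sum>g\<in>G. prob (large_dev g))"
    using large_noise large_dev G(1)
    by (intro order_trans[OF measure_Un_le] add_mono measure_UNION_le) auto
  also have "\<dots> \<le> (\<Sum>i<n. gauss_tail DIM('a) \<sigma> r) + (\<Sum>g\<in>G. 2 * exp (- real n * \<tau>\<^sup>2 / (2 * b\<^sup>2)))"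
    unfolding large_noise_def large_dev_def using G(2) b \<tau> r
    by (intro add_mono sum_mono noise_norm_tail emp_dev_obs_tail) auto
  finally show "prob (good_noise G r \<tau>)
      \<ge> 1 - (real n * gauss_tail DIM('a) \<sigma> r
        + real (card G) * (2 * exp (- real n * \<tau>\<^sup>2 / (2 * b\<^sup>2))))"
    unfolding good prob_compl[OF Bad] by simp
qed

lemma gdens_peak_le_dens:
  assumes "norm y \<le> R"
  shows "gdens \<sigma> (0::'a) \<le> exp (log_range \<sigma> B R) * dens y"
proof -
  have "gdens \<sigma> (0::'a) * exp (- (R + B)\<^sup>2 / (2 * \<sigma>\<^sup>2)) \<le> dens y"
    by (rule gauss_mixture_ge[OF uniform_weights _ assms]) (simp add: norm_location_le)
  thus ?thesis by (simp add: log_range_def exp_minus field_simps)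
qed

definition trunc :: "real \<Rightarrow> ('a \<Rightarrow> real) \<Rightarrow> 'a \<Rightarrow> real" where
  "trunc R h y = indicator (cball 0 R) y * h y"

definition trunc_score :: "real \<Rightarrow> ('a \<Rightarrow> real) \<Rightarrow> 'a \<Rightarrow> 'a \<Rightarrow> real" where
  "trunc_score R h \<theta> y = indicator (cball 0 R) y * h y * (gdens \<sigma> (y - \<theta>) / dens y)"

lemma abs_trunc_le: "\<bar>h y\<bar> \<le> 1 \<Longrightarrow> \<bar>trunc R h y\<bar> \<le> 1"
  by (simp add: trunc_def indicator_def)

lemma borel_measurable_trunc:
  assumes "h \<in> borel_measurable borel"
  shows "trunc R h \<in> borel_measurable borel" and "trunc_score R h \<theta> \<in> borel_measurable borel"
proof -
  note [measurable] = assms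
  have [measurable]: "cball (0::'a) R \<in> sets borel" by simp
  show "trunc R h \<in> borel_measurable borel" "trunc_score R h \<theta> \<in> borel_measurable borel"
    unfolding trunc_def trunc_score_def by measurable
qed

lemma trunc_ratio_le:
  assumes "\<bar>t\<bar> \<le> 1" "\<bar>g\<bar> \<le> gdens \<sigma> (0::'a) * a" "0 \<le> a"
  shows "\<bar>indicator (cball 0 R) y * t * (g / dens y)\<bar> \<le> exp (log_range \<sigma> B R) * a"
proof (cases "norm y \<le> R")
  case True
  have "\<bar>g\<bar> \<le> (exp (log_range \<sigma> B R) * dens y) * a"
    using assms(2) mult_right_mono[OF gdens_peak_le_dens[OF True] assms(3)] by linarith
  hence "\<bar>g / dens y\<bar> \<le> exp (log_range \<sigma> B R) * a"
    using dens_pos[of c y] by (simp add: abs_divide pos_divide_le_eq mult_ac)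
  hence "\<bar>t\<bar> * \<bar>g / dens y\<bar> \<le> 1 * (exp (log_range \<sigma> B R) * a)"
    using assms(1) by (intro mult_mono) auto
  thus ?thesis using True by (simp add: abs_mult)
qed (use assms(3) in simp)

lemma abs_trunc_score_le: "\<bar>h y\<bar> \<le> 1 \<Longrightarrow> \<bar>trunc_score R h \<theta> y\<bar> \<le> exp (log_range \<sigma> B R)"
  using trunc_ratio_le[of "h y" "gdens \<sigma> (y - \<theta>)" 1 R y] gdens_le_peak[of \<sigma> "y - \<theta>"]
  by (simp add: trunc_score_def)

lemma trunc_score_lipschitz:
  assumes "\<bar>h y\<bar> \<le> 1"
  shows "\<bar>trunc_score R h \<theta> y - trunc_score R h \<theta>' y\<bar> \<le> exp (log_range \<sigma> B R) * (norm (\<theta> - \<theta>') / \<sigma>)"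
proof -
  have "\<bar>gdens \<sigma> (y - \<theta>) - gdens \<sigma> (y - \<theta>')\<bar> \<le> gdens \<sigma> (0::'a) * (norm (\<theta> - \<theta>') / \<sigma>)"
    using gdens_lipschitz[OF \<sigma>_pos, of "y - \<theta>" "y - \<theta>'"] by (simp add: norm_minus_commute)
  from trunc_ratio_le[OF assms this, of R y] show ?thesis
    using \<sigma>_pos by (simp add: trunc_score_def diff_divide_distrib right_diff_distrib)
qed

definition trig_tests :: "'a set \<Rightarrow> ('a \<Rightarrow> real) set" where
  "trig_tests F = (\<lambda>t y. cos (t \<bullet> y)) ` F \<union> (\<lambda>t y. sin (t \<bullet> y)) ` F"

definition controlled :: "real \<Rightarrow> ('a \<Rightarrow> real) set \<Rightarrow> 'a set \<Rightarrow> ('a \<Rightarrow> real) set" where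
  "controlled R T \<Theta> = trunc R ` T \<union> (\<lambda>(h, \<theta>). trunc_score R h \<theta>) ` (T \<times> \<Theta>)"

lemma trig_tests_measurable: "h \<in> trig_tests F \<Longrightarrow> h \<in> borel_measurable borel"
  and trig_tests_bound: "h \<in> trig_tests F \<Longrightarrow> \<bar>h y\<bar> \<le> 1"
  by (auto simp: trig_tests_def)

lemma one_mem_trig_tests: "0 \<in> F \<Longrightarrow> (\<lambda>_. 1) \<in> trig_tests F"
  unfolding trig_tests_def by (intro UnI1 image_eqI[of _ _ 0]) auto

lemma finite_trig_tests: "finite F \<Longrightarrow> finite (trig_tests F)"
  and card_trig_tests_le: "finite F \<Longrightarrow> card (trig_tests F) \<le> 2 * card F"
proof -
  assume F: "finite F"
  show "finite (trig_tests F)" using F by (simp add: trig_tests_def)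
  have "card (trig_tests F) \<le> card F + card F"
    unfolding trig_tests_def by (intro order_trans[OF card_Un_le] add_mono card_image_le F)
  thus "card (trig_tests F) \<le> 2 * card F" by simp
qed

lemma card_controlled_le:
  assumes "finite T" "finite \<Theta>"
  shows "card (controlled R T \<Theta>) \<le> card T * (1 + card \<Theta>)"
proof -
  have "card (controlled R T \<Theta>) \<le> card T + card (T \<times> \<Theta>)"
    unfolding controlled_def using assms
    by (intro order_trans[OF card_Un_le] add_mono card_image_le) auto
  thus ?thesis by (simp add: card_cartesian_product)
qed

lemma controlled_trig_tests:
  assumes "g \<in> controlled R (trig_tests F) \<Theta>"
  shows "g \<in> borel_measurable borel" and "\<bar>g y\<bar> \<le> exp (log_range \<sigma> B R)"
proof -
  show "g \<in> borel_measurable borel"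
    using assms borel_measurable_trunc trig_tests_measurable by (auto simp: controlled_def)
  have "1 \<le> exp (log_range \<sigma> B R)" by (simp add: log_range_def)
  thus "\<bar>g y\<bar> \<le> exp (log_range \<sigma> B R)"
    using assms trig_tests_bound[of _ F y] abs_trunc_le[of _ y R] abs_trunc_score_le[of _ y R]
    by (fastforce simp: controlled_def intro: order_trans)
qed

lemma emp_dev_trunc_le:
  assumes "\<epsilon> \<in> good_noise (controlled R T \<Theta>) r \<tau>" "h \<in> T" "\<delta> > 0"
  shows "emp_dev n (obs \<epsilon>) law (trunc R h) \<le> score_dev DIM('a) \<sigma> B R \<delta> \<tau>"
proof -
  have "trunc R h \<in> controlled R T \<Theta>" using assms(2) by (simp add: controlled_def)
  hence "emp_dev n (obs \<epsilon>) law (trunc R h) \<le> \<tau>" using assms(1) by (simp add: good_noise_def)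
  also have "\<tau> \<le> score_dev DIM('a) \<sigma> B R \<delta> \<tau>" using \<sigma>_pos assms(3) by (simp add: score_dev_def)
  finally show ?thesis .
qed

text \<open>A grid of atoms suffices because the scores are Lipschitz in the atom.\<close>
lemma emp_dev_trunc_score_le:
  assumes \<epsilon>: "\<epsilon> \<in> good_noise (controlled R T (int_grid \<delta> Z)) r \<tau>"
    and h: "h \<in> T" "h \<in> borel_measurable borel" "\<And>y. \<bar>h y\<bar> \<le> 1" and \<delta>: "\<delta> > 0" "norm \<theta> \<le> \<delta> * real Z"
  shows "emp_dev n (obs \<epsilon>) law (trunc_score R h \<theta>) \<le> score_dev DIM('a) \<sigma> B R \<delta> \<tau>"
proof -
  interpret prob_space law by (rule prob_space_law)
  obtain \<theta>' where \<theta>': "\<theta>' \<in> int_grid \<delta> Z" "norm (\<theta> - \<theta>') \<le> \<delta> * real DIM('a)"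
    using int_grid_approx[OF \<delta>] .
  have integrable: "integrable law (trunc_score R h \<theta>)" for \<theta>
    using borel_measurable_trunc(2)[OF h(2)] abs_trunc_score_le[OF h(3)]
    by (intro integrable_const_bound[of _ "exp (log_range \<sigma> B R)"]) auto
  have "exp (log_range \<sigma> B R) * (norm (\<theta> - \<theta>') / \<sigma>)
      \<le> exp (log_range \<sigma> B R) * (\<delta> * real DIM('a) / \<sigma>)"
    using \<theta>'(2) \<sigma>_pos by (intro mult_left_mono divide_right_mono) auto
  hence "\<bar>trunc_score R h \<theta> y - trunc_score R h \<theta>' y\<bar>
      \<le> exp (log_range \<sigma> B R) * (\<delta> * real DIM('a) / \<sigma>)" for y
    by (rule order_trans[OF trunc_score_lipschitz[OF h(3)]])
  from emp_dev_perturb[OF prob_space_law n_pos integrable integrable this]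
  have "emp_dev n (obs \<epsilon>) law (trunc_score R h \<theta>) \<le> emp_dev n (obs \<epsilon>) law (trunc_score R h \<theta>')
      + 2 * (exp (log_range \<sigma> B R) * (\<delta> * real DIM('a) / \<sigma>))" .
  moreover have "trunc_score R h \<theta>' \<in> controlled R T (int_grid \<delta> Z)"
    unfolding controlled_def using h(1) \<theta>'(1) by auto
  hence "emp_dev n (obs \<epsilon>) law (trunc_score R h \<theta>') \<le> \<tau>" using \<epsilon> by (simp add: good_noise_def)
  ultimately show ?thesis by (simp add: score_dev_def)
qed

lemma norm_obs_le:
  assumes "\<epsilon> \<in> good_noise G r \<tau>" "i < n"
  shows "norm (obs \<epsilon> i) \<le> B + r"
  using assms norm_location_le[OF assms(2)] norm_triangle_ineq[of "c i" "\<epsilon> i"]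
  by (fastforce simp: good_noise_def)

lemma npmle_atoms_bounded:
  assumes "\<epsilon> \<in> good_noise G r \<tau>" "is_npmle \<sigma> n (obs \<epsilon>) p \<alpha> \<theta>" "B + r \<le> R" "j < p"
  shows "norm (\<theta> j) \<le> R"
  using npmle_atoms_mem_closed_convex[OF \<sigma>_pos n_pos assms(2) convex_cball closed_cball, of 0 R j]
    assms(3,4)
    norm_obs_le[OF assms(1)] by force

lemma npmle_ratio_obs_le:
  assumes "\<epsilon> \<in> good_noise G r \<tau>" "is_npmle \<sigma> n (obs \<epsilon>) p \<alpha> \<theta>" "B + r \<le> R" "i < n"
  shows "ratio p \<alpha> \<theta> (obs \<epsilon> i) \<le> exp (log_range \<sigma> B R)"
proof -
  have "gauss_mixture \<sigma> {..<p} \<alpha> \<theta> (obs \<epsilon> i) \<le> gdens \<sigma> (0::'a)"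
    by (rule gauss_mixture_le_peak[OF npmle_prob_weights[OF assms(2)]])
  also have "\<dots> \<le> exp (log_range \<sigma> B R) * dens (obs \<epsilon> i)"
    using norm_obs_le[OF assms(1,4)] assms(3) by (intro gdens_peak_le_dens) linarith
  finally show ?thesis by (simp add: pos_divide_le_eq dens_pos)
qed

text \<open>The deviation is linear in the mixing measure, so it is enough to control it atom by atom.\<close>
lemma npmle_emp_dev_ratio_le:
  assumes \<epsilon>: "\<epsilon> \<in> good_noise (controlled S T (int_grid \<delta> Z)) r \<tau>"
    and npmle: "is_npmle \<sigma> n (obs \<epsilon>) p \<alpha> \<theta>"
    and h: "h \<in> T" "h \<in> borel_measurable borel" "\<And>y. \<bar>h y\<bar> \<le> 1" and "\<delta> > 0" "B + r \<le> \<delta> * real Z"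
  shows "emp_dev n (obs \<epsilon>) law (\<lambda>y. indicator (cball 0 S) y * h y * ratio p \<alpha> \<theta> y)
    \<le> score_dev DIM('a) \<sigma> B S \<delta> \<tau>"
proof -
  interpret prob_space law by (rule prob_space_law)
  have "emp_dev n (obs \<epsilon>) law (\<lambda>y. \<Sum>j<p. \<alpha> j * trunc_score S h (\<theta> j) y)
      \<le> score_dev DIM('a) \<sigma> B S \<delta> \<tau>"
  proof (rule emp_dev_weighted_mean_le[OF npmle_prob_weights[OF npmle]])
    fix j assume "j \<in> {..<p}"
    show "integrable law (trunc_score S h (\<theta> j))"
      using borel_measurable_trunc(2)[OF h(2)] abs_trunc_score_le[OF h(3)]
      by (intro integrable_const_bound[of _ "exp (log_range \<sigma> B S)"]) auto
    have "norm (\<theta> j) \<le> \<delta> * real Z"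
      using npmle_atoms_bounded[OF \<epsilon> npmle assms(7)] \<open>j \<in> {..<p}\<close> by simp
    thus "emp_dev n (obs \<epsilon>) law (trunc_score S h (\<theta> j)) \<le> score_dev DIM('a) \<sigma> B S \<delta> \<tau>"
      by (intro emp_dev_trunc_score_le[OF \<epsilon>] h \<open>\<delta> > 0\<close>)
  qed
  also have "(\<lambda>y. \<Sum>j<p. \<alpha> j * trunc_score S h (\<theta> j) y)
      = (\<lambda>y. indicator (cball 0 S) y * h y * ratio p \<alpha> \<theta> y)"
    by (rule ext) (simp add: trunc_score_def gauss_mixture_def sum_distrib_left sum_divide_distrib
      mult_ac)
  finally show ?thesis .
qed

lemma npmle_dominating_likelihood_ratio:
  assumes \<epsilon>: "\<epsilon> \<in> good_noise (controlled S (trig_tests F) (int_grid \<delta> Z)) r \<tau>"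
    and npmle: "is_npmle \<sigma> n (obs \<epsilon>) p \<alpha> \<theta>"
    and F: "0 \<in> F" and S: "B \<le> S" and R: "B + r \<le> R" "R \<le> \<delta> * real Z" and "\<delta> > 0"
    and dev: "score_dev DIM('a) \<sigma> B S \<delta> \<tau> \<le> 1"
  shows "dominating_likelihood_ratio law (ratio p \<alpha> \<theta>) n (obs \<epsilon>) (cball 0 S) (trig_tests F)
    (log_range \<sigma> B R) (score_dev DIM('a) \<sigma> B S \<delta> \<tau>) (gauss_tail DIM('a) \<sigma> (S - B))"
proof -
  interpret prob_space law by (rule prob_space_law)
  have \<alpha>: "prob_weights {..<p} \<alpha>" by (rule npmle_prob_weights[OF npmle])
  note ratio_pos = gauss_mixture_pos[OF \<sigma>_pos \<alpha>, of \<theta>] dens_pos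
  have total: "expectation (ratio p \<alpha> \<theta>) = 1"
    using integral_mixture_law_ratio[OF \<sigma>_pos uniform_weights \<alpha>, of "\<lambda>_. 1" c \<theta>]
      prob_space.prob_space[OF prob_space_mixture_law[OF \<sigma>_pos \<alpha>, of \<theta>]] by simp
  have log_ratio: "ln (ratio p \<alpha> \<theta> y) = ln (gauss_mixture \<sigma> {..<p} \<alpha> \<theta> y) - ln (dens y)" for y
    by (intro ln_divide_pos ratio_pos)
  show ?thesis
  proof (unfold_locales)
    show "integrable law (ratio p \<alpha> \<theta>)" using total not_integrable_integral_eq by fastforce
    show "0 \<le> (\<Sum>i<n. ln (ratio p \<alpha> \<theta> (obs \<epsilon> i)))"
      using npmle_likelihood_ge[OF npmle uniform_weights, of c]
      by (simp add: log_ratio sum_subtractf)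
    show "prob (space law - cball 0 S) \<le> gauss_tail DIM('a) \<sigma> (S - B)"
      using mixture_law_tail[OF \<sigma>_pos uniform_weights, of c B S] norm_location_le S
      by (simp add: Compl_eq_Diff_UNIV)
    show "emp_dev n (obs \<epsilon>) law (\<lambda>y. indicator (cball 0 S) y * h y) \<le> score_dev DIM('a) \<sigma> B S \<delta> \<tau>"
      if "h \<in> trig_tests F" for h
      using emp_dev_trunc_le[OF \<epsilon> that \<open>\<delta> > 0\<close>] by (simp add: trunc_def[abs_def])

    show "emp_dev n (obs \<epsilon>) law (\<lambda>y. indicator (cball 0 S) y * h y * ratio p \<alpha> \<theta> y)
        \<le> score_dev DIM('a) \<sigma> B S \<delta> \<tau>"
      if "h \<in> trig_tests F" for h
      using R by (intro npmle_emp_dev_ratio_le[OF \<epsilon> npmle that] trig_tests_measurable[OF that]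
        trig_tests_bound[OF that] \<open>\<delta> > 0\<close>) simp
    show "ratio p \<alpha> \<theta> (obs \<epsilon> i) \<le> exp (log_range \<sigma> B R)" if "i < n" for i
      by (rule npmle_ratio_obs_le[OF \<epsilon> npmle R(1) that])
    show "0 < ratio p \<alpha> \<theta> y" for y by (intro divide_pos_pos ratio_pos)
    show "random_variable borel h" "\<bar>h y\<bar> \<le> 1" if "h \<in> trig_tests F" for h y
      using trig_tests_measurable[OF that] trig_tests_bound[OF that] by simp_all
    show "(\<lambda>_. 1) \<in> trig_tests F" by (rule one_mem_trig_tests[OF F])
    show "0 \<le> log_range \<sigma> B R" by (simp add: log_range_def)
    show "cball 0 S \<in> events" by simp
  qed (fact n_pos total dev)+
qed

lemma npmle_atomic_char_close:
  assumes \<epsilon>: "\<epsilon> \<in> good_noise (controlled S (trig_tests F) (int_grid \<delta> Z)) r \<tau>"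
    and npmle: "is_npmle \<sigma> n (obs \<epsilon>) p \<alpha> \<theta>"
    and F: "0 \<in> F" and "B \<le> S" "B + r \<le> R" "R \<le> \<delta> * real Z" "\<delta> > 0"
    and "score_dev DIM('a) \<sigma> B S \<delta> \<tau> \<le> 1" and t: "t \<in> F"
  shows "cmod (atomic_char {..<n} (\<lambda>_. 1 / real n) c t - atomic_char {..<p} \<alpha> \<theta> t)
    \<le> 2 * (exp (\<sigma>\<^sup>2 * (norm t)\<^sup>2 / 2) * char_error DIM('a) \<sigma> B S R \<delta> \<tau>)"
    (is "_ \<le> 2 * (_ * ?e)")
proof -
  interpret dominating_likelihood_ratio law "ratio p \<alpha> \<theta>" n "obs \<epsilon>" "cball 0 S" "trig_tests F"
    "log_range \<sigma> B R" "score_dev DIM('a) \<sigma> B S \<delta> \<tau>" "gauss_tail DIM('a) \<sigma> (S - B)"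
    by (rule npmle_dominating_likelihood_ratio) fact+
  have \<alpha>: "prob_weights {..<p} \<alpha>" by (rule npmle_prob_weights[OF npmle])
  define D where "D = atomic_char {..<n} (\<lambda>_. 1 / real n) c t - atomic_char {..<p} \<alpha> \<theta> t"
  define E where "E = exp (- \<sigma>\<^sup>2 * (norm t)\<^sup>2 / 2)"
  have test: "\<bar>(\<integral>y. h y \<partial>mixture_law \<sigma> {..<p} \<alpha> \<theta>) - expectation h\<bar> \<le> ?e"
    if "h \<in> trig_tests F" for h
    using expectation_test_diff_le[OF that, folded char_error_def]
      integral_mixture_law_ratio[OF \<sigma>_pos uniform_weights \<alpha> trig_tests_measurable[OF that], of c \<theta>]
    by simp
  have "(\<lambda>y. cos (t \<bullet> y)) \<in> trig_tests F" "(\<lambda>y. sin (t \<bullet> y)) \<in> trig_tests F"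
    using t by (auto simp: trig_tests_def)
  hence "\<bar>E * Re D\<bar> \<le> ?e" "\<bar>E * Im D\<bar> \<le> ?e"
    using test by (fastforce simp: integral_mixture_law_trig[OF \<sigma>_pos \<alpha>]
        integral_mixture_law_trig[OF \<sigma>_pos uniform_weights]
        D_def E_def right_diff_distrib abs_minus_commute)+
  hence "E * cmod D \<le> 2 * ?e"
    using mult_left_mono[OF cmod_le[of D], of E] by (simp add: E_def abs_mult distrib_left)
  thus ?thesis by (simp add: D_def E_def exp_minus field_simps)
qed

lemma npmle_wasserstein2_le:
  assumes \<epsilon>: "\<epsilon> \<in> good_noise (controlled S (trig_tests (int_grid (1 / R) N)) (int_grid \<delta> Z)) r \<tau>"
    and npmle: "is_npmle \<sigma> n (obs \<epsilon>) p \<alpha> \<theta>"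
    and "B \<le> S" and R: "0 < R" "0 \<le> r" "B + r \<le> R" and "R \<le> \<delta> * real Z" "\<delta> > 0"
    and "score_dev DIM('a) \<sigma> B S \<delta> \<tau> \<le> 1"
  shows "wasserstein2_le {..<n} (\<lambda>_. 1 / real n) c {..<p} \<alpha> \<theta>
      (wasserstein_bound DIM('a) \<sigma> B S R N \<delta> \<tau>)"
  unfolding wasserstein_bound_def
proof (rule wasserstein2_le_of_close_atomic_char[OF R(1) uniform_weights
    npmle_prob_weights[OF npmle]])
  show "norm (c i) \<le> R" if "i \<in> {..<n}" for i using norm_location_le[of i] that R by simp
  show "norm (\<theta> j) \<le> R" if "j \<in> {..<p}" for j
    using npmle_atoms_bounded[OF \<epsilon> npmle R(3), of j] that by simp
  let ?e = "char_error DIM('a) \<sigma> B S R \<delta> \<tau>"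
  fix t :: 'a assume t: "t \<in> int_grid (1 / R) N"
  have close: "cmod (atomic_char {..<n} (\<lambda>_. 1 / real n) c t - atomic_char {..<p} \<alpha> \<theta> t)
      \<le> 2 * (exp (\<sigma>\<^sup>2 * (norm t)\<^sup>2 / 2) * ?e)"
    by (rule npmle_atomic_char_close[OF \<epsilon> npmle zero_mem_int_grid]) fact+
  have "0 \<le> 2 * (exp (\<sigma>\<^sup>2 * (norm t)\<^sup>2 / 2) * ?e)" by (rule order_trans[OF norm_ge_zero close])
  hence "0 \<le> ?e" by (simp add: zero_le_mult_iff)
  moreover have "\<sigma>\<^sup>2 * (norm t)\<^sup>2 / 2 \<le> \<sigma>\<^sup>2 * (real DIM('a) * (1 / R * real N)\<^sup>2) / 2"
    using power2_norm_int_grid_le[OF t] R(1) by (intro divide_right_mono mult_left_mono) auto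
  ultimately have "2 * (exp (\<sigma>\<^sup>2 * (norm t)\<^sup>2 / 2) * ?e)
      \<le> 2 * (exp (\<sigma>\<^sup>2 * (real DIM('a) * (1 / R * real N)\<^sup>2) / 2) * ?e)"
    by (simp add: mult_right_mono)
  with close show "cmod (atomic_char {..<n} (\<lambda>_. 1 / real n) c t - atomic_char {..<p} \<alpha> \<theta> t)
      \<le> 2 * (exp (\<sigma>\<^sup>2 * (real DIM('a) * (1 / R * real N)\<^sup>2) / 2) * ?e)" by (rule order_trans)
qed

lemma good_noise_controlled_event:
  fixes S R r \<delta> \<tau> :: real and N Z :: nat
  assumes "0 \<le> \<tau>" "0 \<le> r"
  defines "A \<equiv> good_noise (controlled S (trig_tests (int_grid (1 / R) N)) (int_grid \<delta> Z)) r \<tau>"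
  shows "A \<in> sets noise"
    and "1 - failure_bound DIM('a) \<sigma> B S n N Z r \<tau> \<le> measure noise A"
proof -
  let ?F = "int_grid (1 / R) N :: 'a set" and ?\<Theta> = "int_grid \<delta> Z :: 'a set"
  let ?G = "controlled S (trig_tests ?F) ?\<Theta>"
  let ?b = "exp (log_range \<sigma> B S)"
  have fin: "finite (trig_tests ?F)" "finite ?G"
    by (auto simp: controlled_def intro!: finite_trig_tests finite_int_grid)
  note event = good_noise_event[OF fin(2), of ?b \<tau> r] controlled_trig_tests[of _ S ?F ?\<Theta>] assms(1,2)
  show "A \<in> sets noise" unfolding A_def using event by simp
  have "card ?G \<le> card (trig_tests ?F) * (1 + card ?\<Theta>)"
    by (intro card_controlled_le fin finite_int_grid)
  also have "\<dots> \<le> (2 * (2 * N + 1) ^ DIM('a)) * (1 + (2 * Z + 1) ^ DIM('a))"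
    using card_trig_tests_le[OF finite_int_grid, of "1 / R" N]
      card_int_grid_le[where 'a = 'a, of "1 / R" N]
      card_int_grid_le[where 'a = 'a, of \<delta> Z]
    by (intro mult_mono) auto
  finally have "real (card ?G) \<le> real ((2 * (2 * N + 1) ^ DIM('a)) * (1 + (2 * Z + 1) ^ DIM('a)))"
    by (simp only: of_nat_le_iff)
  hence "real (card ?G) \<le> 2 * (2 * real N + 1) ^ DIM('a) * (1 + (2 * real Z + 1) ^ DIM('a))"
    by (simp add: algebra_simps)
  hence "real (card ?G) * (2 * exp (- real n * \<tau>\<^sup>2 / (2 * ?b\<^sup>2)))
      \<le> 2 * (2 * real N + 1) ^ DIM('a) * (1 + (2 * real Z + 1) ^ DIM('a))
        * (2 * exp (- real n * \<tau>\<^sup>2 / (2 * ?b\<^sup>2)))"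
    by (rule mult_right_mono) simp
  moreover have "1 - (real n * gauss_tail DIM('a) \<sigma> r
      + real (card ?G) * (2 * exp (- real n * \<tau>\<^sup>2 / (2 * ?b\<^sup>2)))) \<le> measure noise A"
    unfolding A_def using event by simp
  ultimately show "1 - failure_bound DIM('a) \<sigma> B S n N Z r \<tau> \<le> measure noise A"
    unfolding failure_bound_def by linarith
qed

theorem npmle_wasserstein2_le_with_prob:
  assumes "B \<le> S" "0 < R" "0 \<le> r" "B + r \<le> R" "R \<le> \<delta> * real Z" "\<delta> > 0" "0 \<le> \<tau>"
    and "score_dev DIM('a) \<sigma> B S \<delta> \<tau> \<le> 1"
  shows "holds_with_prob noise (1 - failure_bound DIM('a) \<sigma> B S n N Z r \<tau>)
    (\<lambda>\<epsilon>. npmle_within \<sigma> n (obs \<epsilon>) c (wasserstein_bound DIM('a) \<sigma> B S R N \<delta> \<tau>))"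
  unfolding holds_with_prob_def npmle_within_def
  using good_noise_controlled_event[OF assms(7,3),
    where S = S and R = R and N = N and \<delta> = \<delta> and Z = Z]
    npmle_wasserstein2_le[where S = S and R = R and N = N and \<delta> = \<delta> and Z = Z, OF _ _ assms(1-6,8)]
  by blast

end

subsection \<open>Rate of convergence\<close>

definition log_radius :: "real \<Rightarrow> real \<Rightarrow> nat \<Rightarrow> real" where
  "log_radius \<sigma> a n = \<sigma> * (a * sqrt (ln (real n)))"

lemma log_range_log_radius:
  assumes "\<sigma> > 0" "n > 0"
  shows "log_range \<sigma> (log_radius \<sigma> b n) (log_radius \<sigma> a n) = (a + b)\<^sup>2 / 2 * ln (real n)"
proof -
  have "log_radius \<sigma> a n + log_radius \<sigma> b n = \<sigma> * ((a + b) * sqrt (ln (real n)))"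
    by (simp add: log_radius_def algebra_simps)
  thus ?thesis using assms by (simp add: log_range_def power_mult_distrib)
qed

lemma gauss_tail_log_radius:
  assumes "\<sigma> > 0" "n > 0"
  shows "gauss_tail d \<sigma> (log_radius \<sigma> a n) = 2 powr (real d / 2) * real n powr (- a\<^sup>2 / 4)"
  using assms by (simp add: gauss_tail_def log_radius_def power_mult_distrib powr_def)

text \<open>The locations lie in the ball of radius \<open>log_radius \<sigma> (1/4) n\<close>, so the scores on the ball of
  radius \<open>log_radius \<sigma> (1/2) n\<close> are at most \<open>n powr (9/32)\<close>: a grid of mesh \<open>1 / n\<close> suffices, and
  Hoeffding's inequality with deviation \<open>n powr (-1/8)\<close> has exponent \<open>- n powr (3/16) / 2\<close>. The
  tail \<open>n powr (-1/64)\<close> makes the error of the characteristic functions \<open>n powr (-1/128)\<close> up to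
  logarithms, which beats the Gaussian factor \<open>n powr (1/200)\<close>.\<close>
definition tuned_score_dev :: "nat \<Rightarrow> real \<Rightarrow> nat \<Rightarrow> real" where
  "tuned_score_dev d \<sigma> n = score_dev d \<sigma> (log_radius \<sigma> (1/4) n) (log_radius \<sigma> (1/2) n)
     (1 / real n) (real n powr (-1/8))"

definition tuned_failure_bound :: "nat \<Rightarrow> real \<Rightarrow> nat \<Rightarrow> real" where
  "tuned_failure_bound d \<sigma> n = failure_bound d \<sigma> (log_radius \<sigma> (1/4) n) (log_radius \<sigma> (1/2) n)
     n (nat \<lfloor>ln (real n)\<rfloor>) (n\<^sup>2) (log_radius \<sigma> 4 n) (real n powr (-1/8))"

definition tuned_wasserstein_bound :: "nat \<Rightarrow> real \<Rightarrow> nat \<Rightarrow> real" where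
  "tuned_wasserstein_bound d \<sigma> n = wasserstein_bound d \<sigma> (log_radius \<sigma> (1/4) n) (log_radius \<sigma> (1/2) n)
     (log_radius \<sigma> (10 * sqrt (real d)) n) (nat \<lfloor>ln (real n)\<rfloor>) (1 / real n) (real n powr (-1/8))"

lemma exp_log_range_tuned:
  assumes "\<sigma> > 0" "n > 0"
  shows "exp (log_range \<sigma> (log_radius \<sigma> (1/4) n) (log_radius \<sigma> (1/2) n)) = real n powr (9/32)"
  using assms by (simp add: log_range_log_radius powr_def power_divide)

lemma tuned_score_dev_eq:
  assumes "\<sigma> > 0" "n > 0"
  shows "tuned_score_dev d \<sigma> n = real n powr (-1/8)
      + 2 * (real n powr (9/32) * (1 / real n * (real d / \<sigma>)))"
  by (simp add: tuned_score_dev_def score_dev_def exp_log_range_tuned[OF assms])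

lemma tuned_score_dev_eventually_le_1:
  assumes "\<sigma> > 0" "d > 0"
  shows "\<forall>\<^sub>F n in sequentially. tuned_score_dev d \<sigma> n \<le> 1"
proof -
  have "real d / \<sigma> > 0" using assms by simp
  hence "\<forall>\<^sub>F n in sequentially. real n powr (-1/8)
      + 2 * (real n powr (9/32) * (1 / real n * (real d / \<sigma>))) \<le> 1"
    by real_asymp
  thus ?thesis
    using eventually_gt_at_top[of 0] by eventually_elim (simp add: tuned_score_dev_eq[OF assms(1)])
qed

lemma tuned_failure_bound_eventually_le:
  assumes "\<sigma> > 0"
  shows "\<forall>\<^sub>F n in sequentially. tuned_failure_bound d \<sigma> n \<le> 5 / real n"
proof -
  let ?h = "\<lambda>n. 2 * exp (- real n * (real n powr (-1/8))\<^sup>2 / (2 * (real n powr (9/32))\<^sup>2))"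
  have "(2::real) powr (real d / 2) > 0" by simp
  hence "\<forall>\<^sub>F n in sequentially. real n * (2 powr (real d / 2) * real n powr (-4))
      + 2 * (2 * ln (real n) + 1) ^ d * (1 + (2 * real (n\<^sup>2) + 1) ^ d) * ?h n \<le> 5 / real n"
    by real_asymp
  thus ?thesis using eventually_gt_at_top[of 0]
  proof eventually_elim
    case (elim n)
    have "(2 * real (nat \<lfloor>ln (real n)\<rfloor>) + 1) ^ d \<le> (2 * ln (real n) + 1) ^ d"
      using elim(2) by (intro power_mono) (auto simp: of_nat_floor)
    hence "2 * (2 * real (nat \<lfloor>ln (real n)\<rfloor>) + 1) ^ d * (1 + (2 * real (n\<^sup>2) + 1) ^ d) * ?h n
        \<le> 2 * (2 * ln (real n) + 1) ^ d * (1 + (2 * real (n\<^sup>2) + 1) ^ d) * ?h n"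
      by (intro mult_right_mono mult_left_mono) auto
    moreover have "gauss_tail d \<sigma> (log_radius \<sigma> 4 n) = 2 powr (real d / 2) * real n powr (-4)"
      using gauss_tail_log_radius[OF assms elim(2), of d 4] by simp
    ultimately show ?case
      using elim(1) by (simp only: tuned_failure_bound_def failure_bound_def
        exp_log_range_tuned[OF assms elim(2)])
  qed
qed

lemma tuned_char_error_eq:
  assumes "\<sigma> > 0" "n > 0"
  shows "char_error d \<sigma> (log_radius \<sigma> (1/4) n) (log_radius \<sigma> (1/2) n) (log_radius \<sigma> q n)
      (1 / real n) (real n powr (-1/8))
    = hellinger_error ((q + 1/4)\<^sup>2 / 2 * ln (real n)) (tuned_score_dev d \<sigma> n)
      (2 powr (real d / 2) * real n powr (-1/64))"
proof -
  have "log_radius \<sigma> (1/2) n - log_radius \<sigma> (1/4) n = log_radius \<sigma> (1/4) n"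
    by (simp add: log_radius_def)
  thus ?thesis
    using gauss_tail_log_radius[OF assms, of d "1/4"]
    by (simp add: char_error_def tuned_score_dev_def log_range_log_radius[OF assms] power_divide)
qed

lemma exp_gauss_factor_tuned_le:
  assumes "\<sigma> > 0" "d > 0" "n > 1"
  shows "exp (\<sigma>\<^sup>2 * (real d * (1 / log_radius \<sigma> (10 * sqrt (real d)) n
      * real (nat \<lfloor>ln (real n)\<rfloor>))\<^sup>2) / 2) \<le> real n powr (1/200)"
proof -
  let ?N = "nat \<lfloor>ln (real n)\<rfloor>"
  have log_pos: "ln (real n) > 0" using assms by simp
  have "\<sigma>\<^sup>2 * (real d * (1 / log_radius \<sigma> (10 * sqrt (real d)) n * real ?N)\<^sup>2) / 2
      = (real ?N)\<^sup>2 / (200 * ln (real n))"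
    using assms log_pos by (simp add: log_radius_def power_mult_distrib power_divide)
  also have "\<dots> \<le> (ln (real n))\<^sup>2 / (200 * ln (real n))"
    using log_pos by (intro divide_right_mono power_mono) (auto simp: of_nat_floor)
  also have "\<dots> = 1/200 * ln (real n)" using log_pos by (simp add: power2_eq_square)
  finally show ?thesis using assms(3) by (simp add: powr_def)
qed

lemma smoothing_plus_variation_bigo:
  fixes \<sigma> a m v k D :: real
  assumes "\<sigma> > 0" "a > 0" "m > 0" "v > 0" "k > 0" "D > 0"
  shows "(\<lambda>n. 16 * m * (log_radius \<sigma> a n * (pi / real (nat \<lfloor>ln (real n)\<rfloor> + 2)))\<^sup>2
      + 32 * m * (log_radius \<sigma> a n)\<^sup>2 * real (nat \<lfloor>ln (real n)\<rfloor> + 1) ^ d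
        * (2 * (real n powr (1/200)
          * hellinger_error (v * ln (real n))
              (real n powr (-1/8) + 2 * (real n powr (9/32) * (1 / real n * D)))
              (k * real n powr (-1/64)))))
    \<in> O(\<lambda>n. 1 / ln (real n))"
  unfolding log_radius_def hellinger_error_def using assms by real_asymp

lemma tuned_wasserstein_bound_eventually_le:
  assumes \<sigma>: "\<sigma> > 0" and d: "d > 0"
  obtains C where "C > 0" "\<forall>\<^sub>F n in sequentially. tuned_wasserstein_bound d \<sigma> n \<le> C / ln (real n)"
proof -
  define a v where "a = 10 * sqrt (real d)" and "v = (10 * sqrt (real d) + 1/4)\<^sup>2 / 2"
  define e where "e n = hellinger_error (v * ln (real n))
      (real n powr (-1/8) + 2 * (real n powr (9/32) * (1 / real n * (real d / \<sigma>))))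
      (2 powr (real d / 2) * real n powr (-1/64))" for n :: nat
  define W where "W n = 16 * real d * (log_radius \<sigma> a n * (pi / real (nat \<lfloor>ln (real n)\<rfloor> + 2)))\<^sup>2
      + 32 * real d * (log_radius \<sigma> a n)\<^sup>2 * real (nat \<lfloor>ln (real n)\<rfloor> + 1) ^ d
        * (2 * (real n powr (1/200) * e n))" for n
  have pos: "a > 0" "v > 0"
    using d by (auto simp: a_def v_def add_nonneg_pos less_imp_neq[symmetric])
  have "W \<in> O(\<lambda>n. 1 / ln (real n))"
    unfolding W_def[abs_def] e_def using \<sigma> d pos by (intro smoothing_plus_variation_bigo) auto
  then obtain C where C: "C > 0" "\<forall>\<^sub>F n in sequentially. norm (W n) \<le> C * norm (1 / ln (real n))"
    by (elim landau_o.bigE)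
  have "\<forall>\<^sub>F n in sequentially. tuned_wasserstein_bound d \<sigma> n \<le> C / ln (real n)"
    using C(2) eventually_gt_at_top[of 1]
  proof eventually_elim
    case (elim n)
    hence log_pos: "ln (real n) > 0" by simp
    have "e n \<ge> 0" unfolding e_def hellinger_error_def using pos \<sigma> log_pos by simp
    moreover have "char_error d \<sigma> (log_radius \<sigma> (1/4) n) (log_radius \<sigma> (1/2) n) (log_radius \<sigma> a n)
        (1 / real n) (real n powr (-1/8)) = e n"
      using elim(2) tuned_char_error_eq[OF \<sigma>, of n d a] tuned_score_dev_eq[OF \<sigma>, of n d]
      by (simp add: e_def v_def a_def)
    ultimately have "tuned_wasserstein_bound d \<sigma> n \<le> W n"
      unfolding tuned_wasserstein_bound_def wasserstein_bound_def W_def a_def[symmetric]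
      using exp_gauss_factor_tuned_le[OF \<sigma> d elim(2), folded a_def]
      by (simp only:) (intro add_mono mult_left_mono mult_right_mono; simp)
    also have "W n \<le> C / ln (real n)" using elim(1) log_pos by simp
    finally show ?case .
  qed
  with C(1) show ?thesis by (rule that)
qed

lemma npmle_within_tuned_wasserstein_bound:
  fixes c :: "nat \<Rightarrow> 'a::euclidean_space"
  assumes \<sigma>: "\<sigma> > 0" and n: "n > 1" and c: "\<forall>i<n. norm (c i) \<le> log_radius \<sigma> (1/4) n"
    and R: "log_radius \<sigma> (10 * sqrt (real DIM('a))) n \<le> real n"
    and score: "tuned_score_dev DIM('a) \<sigma> n \<le> 1"
  shows "holds_with_prob (gauss_noise \<sigma> n) (1 - tuned_failure_bound DIM('a) \<sigma> n)
    (\<lambda>\<epsilon>. npmle_within \<sigma> n (\<lambda>i. c i + \<epsilon> i) c (tuned_wasserstein_bound DIM('a) \<sigma> n))"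
proof -
  interpret gauss_location_sample \<sigma> "log_radius \<sigma> (1/4) n" n c
    using \<sigma> n c by unfold_locales auto
  define q s where "q = 10 * sqrt (real DIM('a))" and "s = sqrt (ln (real n))"
  have s: "s > 0" using n by (simp add: s_def)
  have q: "q \<ge> 10" by (simp add: q_def Suc_leI)
  have "(1/4 + 4) * s \<le> q * s" using s q by (intro mult_right_mono) auto
  hence "\<sigma> * ((1/4 + 4) * s) \<le> \<sigma> * (q * s)" using \<sigma> by (intro mult_left_mono) auto
  hence sum: "log_radius \<sigma> (1/4) n + log_radius \<sigma> 4 n \<le> log_radius \<sigma> q n"
    by (simp add: log_radius_def s_def[symmetric] algebra_simps)
  have radii: "log_radius \<sigma> (1/4) n \<le> log_radius \<sigma> (1/2) n"
    "0 < log_radius \<sigma> q n" "0 \<le> log_radius \<sigma> 4 n"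
    using \<sigma> s q by (auto simp: log_radius_def s_def[symmetric])
  have grid: "log_radius \<sigma> q n \<le> 1 / real n * real (n\<^sup>2)"
    using R n by (simp add: q_def power2_eq_square)
  show ?thesis
    unfolding tuned_failure_bound_def tuned_wasserstein_bound_def q_def[symmetric]
    using npmle_wasserstein2_le_with_prob[OF radii sum grid _ powr_ge_zero
      score[unfolded tuned_score_dev_def]] n by simp
qed

theorem npmle_wasserstein_rate:
  fixes B \<sigma> :: real
  assumes \<sigma>: "\<sigma> > 0"
  obtains C n0 where "C > 0"
    "\<And>n (c :: nat \<Rightarrow> 'a::euclidean_space). \<lbrakk>n \<ge> n0; \<forall>i<n. norm (c i) \<le> B\<rbrakk> \<Longrightarrow>
      holds_with_prob (gauss_noise \<sigma> n) (1 - 5 / real n)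
        (\<lambda>\<epsilon>. npmle_within \<sigma> n (\<lambda>i. c i + \<epsilon> i) c (C / ln (real n)))"
proof -
  let ?d = "DIM('a)"
  let ?q = "10 * sqrt (real ?d)"
  obtain C where C: "C > 0"
    "\<forall>\<^sub>F n in sequentially. tuned_wasserstein_bound ?d \<sigma> n \<le> C / ln (real n)"
    by (rule tuned_wasserstein_bound_eventually_le[OF \<sigma> DIM_positive])
  have "\<forall>\<^sub>F n in sequentially. B \<le> log_radius \<sigma> (1/4) n"
    unfolding log_radius_def using \<sigma> by real_asymp
  moreover have "\<forall>\<^sub>F n in sequentially. log_radius \<sigma> ?q n \<le> real n"
    unfolding log_radius_def by real_asymp
  ultimately have "\<forall>\<^sub>F n in sequentially. 1 < n \<and> B \<le> log_radius \<sigma> (1/4) n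
      \<and> log_radius \<sigma> ?q n \<le> real n \<and> tuned_score_dev ?d \<sigma> n \<le> 1
      \<and> tuned_failure_bound ?d \<sigma> n \<le> 5 / real n \<and> tuned_wasserstein_bound ?d \<sigma> n \<le> C / ln (real n)"
    by (intro eventually_conj C(2) tuned_score_dev_eventually_le_1 tuned_failure_bound_eventually_le
      \<sigma> DIM_positive eventually_gt_at_top)
  then obtain n0 where large: "\<And>n. n \<ge> n0 \<Longrightarrow> 1 < n \<and> B \<le> log_radius \<sigma> (1/4) n
      \<and> log_radius \<sigma> ?q n \<le> real n \<and> tuned_score_dev ?d \<sigma> n \<le> 1
      \<and> tuned_failure_bound ?d \<sigma> n \<le> 5 / real n \<and> tuned_wasserstein_bound ?d \<sigma> n \<le> C / ln (real n)"
    unfolding eventually_sequentially by blast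
  show ?thesis
  proof (rule that[OF C(1)])
    fix n and c :: "nat \<Rightarrow> 'a" assume "n \<ge> n0" and c: "\<forall>i<n. norm (c i) \<le> B"
    note n = large[OF \<open>n \<ge> n0\<close>]
    have "\<forall>i<n. norm (c i) \<le> log_radius \<sigma> (1/4) n" using c n by (auto intro: order_trans)
    hence "holds_with_prob (gauss_noise \<sigma> n) (1 - tuned_failure_bound ?d \<sigma> n)
        (\<lambda>\<epsilon>. npmle_within \<sigma> n (\<lambda>i. c i + \<epsilon> i) c (tuned_wasserstein_bound ?d \<sigma> n))"
      using n \<sigma> by (intro npmle_within_tuned_wasserstein_bound) auto
    thus "holds_with_prob (gauss_noise \<sigma> n) (1 - 5 / real n)
        (\<lambda>\<epsilon>. npmle_within \<sigma> n (\<lambda>i. c i + \<epsilon> i) c (C / ln (real n)))"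
      by (rule holds_with_prob_mono) (use n npmle_within_mono in auto)
  qed
qed

subsection \<open>The denoising error\<close>

definition denoising_error_le ::
    "real \<Rightarrow> nat \<Rightarrow> (nat \<Rightarrow> 'a::euclidean_space) \<Rightarrow> (nat \<Rightarrow> 'a) \<Rightarrow> ('a \<Rightarrow> 'a) \<Rightarrow> real \<Rightarrow> bool" where
  "denoising_error_le \<sigma> n X Y f b \<longleftrightarrow>
     (\<forall>p \<alpha> \<theta> \<Gamma>. is_npmle \<sigma> n Y p \<alpha> \<theta> \<longrightarrow> is_opt_coupling n p X \<theta> \<alpha> \<Gamma> \<longrightarrow>
        (1 / real n) * (\<Sum>i<n. (norm (bary_proj n p \<Gamma> \<theta> i - f (X i)))\<^sup>2) \<le> b)"

lemma denoising_error_le_of_npmle_within: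
  assumes \<pi>: "\<pi> permutes {..<n}" and regular: "smooth_strongly_convex l L \<psi> f"
    and within: "npmle_within \<sigma> n Y (\<lambda>i. f (X (\<pi> i))) b"
  shows "denoising_error_le \<sigma> n X Y f ((L / l) * b)"
  unfolding denoising_error_le_def
proof (intro allI impI)
  fix p \<alpha> \<theta> \<Gamma> assume "is_npmle \<sigma> n Y p \<alpha> \<theta>" and opt: "is_opt_coupling n p X \<theta> \<alpha> \<Gamma>"
  hence "wasserstein2_le {..<n} (\<lambda>_. 1 / real n) (\<lambda>i. f (X (\<pi> i))) {..<p} \<alpha> \<theta> b"
    using within by (simp add: npmle_within_def)
  hence "wasserstein2_le {..<n} (\<lambda>_. 1 / real n) (\<lambda>i. f (X i)) {..<p} \<alpha> \<theta> b"
    by (rule wasserstein2_le_permute[OF \<pi>])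
  thus "(1 / real n) * (\<Sum>i<n. (norm (bary_proj n p \<Gamma> \<theta> i - f (X i)))\<^sup>2) \<le> (L / l) * b"
    by (rule opt_coupling_stability[OF regular opt])
qed

theorem denoising_error_rate:
  fixes B \<sigma> :: real
  assumes "\<sigma> > 0"
  obtains C n0 where "C > 0"
    "\<And>n (X :: nat \<Rightarrow> 'a::euclidean_space) \<pi> f \<psi> l L.
      \<lbrakk>n \<ge> n0; \<pi> permutes {..<n}; smooth_strongly_convex l L \<psi> f; \<forall>i<n. norm (f (X i)) \<le> B\<rbrakk> \<Longrightarrow>
      holds_with_prob (gauss_noise \<sigma> n) (1 - 5 / real n)
        (\<lambda>\<epsilon>. denoising_error_le \<sigma> n X (\<lambda>i. f (X (\<pi> i)) + \<epsilon> i) f (C * (L / l) * (1 / ln (real n))))"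
proof -
  obtain C n0 where C: "C > 0" and rate: "\<And>n (c :: nat \<Rightarrow> 'a). \<lbrakk>n \<ge> n0; \<forall>i<n. norm (c i) \<le> B\<rbrakk> \<Longrightarrow>
      holds_with_prob (gauss_noise \<sigma> n) (1 - 5 / real n)
        (\<lambda>\<epsilon>. npmle_within \<sigma> n (\<lambda>i. c i + \<epsilon> i) c (C / ln (real n)))"
    using npmle_wasserstein_rate[OF assms] by blast
  show ?thesis
  proof (rule that[OF C])
    fix n and X :: "nat \<Rightarrow> 'a" and \<pi> f \<psi> and l L :: real
    assume n: "n \<ge> n0" and \<pi>: "\<pi> permutes {..<n}" and regular: "smooth_strongly_convex l L \<psi> f"
      and bounded: "\<forall>i<n. norm (f (X i)) \<le> B"
    have "\<forall>i<n. norm (f (X (\<pi> i))) \<le> B" using bounded permutes_in_image[OF \<pi>] by simp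
    note within = rate[of n "\<lambda>i. f (X (\<pi> i))", OF n this]
    have "C * (L / l) * (1 / ln (real n)) = (L / l) * (C / ln (real n))" by simp
    thus "holds_with_prob (gauss_noise \<sigma> n) (1 - 5 / real n)
      (\<lambda>\<epsilon>. denoising_error_le \<sigma> n X (\<lambda>i. f (X (\<pi> i)) + \<epsilon> i) f (C * (L / l) * (1 / ln (real n))))"
      using denoising_error_le_of_npmle_within[OF \<pi> regular]
      by (simp only: holds_with_prob_mono[OF within order_refl])
  qed
qed

lemma holds_with_prob_small_sample:
  assumes "prob_space M" "n \<le> 5" "n = 0 \<Longrightarrow> \<forall>\<omega>. P \<omega>"
  shows "holds_with_prob M (1 - 5 / real n) P"
proof (cases "n = 0")
  case True
  thus ?thesis using prob_space.prob_space[OF assms(1)] assms(3)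
    unfolding holds_with_prob_def by (intro bexI[of _ "space M"]) auto
next
  case False
  thus ?thesis
    using assms(2) unfolding holds_with_prob_def by (intro bexI[of _ "{}"]) (auto simp: field_simps)
qed

lemma le_of_mult_power_ln_le:
  fixes x :: real
  assumes "c \<ge> 0" "x \<ge> 3" "c * ln x ^ k \<le> x"
  shows "c \<le> x"
proof -
  have "exp 1 \<le> x" using assms(2) exp_le by linarith
  hence "1 \<le> ln x ^ k" using assms(2) by (intro one_le_power) (simp add: ln_ge_iff)
  hence "c * 1 \<le> c * ln x ^ k" using assms(1) by (rule mult_left_mono)
  thus ?thesis using assms(3) by simp
qed

theorem theorem2:
  fixes B \<sigma> :: real
  assumes "B > 0" and "\<sigma> > 0"
  shows "\<exists>C0 C. C0 > 0 \<and> C > 0 \<and>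
    (\<forall>(n::nat) (X :: nat \<Rightarrow> real^'d) (\<pi> :: nat \<Rightarrow> nat) (f :: real^'d \<Rightarrow> real^'d)
       (\<psi> :: real^'d \<Rightarrow> real) (lam::real) (L::real).
      \<pi> permutes {..<n} \<longrightarrow>
      (\<forall>x. GDERIV \<psi> x :> f x) \<longrightarrow>
      lam > 0 \<longrightarrow> L > 0 \<longrightarrow>
      (\<forall>x z. \<psi> z \<ge> \<psi> x + f x \<bullet> (z - x) + lam / 2 * (norm (x - z))\<^sup>2) \<longrightarrow>
      (\<forall>x z. \<psi> z \<le> \<psi> x + f x \<bullet> (z - x) + L / 2 * (norm (x - z))\<^sup>2) \<longrightarrow>
      (\<forall>i<n. norm (f (X i)) \<le> B) \<longrightarrow>
      real n \<ge> C0 * (ln (real n)) ^ (CARD('d) + 1) \<longrightarrow>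
      (\<exists>A \<in> sets (PiM {..<n} (\<lambda>_. gauss_vec \<sigma> :: (real^'d) measure)).
         measure (PiM {..<n} (\<lambda>_. gauss_vec \<sigma> :: (real^'d) measure)) A \<ge> 1 - 5 / real n \<and>
         (\<forall>\<epsilon>\<in>A. \<forall>p \<alpha> \<theta> \<Gamma>.
            is_npmle \<sigma> n (\<lambda>i. f (X (\<pi> i)) + \<epsilon> i) p \<alpha> \<theta> \<longrightarrow>
            is_opt_coupling n p X \<theta> \<alpha> \<Gamma> \<longrightarrow>
            (1 / real n) * (\<Sum>i<n. (norm (bary_proj n p \<Gamma> \<theta> i - f (X i)))\<^sup>2)
              \<le> C * (L / lam) * (1 / ln (real n)))))"
proof -
  obtain C n0 where C: "C > 0" and rate: "\<And>n (X :: nat \<Rightarrow> real^'d) \<pi> f \<psi> l L.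
      \<lbrakk>n \<ge> n0; \<pi> permutes {..<n}; smooth_strongly_convex l L \<psi> f; \<forall>i<n. norm (f (X i)) \<le> B\<rbrakk> \<Longrightarrow>
      holds_with_prob (gauss_noise \<sigma> n) (1 - 5 / real n)
        (\<lambda>\<epsilon>. denoising_error_le \<sigma> n X (\<lambda>i. f (X (\<pi> i)) + \<epsilon> i) f (C * (L / l) * (1 / ln (real n))))"
    by (rule denoising_error_rate[OF assms(2), where 'a = "real^'d"]) (rule that, assumption, blast)
  show ?thesis
  proof (rule exI[of _ "real (Suc n0)"], rule exI[of _ C], intro conjI allI impI, goal_cases)
    case (3 n X \<pi> f \<psi> lam L)
    have "holds_with_prob (gauss_noise \<sigma> n) (1 - 5 / real n)
        (\<lambda>\<epsilon>. denoising_error_le \<sigma> n X (\<lambda>i. f (X (\<pi> i)) + \<epsilon> i) f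
          (C * (L / lam) * (1 / ln (real n))))"
    proof (cases "n \<le> 5")
      case True
      thus ?thesis
        by (intro holds_with_prob_small_sample prob_space_PiM prob_space_gauss_vec assms(2))
          (auto simp: denoising_error_le_def)
    next
      case False
      hence "real (Suc n0) \<le> real n" by (intro le_of_mult_power_ln_le[OF _ _ 3(8)]) auto
      moreover have "smooth_strongly_convex lam L \<psi> f"
        using 3(2-6) by (simp add: smooth_strongly_convex_def)
      ultimately show ?thesis using 3(1,7) by (intro rate) auto
    qed
    thus ?case unfolding holds_with_prob_def denoising_error_le_def .
  qed (use C in simp_all)
qed

end
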